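(* Let $m,n\in\mathbb N$ with $m=\big\lfloor\frac{n}{48\sqrt2\ln(4n)}\big\rfloor$. Then for every $d\in\mathbb N$, $$e^{\rm avg}(n,d;\Lambda^{\rm std})\le 4\,e^{\rm avg}(m,d;\Lambda^{\rm all}).$$ Moreover, if there are constants $A\ge1$ and $q\in(0,1)$ such that $\sqrt{\lambda_{k,d}}\le Aq^{k}\,e^{\rm avg}(0,d;\Lambda^{\rm all})$ for all $k\in\mathbb N$, then for all $n\in\mathbb N$ for which $m\ge1$, $$e^{\rm avg}(n,d;\Lambda^{\rm std})\le\frac{4A}{1-q}\,q_2^{\,n/\ln(4n)}\,e^{\rm avg}(0,d;\Lambda^{\rm all}),\qquad q_2=q^{1/(48\sqrt2)}\in(q,1).$$
   Context: Setting (average case approximation). For each $d\in\mathbb N$: $D_d\subset\mathbb R^d$ is a Borel set of positive Lebesgue measure, $\rho_d$ is a probability density on $D_d$, and $G_d=L_2(D_d,\rho_d(x)\,dx)$. $F_d$ is a separable Banach space of real-valued functions on $D_d$, continuously embedded in $G_d$, such that every point evaluation $f\mapsto f(x)$, $x\in D_d$, is a continuous linear functional on $F_d$; $F_d$ carries a zero-mean Gaussian measure $\mu_d$. ${\rm APP}_d:F_d\to G_d$, ${\rm APP}_d f=f$. $\Lambda^{\rm all}$ is the class of all continuous linear functionals on $F_d$, $\Lambda^{\rm std}$ the class of point evaluations. For $\Lambda\in\{\Lambda^{\rm all},\Lambda^{\rm std}\}$, an algorithm is $A_{n,d}f=\phi_{n,d}(L_1(f),\dots,L_n(f))$ with $L_i\in\Lambda$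 and $\phi_{n,d}:\mathbb R^n\to G_d$ measurable; its average case error is $e^{\rm avg}(A_{n,d})=\big(\int_{F_d}\|f-A_{n,d}f\|_{G_d}^2\,\mu_d(df)\big)^{1/2}$, and $e^{\rm avg}(n,d;\Lambda)$ is the infimum of $e^{\rm avg}(A_{n,d})$ over all such algorithms using $n$ functionals from $\Lambda$ (for $n=0$, $A_{0,d}=0$). $\lambda_{1,d}\ge\lambda_{2,d}\ge\dots\ge0$ denote the eigenvalues of the covariance operator $C_{\nu_d}:G_d\to G_d$ of the zero-mean Gaussian measure $\nu_d=\mu_d\circ{\rm APP}_d^{-1}$ on $G_d$; one has $e^{\rm avg}(n,d;\Lambda^{\rm all})=(\sum_{k>n}\lambda_{k,d})^{1/2}$. *)

theory Defs
  imports "HOL-Probability.Probability"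
begin

(* The space G_d = L_2(D_d, rho_d(x) dx), realised on representatives g :: real^'d => real. *)

definition L2_member :: "(real^'d) set \<Rightarrow> (real^'d \<Rightarrow> real) \<Rightarrow> (real^'d \<Rightarrow> real) \<Rightarrow> bool" where
  "L2_member D \<rho> g \<longleftrightarrow>
     (\<lambda>x. indicator D x * g x) \<in> borel_measurable lborel \<and>
     integrable lborel (\<lambda>x. indicator D x * \<rho> x * (g x)\<^sup>2)"

definition L2_inner :: "(real^'d) set \<Rightarrow> (real^'d \<Rightarrow> real) \<Rightarrow> (real^'d \<Rightarrow> real) \<Rightarrow> (real^'d \<Rightarrow> real) \<Rightarrow> real" where
  "L2_inner D \<rho> g h = (\<integral>x. indicator D x * \<rho> x * g x * h x \<partial>lborel)"

definition L2_sqnorm :: "(real^'d) set \<Rightarrow> (real^'d \<Rightarrow> real) \<Rightarrow> (real^'d \<Rightarrow> real) \<Rightarrow> ennreal" where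
  "L2_sqnorm D \<rho> g = (\<integral>\<^sup>+x\<in>D. ennreal (\<rho> x * (g x)\<^sup>2) \<partial>lborel)"

(* Standing assumptions: D Borel of positive Lebesgue measure, rho a probability density on D,
   F (the type 'f) a separable Banach space whose elements are real functions on D via evl,
   point evaluations continuous linear, F continuously embedded in G. *)
definition avg_setting ::
  "(real^'d) set \<Rightarrow> (real^'d \<Rightarrow> real) \<Rightarrow> ('f::{banach,second_countable_topology} \<Rightarrow> real^'d \<Rightarrow> real) \<Rightarrow> bool" where
  "avg_setting D \<rho> evl \<longleftrightarrow>
     D \<in> sets borel \<and> emeasure lborel D > 0 \<and>
     \<rho> \<in> borel_measurable borel \<and> (\<forall>x\<in>D. 0 \<le> \<rho> x) \<and>
     (\<integral>\<^sup>+x\<in>D. ennreal (\<rho> x) \<partial>lborel) = 1 \<and>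
     (\<forall>x\<in>D. bounded_linear (\<lambda>f. evl f x)) \<and>
     (\<forall>f. (\<forall>x\<in>D. evl f x = 0) \<longrightarrow> f = 0) \<and>
     (\<forall>f. L2_member D \<rho> (evl f)) \<and>
     (\<exists>C. \<forall>f. L2_inner D \<rho> (evl f) (evl f) \<le> C * (norm f)\<^sup>2)"

definition centered_gaussian :: "'f::real_normed_vector measure \<Rightarrow> bool" where
  "centered_gaussian \<mu> \<longleftrightarrow> prob_space \<mu> \<and> sets \<mu> = sets borel \<and>
     (\<forall>L :: 'f \<Rightarrow> real. bounded_linear L \<longrightarrow>
        (\<exists>\<sigma>\<ge>0. distr \<mu> borel L =
           (if \<sigma> = 0 then return borel 0 else density lborel (normal_density 0 \<sigma>))))"

definition Lambda_all :: "('f::real_normed_vector \<Rightarrow> real) set" where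
  "Lambda_all = {L. bounded_linear L}"

definition Lambda_std :: "('f \<Rightarrow> real^'d \<Rightarrow> real) \<Rightarrow> (real^'d) set \<Rightarrow> ('f \<Rightarrow> real) set" where
  "Lambda_std evl D = {(\<lambda>f. evl f x) | x. x \<in> D}"

(* phi : R^n -> G measurable: jointly Borel measurable, with values in G *)
definition admissible_phi :: "nat \<Rightarrow> (real^'d) set \<Rightarrow> (real^'d \<Rightarrow> real) \<Rightarrow> ((nat \<Rightarrow> real) \<Rightarrow> real^'d \<Rightarrow> real) \<Rightarrow> bool" where
  "admissible_phi n D \<rho> \<phi> \<longleftrightarrow>
     (\<lambda>p. \<phi> (fst p) (snd p)) \<in> borel_measurable (PiM {..<n} (\<lambda>_. borel) \<Otimes>\<^sub>M lborel) \<and>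
     (\<forall>y \<in> space (PiM {..<n} (\<lambda>_. (borel :: real measure))). L2_member D \<rho> (\<phi> y))"

definition algorithms :: "('f \<Rightarrow> real) set \<Rightarrow> nat \<Rightarrow> (real^'d) set \<Rightarrow> (real^'d \<Rightarrow> real) \<Rightarrow> ('f \<Rightarrow> real^'d \<Rightarrow> real) set" where
  "algorithms \<Lambda> n D \<rho> =
     (if n = 0 then {(\<lambda>f x. 0)}
      else {(\<lambda>f. \<phi> (\<lambda>i\<in>{..<n}. L i f)) | L \<phi>. (\<forall>i<n. L i \<in> \<Lambda>) \<and> admissible_phi n D \<rho> \<phi>})"

definition avg_err2 :: "'f measure \<Rightarrow> ('f \<Rightarrow> real^'d \<Rightarrow> real) \<Rightarrow> (real^'d) set \<Rightarrow> (real^'d \<Rightarrow> real) \<Rightarrow> ('f \<Rightarrow> real^'d \<Rightarrow> real) \<Rightarrow> ennreal" where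
  "avg_err2 \<mu> evl D \<rho> A = (\<integral>\<^sup>+f. L2_sqnorm D \<rho> (\<lambda>x. evl f x - A f x) \<partial>\<mu>)"

(* n-th minimal average case error e^avg(n,d;Lambda) (finite in the setting, Fernique) *)
definition e_avg :: "'f measure \<Rightarrow> ('f \<Rightarrow> real^'d \<Rightarrow> real) \<Rightarrow> (real^'d) set \<Rightarrow> (real^'d \<Rightarrow> real) \<Rightarrow> ('f \<Rightarrow> real) set \<Rightarrow> nat \<Rightarrow> real" where
  "e_avg \<mu> evl D \<rho> \<Lambda> n = sqrt (enn2real (INF A \<in> algorithms \<Lambda> n D \<rho>. avg_err2 \<mu> evl D \<rho> A))"

(* lam k = lambda_{k+1,d}: the eigenvalues (nonincreasing, with multiplicity) of the covariance
   operator C of nu = mu o APP^{-1} on G, given by  <C g, h> = int <f,g>_G <f,h>_G dmu(f),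
   expressed through its spectral decomposition C = sum_k lam k <., e_k> e_k with (e_k) orthonormal in G *)
definition cov_eigenvalues :: "'f measure \<Rightarrow> ('f \<Rightarrow> real^'d \<Rightarrow> real) \<Rightarrow> (real^'d) set \<Rightarrow> (real^'d \<Rightarrow> real) \<Rightarrow> (nat \<Rightarrow> real) \<Rightarrow> bool" where
  "cov_eigenvalues \<mu> evl D \<rho> lam \<longleftrightarrow> antimono lam \<and> (\<forall>k. 0 \<le> lam k) \<and>
     (\<exists>e :: nat \<Rightarrow> real^'d \<Rightarrow> real.
        (\<forall>k. L2_member D \<rho> (e k)) \<and>
        (\<forall>j k. L2_inner D \<rho> (e j) (e k) = (if j = k then 1 else 0)) \<and>
        (\<forall>g h. L2_member D \<rho> g \<longrightarrow> L2_member D \<rho> h \<longrightarrow>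
           (\<lambda>k. lam k * L2_inner D \<rho> g (e k) * L2_inner D \<rho> h (e k)) sums
             (\<integral>f. L2_inner D \<rho> (evl f) g * L2_inner D \<rho> (evl f) h \<partial>\<mu>)))"

definition m_of :: "nat \<Rightarrow> nat" where
  "m_of n = nat \<lfloor>real n / (48 * sqrt 2 * ln (4 * real n))\<rfloor>"

end

theory Submission
  imports Defs "Jordan_Normal_Form.Determinant"
begin

text \<open>
  Gaussianity turns any algorithm using \<open>m\<close> continuous linear functionals into one that is at least
  as good and takes values in a subspace \<open>V\<close> of \<open>G\<close> of dimension \<open>p \<le> m\<close>: the conditional
  expectation given the information is linear in it. So it suffices to recover from samples with an
  error at most \<open>4\<close> times the error \<open>\<epsilon>\<close> of the orthogonal projection onto \<open>V\<close>. Interpolation at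
  weighted Fekete points of \<open>V\<close> loses a factor polynomial in \<open>p\<close>. It is then corrected iteratively:
  estimate the Fourier coefficients of the current residual by Monte Carlo integration with \<open>2p\<close>
  points, importance sampled from the density proportional to \<open>\<Sum> e\<^sub>k\<^sup>2\<close>. Each round maps the
  squared coefficient error \<open>\<Delta>\<close> to at most \<open>(\<epsilon>\<^sup>2 + \<Delta>) / 2\<close>, so \<open>O(log p)\<close> rounds suffice, and the
  logarithm in \<open>m = n / (48 sqrt 2 ln (4n))\<close> pays for them.
\<close>

section \<open>Square integrable functions and orthonormal systems\<close>

text \<open>Monte Carlo correction cannot start from zero: its error would then involve the size of
  the function, which \<open>\<epsilon>\<close> does not control. Interpolation supplies a start
  whose error is a multiple of \<open>\<epsilon>\<close>, and since each round halves the excess, a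
  polynomial multiple is affordable. The functions need not be continuous, so optimal interpolation
  points may not exist and nearly optimal ones have to do; moreover the Fekete weight must contain
  the mean square of the projection residual, since otherwise nothing bounds the residual at the
  chosen points. Random points are replaced by points that are at least as good as the average,
  where the average also runs over \<open>\<mu>\<close>; hence one fixed set of points serves all
  functions. Gaussianity enters through moments and the conditional expectation; the recovery itself
  is a statement about square integrable random functions. Eigenvalues enter only the second claim.
  The constants are generous: the recovery gives 14 in place of \<open>16 = 4^2\<close>, and about
  \<open>13 p ln (4n)\<close> samples suffice where \<open>48 sqrt 2 p ln (4n)\<close> are
  available.\<close>

definition sq_integrable :: "'a measure \<Rightarrow> ('a \<Rightarrow> real) \<Rightarrow> bool" where
  "sq_integrable M f \<longleftrightarrow> f \<in> borel_measurable M \<and> integrable M (\<lambda>x. (f x)\<^sup>2)"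

lemma sq_integrable_measurable[measurable_dest]: "sq_integrable M f \<Longrightarrow> f \<in> borel_measurable M"
  by (simp add: sq_integrable_def)

lemma sq_integrable_sq: "sq_integrable M f \<Longrightarrow> integrable M (\<lambda>x. (f x)\<^sup>2)"
  by (simp add: sq_integrable_def)

lemma abs_mult_le_sum_squares: "\<bar>a * b\<bar> \<le> a\<^sup>2 + (b::real)\<^sup>2"
proof -
  have "0 \<le> (\<bar>a\<bar> - \<bar>b\<bar>)\<^sup>2 + a\<^sup>2 + b\<^sup>2" by simp
  then show ?thesis by (simp add: power2_diff abs_mult)
qed

lemma sq_integrable_mult:
  assumes "sq_integrable M f" "sq_integrable M g"
  shows "integrable M (\<lambda>x. f x * g x)"
proof (rule Bochner_Integration.integrable_bound[where f="\<lambda>x. (f x)\<^sup>2 + (g x)\<^sup>2"])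
  show "integrable M (\<lambda>x. (f x)\<^sup>2 + (g x)\<^sup>2)"
    using assms by (auto simp: sq_integrable_def)
  show "(\<lambda>x. f x * g x) \<in> borel_measurable M"
    using assms by (auto simp: sq_integrable_def)
  show "AE x in M. norm (f x * g x) \<le> norm ((f x)\<^sup>2 + (g x)\<^sup>2)"
    using abs_mult_le_sum_squares by (intro AE_I2) (simp add: order_trans[OF _ abs_ge_self])
qed

lemma sq_integrable_0[simp]: "sq_integrable M (\<lambda>x. 0)"
  by (simp add: sq_integrable_def)

lemma sq_integrable_cmult:
  assumes "sq_integrable M f" shows "sq_integrable M (\<lambda>x. c * f x)"
  using assms by (auto simp: sq_integrable_def power_mult_distrib)

lemma sq_integrable_add:
  assumes "sq_integrable M f" "sq_integrable M g" shows "sq_integrable M (\<lambda>x. f x + g x)"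
  using assms sq_integrable_mult[OF assms]
  by (auto simp: sq_integrable_def power2_sum mult.assoc)

lemma sq_integrable_diff:
  assumes "sq_integrable M f" "sq_integrable M g" shows "sq_integrable M (\<lambda>x. f x - g x)"
  using sq_integrable_add[OF assms(1) sq_integrable_cmult[OF assms(2), of "-1"]] by simp

lemma sq_integrable_sum:
  assumes "\<And>i. i \<in> I \<Longrightarrow> sq_integrable M (f i)" shows "sq_integrable M (\<lambda>x. \<Sum>i\<in>I. f i x)"
  using assms
proof (induction I rule: infinite_finite_induct)
  case (insert i I)
  then show ?case by (auto intro: sq_integrable_add)
qed auto

lemma sq_integrable_lin_sum:
  assumes "\<And>i. i \<in> I \<Longrightarrow> sq_integrable M (f i)" shows "sq_integrable M (\<lambda>x. \<Sum>i\<in>I. c i * f i x)"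
  by (intro sq_integrable_sum sq_integrable_cmult assms)

lemma (in finite_measure) sq_integrable_const: "sq_integrable M (\<lambda>x. c)"
  by (simp add: sq_integrable_def)

lemma (in finite_measure) sq_integrable_integrable:
  assumes "sq_integrable M f" shows "integrable M f"
  using sq_integrable_mult[OF assms sq_integrable_const[of 1]] by simp

definition orthonormal :: "'a measure \<Rightarrow> nat \<Rightarrow> (nat \<Rightarrow> 'a \<Rightarrow> real) \<Rightarrow> bool" where
  "orthonormal M p e \<longleftrightarrow> (\<forall>j<p. sq_integrable M (e j)) \<and>
     (\<forall>j<p. \<forall>k<p. (\<integral>x. e j x * e k x \<partial>M) = (if j = k then 1 else 0))"

lemma orthonormal_sq: "orthonormal M p e \<Longrightarrow> j < p \<Longrightarrow> sq_integrable M (e j)"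
  by (simp add: orthonormal_def)

lemma orthonormal_ip:
  "orthonormal M p e \<Longrightarrow> j < p \<Longrightarrow> k < p \<Longrightarrow> (\<integral>x. e j x * e k x \<partial>M) = (if j = k then 1 else 0)"
  by (simp add: orthonormal_def)

lemma orthonormal_comb_sq:
  assumes "orthonormal M p e" shows "sq_integrable M (\<lambda>x. \<Sum>k<p. c k * e k x)"
  using assms by (intro sq_integrable_lin_sum) (auto dest: orthonormal_sq)

lemma orthonormal_norm_comb:
  assumes o: "orthonormal M p e"
  shows "(\<integral>x. (\<Sum>k<p. c k * e k x)\<^sup>2 \<partial>M) = (\<Sum>k<p. (c k)\<^sup>2)"
proof -
  have i: "integrable M (\<lambda>x. c j * c k * (e j x * e k x))" if "j < p" "k < p" for j k
    using o that by (intro integrable_mult_right sq_integrable_mult) (auto dest: orthonormal_sq)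
  have "(\<integral>x. (\<Sum>k<p. c k * e k x)\<^sup>2 \<partial>M) = (\<integral>x. (\<Sum>j<p. \<Sum>k<p. c j * c k * (e j x * e k x)) \<partial>M)"
    by (simp add: power2_eq_square sum_product algebra_simps)
  also have "\<dots> = (\<Sum>j<p. \<Sum>k<p. c j * c k * (\<integral>x. e j x * e k x \<partial>M))"
    using i by (subst Bochner_Integration.integral_sum; (intro Bochner_Integration.integrable_sum)?)
      (auto intro!: sum.cong simp: Bochner_Integration.integral_sum)
  also have "\<dots> = (\<Sum>j<p. \<Sum>k<p. if j = k then (c j)\<^sup>2 else 0)"
    using o by (intro sum.cong) (auto simp: orthonormal_ip power2_eq_square)
  finally show ?thesis by simp
qed

lemma residual_expand:
  assumes o: "orthonormal M p e" and f: "sq_integrable M f"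
  shows "(\<integral>x. (f x - (\<Sum>k<p. c k * e k x))\<^sup>2 \<partial>M)
    = (\<integral>x. (f x)\<^sup>2 \<partial>M) - 2 * (\<Sum>k<p. c k * (\<integral>x. f x * e k x \<partial>M)) + (\<Sum>k<p. (c k)\<^sup>2)"
proof -
  let ?S = "\<lambda>x. \<Sum>k<p. c k * e k x"
  have S: "sq_integrable M ?S" by (rule orthonormal_comb_sq[OF o])
  have i: "integrable M (\<lambda>x. f x * e k x)" if "k < p" for k
    using o f that by (intro sq_integrable_mult) (auto dest: orthonormal_sq)
  have fS: "(\<integral>x. f x * ?S x \<partial>M) = (\<Sum>k<p. c k * (\<integral>x. f x * e k x \<partial>M))"
  proof -
    have "(\<integral>x. f x * ?S x \<partial>M) = (\<integral>x. (\<Sum>k<p. c k * (f x * e k x)) \<partial>M)"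
      by (simp add: sum_distrib_left algebra_simps)
    also have "\<dots> = (\<Sum>k<p. (\<integral>x. c k * (f x * e k x) \<partial>M))"
      using i by (intro Bochner_Integration.integral_sum) auto
    finally show ?thesis by simp
  qed
  have "(\<integral>x. (f x - ?S x)\<^sup>2 \<partial>M) = (\<integral>x. ((f x)\<^sup>2 - 2 * (f x * ?S x)) + (?S x)\<^sup>2 \<partial>M)"
    by (simp add: power2_diff algebra_simps)
  also have "\<dots> = (\<integral>x. (f x)\<^sup>2 \<partial>M) - 2 * (\<integral>x. f x * ?S x \<partial>M) + (\<integral>x. (?S x)\<^sup>2 \<partial>M)"
    using f S sq_integrable_mult[OF f S]
    by (subst Bochner_Integration.integral_add; (subst Bochner_Integration.integral_diff)?)
       (auto dest: sq_integrable_sq)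
  finally show ?thesis by (simp add: fS orthonormal_norm_comb[OF o])
qed

text \<open>Completing the square separates the error that no choice of coefficients avoids from the
  coefficient error, which is the only part that sampling has to control.\<close>

lemma residual_pythagoras:
  assumes o: "orthonormal M p e" and f: "sq_integrable M f"
  shows "(\<integral>x. (f x - (\<Sum>k<p. c k * e k x))\<^sup>2 \<partial>M)
    = (\<integral>x. (f x - (\<Sum>k<p. (\<integral>y. f y * e k y \<partial>M) * e k x))\<^sup>2 \<partial>M)
      + (\<Sum>k<p. ((\<integral>x. f x * e k x \<partial>M) - c k)\<^sup>2)"
proof -
  let ?b = "\<lambda>k. \<integral>x. f x * e k x \<partial>M"
  have "(\<Sum>k<p. (?b k - c k)\<^sup>2) = (\<Sum>k<p. (?b k)\<^sup>2) - 2 * (\<Sum>k<p. c k * ?b k) + (\<Sum>k<p. (c k)\<^sup>2)"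
    by (simp add: power2_diff sum.distrib sum_subtractf sum_distrib_left mult_ac)
  then show ?thesis
    unfolding residual_expand[OF o f] by (simp add: power2_eq_square)
qed

lemma residual_le:
  assumes "orthonormal M p e" and "sq_integrable M f"
  shows "(\<integral>x. (f x - (\<Sum>k<p. (\<integral>y. f y * e k y \<partial>M) * e k x))\<^sup>2 \<partial>M)
    \<le> (\<integral>x. (f x - (\<Sum>k<p. c k * e k x))\<^sup>2 \<partial>M)"
  unfolding residual_pythagoras[OF assms, of c] by (simp add: sum_nonneg)

lemma residual_norm:
  assumes "orthonormal M p e" and "sq_integrable M f"
  shows "(\<integral>x. (f x - (\<Sum>k<p. (\<integral>y. f y * e k y \<partial>M) * e k x))\<^sup>2 \<partial>M)
    = (\<integral>x. (f x)\<^sup>2 \<partial>M) - (\<Sum>k<p. (\<integral>x. f x * e k x \<partial>M)\<^sup>2)"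
  unfolding residual_expand[OF assms] by (simp add: power2_eq_square)

lemma bessel:
  assumes "orthonormal M p e" and "sq_integrable M f"
  shows "(\<Sum>k<p. (\<integral>x. f x * e k x \<partial>M)\<^sup>2) \<le> (\<integral>x. (f x)\<^sup>2 \<partial>M)"
  using residual_norm[OF assms] Bochner_Integration.integral_nonneg[of M "\<lambda>x. (f x - (\<Sum>k<p. (\<integral>y. f y * e k y \<partial>M) * e k x))\<^sup>2"]
  by simp

lemma residual_orthogonal:
  assumes o: "orthonormal M p e" and f: "sq_integrable M f" and j: "j < p"
  shows "(\<integral>x. (f x - (\<Sum>k<p. (\<integral>y. f y * e k y \<partial>M) * e k x)) * e j x \<partial>M) = 0"
proof -
  let ?b = "\<lambda>k. \<integral>y. f y * e k y \<partial>M"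
  have i: "integrable M (\<lambda>x. f x * e j x)" "k < p \<Longrightarrow> integrable M (\<lambda>x. e k x * e j x)" for k
    using o f j by (auto intro!: sq_integrable_mult dest: orthonormal_sq)
  have "(\<integral>x. (f x - (\<Sum>k<p. ?b k * e k x)) * e j x \<partial>M)
      = (\<integral>x. f x * e j x - (\<Sum>k<p. ?b k * (e k x * e j x)) \<partial>M)"
    by (simp add: left_diff_distrib sum_distrib_right mult.assoc)
  also have "\<dots> = ?b j - (\<Sum>k<p. ?b k * (\<integral>x. e k x * e j x \<partial>M))"
    using i by (subst Bochner_Integration.integral_diff) (auto simp: Bochner_Integration.integral_sum)
  also have "(\<Sum>k<p. ?b k * (\<integral>x. e k x * e j x \<partial>M)) = (\<Sum>k<p. if k = j then ?b k else 0)"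
    using o j by (intro sum.cong) (auto simp: orthonormal_ip)
  finally show ?thesis using j by simp
qed

lemma lin_closed_sum:
  fixes S :: "('a \<Rightarrow> real) set"
  assumes lin: "\<And>f g c. f \<in> S \<Longrightarrow> g \<in> S \<Longrightarrow> (\<lambda>x. f x + c * g x) \<in> S"
    and f: "f \<in> S" and e: "\<And>j. j < p \<Longrightarrow> e j \<in> S"
  shows "(\<lambda>x. f x - (\<Sum>j<(p::nat). c j * e j x)) \<in> S"
  using e
proof (induction p)
  case 0
  then show ?case using f by simp
next
  case (Suc p)
  have "(\<lambda>x. (f x - (\<Sum>j<p. c j * e j x)) + (- c p) * e p x) \<in> S"
    using Suc by (intro lin) auto
  then show ?case by (simp add: algebra_simps)
qed

text \<open>Functions of norm zero need not vanish, so spanning is expressed by a vanishing residual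
  norm. Dependent vectors are dropped, whence only \<open>p \<le> m\<close>. The set
  \<open>S\<close> keeps the new system in a class of representatives, later the bounded linear
  functionals.\<close>

lemma gram_schmidt:
  fixes S :: "('a \<Rightarrow> real) set"
  assumes sq: "\<And>f. f \<in> S \<Longrightarrow> sq_integrable M f"
    and lin: "\<And>f g c. f \<in> S \<Longrightarrow> g \<in> S \<Longrightarrow> (\<lambda>x. f x + c * g x) \<in> S"
    and a: "\<And>i. i < m \<Longrightarrow> a i \<in> S"
  shows "\<exists>p\<le>m. \<exists>e. (\<forall>j<p. e j \<in> S) \<and> orthonormal M p e \<and>
    (\<forall>i<m. (\<integral>x. (a i x - (\<Sum>j<p. (\<integral>y. a i y * e j y \<partial>M) * e j x))\<^sup>2 \<partial>M) = 0)"
  using a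
proof (induction m)
  case 0
  then show ?case by (auto simp: orthonormal_def)
next
  case (Suc m)
  have "\<exists>p\<le>m. \<exists>e. (\<forall>j<p. e j \<in> S) \<and> orthonormal M p e \<and>
    (\<forall>i<m. (\<integral>x. (a i x - (\<Sum>j<p. (\<integral>y. a i y * e j y \<partial>M) * e j x))\<^sup>2 \<partial>M) = 0)"
    by (rule Suc.IH) (simp add: Suc.prems)
  then obtain p e where p: "p \<le> m" and e: "\<And>j. j < p \<Longrightarrow> e j \<in> S" and o: "orthonormal M p e"
    and res: "\<And>i. i < m \<Longrightarrow> (\<integral>x. (a i x - (\<Sum>j<p. (\<integral>y. a i y * e j y \<partial>M) * e j x))\<^sup>2 \<partial>M) = 0"
    by blast
  have am: "a m \<in> S" using Suc.prems by simp
  define r where "r x = a m x - (\<Sum>j<p. (\<integral>y. a m y * e j y \<partial>M) * e j x)" for x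
  have rS: "r \<in> S" unfolding r_def[abs_def] by (rule lin_closed_sum[OF lin am e])
  define t where "t = (\<integral>x. (r x)\<^sup>2 \<partial>M)"
  show ?case
  proof (cases "t = 0")
    case True
    then have "\<forall>i<Suc m. (\<integral>x. (a i x - (\<Sum>j<p. (\<integral>y. a i y * e j y \<partial>M) * e j x))\<^sup>2 \<partial>M) = 0"
      using res by (auto simp: less_Suc_eq t_def r_def)
    then show ?thesis using p e o by (intro exI[of _ p] conjI exI[of _ e]) auto
  next
    case False
    have "t \<ge> 0" by (simp add: t_def)
    with False have t: "t > 0" by simp
    define e' where "e' j = (if j < p then e j else (\<lambda>x. r x / sqrt t))" for j
    \<comment> \<open>\<open>S\<close> is only closed under \<open>f + c * g\<close>, so the
      normalisation is written as \<open>r\<close> plus a multiple of itself.\<close>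
    have "(\<lambda>x. r x + (1 / sqrt t - 1) * r x) \<in> S" by (rule lin[OF rS rS])
    then have rS': "(\<lambda>x. r x / sqrt t) \<in> S" by (simp add: algebra_simps)
    then have e': "\<forall>j<Suc p. e' j \<in> S" using e by (auto simp: e'_def)
    have re: "(\<integral>x. r x * e j x \<partial>M) = 0" if "j < p" for j
      using residual_orthogonal[OF o sq[OF am] that] by (simp add: r_def)
    have o': "orthonormal M (Suc p) e'"
      unfolding orthonormal_def
    proof (intro conjI allI impI)
      fix j k assume jk: "j < Suc p" "k < Suc p"
      consider "j < p" "k < p" | "j < p" "k = p" | "j = p" "k < p" | "j = p" "k = p"
        using jk by linarith
      then show "(\<integral>x. e' j x * e' k x \<partial>M) = (if j = k then 1 else 0)"
      proof cases
        case 1 then show ?thesis using o by (simp add: e'_def orthonormal_ip)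
      next
        case 2 then show ?thesis using re[of j] by (simp add: e'_def mult.commute)
      next
        case 3 then show ?thesis using re[of k] by (simp add: e'_def)
      next
        case 4 
        have "(\<integral>x. (r x)\<^sup>2 / t \<partial>M) = 1" using t by (simp flip: t_def)
        then show ?thesis using 4 t by (simp add: e'_def power2_eq_square real_sqrt_mult_self)
      qed
    qed (use e' sq in auto)
    have "(\<integral>x. (a i x - (\<Sum>j<Suc p. (\<integral>y. a i y * e' j y \<partial>M) * e' j x))\<^sup>2 \<partial>M) = 0" if "i < Suc m" for i
    proof -
      have ai: "sq_integrable M (a i)" using Suc.prems that sq by blast
      \<comment> \<open>Explicit coefficients with vanishing residual: the old vectors ignore the
        new direction, and \<open>a m\<close> has component \<open>sqrt t\<close> along it. The
        Fourier coefficients can only do better.\<close>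
      define c where "c j = (if j < p then (\<integral>y. a i y * e j y \<partial>M) else if i < m then 0 else sqrt t)" for j
      have "(\<integral>x. (a i x - (\<Sum>j<Suc p. c j * e' j x))\<^sup>2 \<partial>M) = 0"
      proof (cases "i < m")
        case True then show ?thesis using res[OF True] by (simp add: c_def e'_def)
      next
        case False
        then have "i = m" using that by simp
        then show ?thesis using t False by (simp add: c_def e'_def r_def)
      qed
      moreover have "0 \<le> (\<integral>x. (a i x - (\<Sum>j<Suc p. (\<integral>y. a i y * e' j y \<partial>M) * e' j x))\<^sup>2 \<partial>M)"
        by simp
      ultimately show ?thesis using residual_le[OF o' ai, of c] by linarith
    qed
    then show ?thesis using p e' o' by (intro exI[of _ "Suc p"] conjI exI[of _ e']) auto
  qed
qed

section \<open>Gaussian functionals\<close>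

lemma dense_sequence:
  obtains d :: "nat \<Rightarrow> 'a::{metric_space,second_countable_topology}"
  where "\<And>w r. 0 < r \<Longrightarrow> \<exists>i. dist w (d i) < r"
proof -
  obtain D :: "'a set" where D: "countable D" "\<And>X. open X \<Longrightarrow> X \<noteq> {} \<Longrightarrow> \<exists>d\<in>D. d \<in> X"
    using countable_dense_setE by blast
  show ?thesis
  proof (rule that)
    fix w :: 'a and r :: real assume "0 < r"
    then obtain v where "v \<in> D" "v \<in> ball w r" using D(2)[of "ball w r"] by auto
    then show "\<exists>i. dist w (from_nat_into D i) < r"
      using from_nat_into_surj[OF D(1) \<open>v \<in> D\<close>] by auto
  qed
qed

text \<open>Joint measurability is not part of the setting. It follows by replacing \<open>w\<close>
  with the first member of a dense sequence at distance below \<open>1 / (n + 1)\<close>: these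
  approximants use countably many first arguments, and continuity gives the limit.\<close>

lemma caratheodory_measurable:
  fixes h :: "'a::{metric_space,second_countable_topology} \<Rightarrow> 'b \<Rightarrow> real"
  assumes cont: "\<And>x. x \<in> space N \<Longrightarrow> continuous_on UNIV (\<lambda>w. h w x)"
    and meas: "\<And>w. h w \<in> borel_measurable N"
  shows "(\<lambda>p. h (fst p) (snd p)) \<in> borel_measurable (borel \<Otimes>\<^sub>M N)"
proof -
  obtain d :: "nat \<Rightarrow> 'a" where near: "\<And>w r. 0 < r \<Longrightarrow> \<exists>i. dist w (d i) < r"
    using dense_sequence by blast
  define i where "i n w = (LEAST i. dist w (d i) < 1 / real (Suc n))" for n w
  have i: "dist w (d (i n w)) < 1 / real (Suc n)" for n w
    unfolding i_def by (rule LeastI_ex, rule near) simp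
  have im: "i n \<in> measurable borel (count_space UNIV)" for n
    unfolding i_def by measurable
  define f where "f n p = h (d (i n (fst p))) (snd p)" for n and p :: "'a \<times> 'b"
  show ?thesis
  proof (rule borel_measurable_LIMSEQ_real)
    fix n
    show "f n \<in> borel_measurable (borel \<Otimes>\<^sub>M N)"
      unfolding f_def
    proof (rule measurable_compose_countable)
      show "(\<lambda>p. h (d j) (snd p)) \<in> borel_measurable (borel \<Otimes>\<^sub>M N)" for j
        using meas by measurable
      show "(\<lambda>p. i n (fst p)) \<in> borel \<Otimes>\<^sub>M N \<rightarrow>\<^sub>M count_space UNIV"
        using im by measurable
    qed
  next
    fix p :: "'a \<times> 'b" assume "p \<in> space (borel \<Otimes>\<^sub>M N)"
    then have x: "snd p \<in> space N" by (auto simp: space_pair_measure)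
    have lim: "(\<lambda>n. d (i n (fst p))) \<longlonglongrightarrow> fst p"
    proof (rule metric_LIMSEQ_I)
      fix r :: real assume "r > 0"
      then obtain n0 where n0: "1 / real (Suc n0) < r"
        using nat_approx_posE by blast
      have "dist (d (i n (fst p))) (fst p) < r" if "n \<ge> n0" for n
      proof -
        have "1 / real (Suc n) \<le> 1 / real (Suc n0)" using that by (simp add: frac_le)
        then show ?thesis using i[of "fst p" n] n0 by (simp add: dist_commute)
      qed
      then show "\<exists>no. \<forall>n\<ge>no. dist (d (i n (fst p))) (fst p) < r" by blast
    qed
    then show "(\<lambda>n. f n p) \<longlonglongrightarrow> h (fst p) (snd p)"
      unfolding f_def by (intro continuous_on_tendsto_compose[OF cont[OF x] lim]) auto
  qed
qed

lemma centered_gaussian_bounded_linear_measurable: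
  assumes "centered_gaussian \<mu>" "bounded_linear (L :: _ \<Rightarrow> real)"
  shows "L \<in> borel_measurable \<mu>"
proof -
  have "sets \<mu> = sets borel" using assms by (simp add: centered_gaussian_def)
  moreover have "L \<in> borel_measurable borel"
    using assms(2) by (intro borel_measurable_continuous_onI linear_continuous_on)
  ultimately show ?thesis using measurable_cong_sets by blast
qed

lemma normal_second_moment:
  assumes "0 < \<sigma>"
  shows "has_bochner_integral lborel (\<lambda>x. normal_density 0 \<sigma> x * x\<^sup>2) (\<sigma>\<^sup>2)"
  using normal_moment_even[OF assms, where \<mu>=0 and k=1] by (simp add: fact_numeral)

lemma normal_fourth_moment:
  assumes "0 < \<sigma>"
  shows "has_bochner_integral lborel (\<lambda>x. normal_density 0 \<sigma> x * x ^ 4) (3 * (\<sigma>\<^sup>2)\<^sup>2)"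
proof -
  have "fact (2 * 2) / ((2 / \<sigma>\<^sup>2)\<^sup>2 * fact 2) = 3 * (\<sigma>\<^sup>2)\<^sup>2"
    using assms by (simp add: fact_numeral power_divide)
  then show ?thesis using normal_moment_even[OF assms, where \<mu>=0 and k=2] by simp
qed

text \<open>Expressing the law by the second moment instead of an unknown \<open>\<sigma>\<close>
  makes laws comparable: equal variances give equal laws.\<close>

lemma centered_gaussian_distr:
  assumes G: "centered_gaussian \<mu>" and L: "bounded_linear (L :: _ \<Rightarrow> real)"
  shows "sq_integrable \<mu> L"
    and "integrable \<mu> (\<lambda>f. (L f) ^ 4)"
    and "(\<integral>f. (L f) ^ 4 \<partial>\<mu>) = 3 * (\<integral>f. (L f)\<^sup>2 \<partial>\<mu>)\<^sup>2"
    and "distr \<mu> borel L = (if (\<integral>f. (L f)\<^sup>2 \<partial>\<mu>) = 0 then return borel 0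
            else density lborel (normal_density 0 (sqrt (\<integral>f. (L f)\<^sup>2 \<partial>\<mu>))))"
proof -
  interpret prob_space \<mu> using G by (simp add: centered_gaussian_def)
  have Lm[measurable]: "L \<in> borel_measurable \<mu>" by (rule centered_gaussian_bounded_linear_measurable[OF G L])
  obtain \<sigma> where s: "\<sigma> \<ge> 0" and d: "distr \<mu> borel L =
           (if \<sigma> = 0 then return borel 0 else density lborel (normal_density 0 \<sigma>))"
    using G L unfolding centered_gaussian_def by blast
  \<comment> \<open>One transfer rule for both the point mass and the nondegenerate normal
    law.\<close>
  have mom: "integrable \<mu> (\<lambda>f. g (L f)) \<and> (\<integral>f. g (L f) \<partial>\<mu>) = v"
    if [measurable]: "g \<in> borel_measurable borel"
      and z: "\<sigma> = 0 \<Longrightarrow> v = g 0"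
      and n: "0 < \<sigma> \<Longrightarrow> has_bochner_integral lborel (\<lambda>x. normal_density 0 \<sigma> x * g x) v"
    for g :: "real \<Rightarrow> real" and v
  proof (cases "\<sigma> = 0")
    case True
    have "integrable (distr \<mu> borel L) g" "integral\<^sup>L (distr \<mu> borel L) g = v"
      using True z d by (simp_all add: integrable_iff_bounded nn_integral_return integral_return)
    then show ?thesis by (simp add: integrable_distr_eq integral_distr)
  next
    case False
    have "integrable (distr \<mu> borel L) g" "integral\<^sup>L (distr \<mu> borel L) g = v"
      using False s n d by (simp_all add: integrable_density integral_density has_bochner_integral_iff)
    then show ?thesis by (simp add: integrable_distr_eq integral_distr)
  qed
  have m2: "integrable \<mu> (\<lambda>f. (L f)\<^sup>2) \<and> (\<integral>f. (L f)\<^sup>2 \<partial>\<mu>) = \<sigma>\<^sup>2"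
    by (rule mom) (auto intro: normal_second_moment)
  have m4: "integrable \<mu> (\<lambda>f. (L f)^4) \<and> (\<integral>f. (L f)^4 \<partial>\<mu>) = 3 * (\<sigma>\<^sup>2)\<^sup>2"
  proof (rule mom)
    show "has_bochner_integral lborel (\<lambda>x. normal_density 0 \<sigma> x * x ^ 4) (3 * (\<sigma>\<^sup>2)\<^sup>2)" if "0 < \<sigma>"
      by (rule normal_fourth_moment[OF that])
  qed auto
  show "sq_integrable \<mu> L" using m2 by (simp add: sq_integrable_def)
  show "integrable \<mu> (\<lambda>f. (L f) ^ 4)" "(\<integral>f. (L f) ^ 4 \<partial>\<mu>) = 3 * (\<integral>f. (L f)\<^sup>2 \<partial>\<mu>)\<^sup>2"
    using m2 m4 by auto
  show "distr \<mu> borel L = (if (\<integral>f. (L f)\<^sup>2 \<partial>\<mu>) = 0 then return borel 0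
            else density lborel (normal_density 0 (sqrt (\<integral>f. (L f)\<^sup>2 \<partial>\<mu>))))"
    using d s m2 by simp
qed

lemma centered_gaussian_same_law:
  assumes G: "centered_gaussian \<mu>" and L: "bounded_linear (L :: _ \<Rightarrow> real)" and L': "bounded_linear (L' :: _ \<Rightarrow> real)"
    and v: "(\<integral>f. (L f)\<^sup>2 \<partial>\<mu>) = (\<integral>f. (L' f)\<^sup>2 \<partial>\<mu>)" and [measurable]: "g \<in> borel_measurable borel"
  shows "(\<integral>f. g (L f) \<partial>\<mu>) = (\<integral>f. g (L' f) \<partial>\<mu> :: real)"
proof -
  have [measurable]: "L \<in> borel_measurable \<mu>" "L' \<in> borel_measurable \<mu>"
    using G L L' by (auto intro: centered_gaussian_bounded_linear_measurable)
  have "distr \<mu> borel L = distr \<mu> borel L'"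
    using centered_gaussian_distr(4)[OF G L] centered_gaussian_distr(4)[OF G L'] v by simp
  then have "integral\<^sup>L (distr \<mu> borel L) g = integral\<^sup>L (distr \<mu> borel L') g" by simp
  then show ?thesis by (simp add: integral_distr)
qed

lemma scaled_sin_tendsto: "(\<lambda>n. real (Suc n) * sin (r / real (Suc n))) \<longlonglongrightarrow> (r::real)"
proof -
  have "((\<lambda>h. sin (h * r)) has_real_derivative r) (at 0)"
    by (auto intro!: derivative_eq_intros)
  then have "(\<lambda>h. sin (h * r) / h) \<midarrow>0\<rightarrow> r"
    by (simp add: DERIV_def)
  moreover have "(\<lambda>n. inverse (real (Suc n))) \<longlonglongrightarrow> 0" by (rule LIMSEQ_inverse_real_of_nat)
  ultimately have "(\<lambda>n. sin (inverse (real (Suc n)) * r) / inverse (real (Suc n))) \<longlonglongrightarrow> r"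
    unfolding tendsto_at_iff_sequentially comp_def by (auto simp del: of_nat_Suc)
  then show ?thesis by (simp add: field_simps)
qed

text \<open>Flipping the sign of \<open>r\<close> leaves the law of \<open>Y + s r\<close> unchanged, which kills
  \<open>E sin (s r) sin Y\<close>; dividing by \<open>s\<close> and letting \<open>s\<close> tend to \<open>0\<close> gives the claim.\<close>

lemma centered_gaussian_uncorrelated_trig:
  assumes G: "centered_gaussian \<mu>" and r: "bounded_linear (r :: _ \<Rightarrow> real)" and Y: "bounded_linear (Y :: _ \<Rightarrow> real)"
    and rY: "(\<integral>f. r f * Y f \<partial>\<mu>) = 0"
  shows "(\<integral>f. r f * cos (Y f) \<partial>\<mu>) = 0" and "(\<integral>f. r f * sin (Y f) \<partial>\<mu>) = 0"
proof -
  interpret prob_space \<mu> using G by (simp add: centered_gaussian_def)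
  have rm[measurable]: "r \<in> borel_measurable \<mu>" and Ym[measurable]: "Y \<in> borel_measurable \<mu>"
    using G r Y by (auto intro: centered_gaussian_bounded_linear_measurable)
  have rs: "sq_integrable \<mu> r" and Ys: "sq_integrable \<mu> Y"
    using G r Y by (auto intro: centered_gaussian_distr(1))
  have ri: "integrable \<mu> r" by (rule sq_integrable_integrable[OF rs])
  have bl: "bounded_linear (\<lambda>f. Y f + s * r f)" for s
    using bounded_linear_add[OF Y bounded_linear_compose[OF bounded_linear_mult_right r]] .
  have var: "(\<integral>f. (Y f + s * r f)\<^sup>2 \<partial>\<mu>) = (\<integral>f. (Y f)\<^sup>2 \<partial>\<mu>) + s\<^sup>2 * (\<integral>f. (r f)\<^sup>2 \<partial>\<mu>)" for s
  proof -
    have "(\<integral>f. (Y f + s * r f)\<^sup>2 \<partial>\<mu>) = (\<integral>f. ((Y f)\<^sup>2 + s\<^sup>2 * (r f)\<^sup>2) + 2 * s * (r f * Y f) \<partial>\<mu>)"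
      by (simp add: power2_sum power_mult_distrib algebra_simps)
    also have "\<dots> = (\<integral>f. (Y f)\<^sup>2 \<partial>\<mu>) + s\<^sup>2 * (\<integral>f. (r f)\<^sup>2 \<partial>\<mu>) + 2 * s * (\<integral>f. r f * Y f \<partial>\<mu>)"
      using rs Ys sq_integrable_mult[OF rs Ys]
      by (subst Bochner_Integration.integral_add; (subst Bochner_Integration.integral_add)?)
        (auto dest!: sq_integrable_sq)
    finally show ?thesis using rY by simp
  qed
  \<comment> \<open>The variance depends on \<open>s\<close> only through its square because the
    cross term vanishes, so opposite shifts have the same law.\<close>
  have same: "(\<integral>f. g (Y f + s * r f) \<partial>\<mu>) = (\<integral>f. g (Y f + (- s) * r f) \<partial>\<mu>)"
    if "g \<in> borel_measurable borel" for g :: "real \<Rightarrow> real" and s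
    by (rule centered_gaussian_same_law[OF G bl bl _ that]) (simp only: var power2_minus)
  \<comment> \<open>The limit is taken along \<open>s = 1 / (n + 1)\<close>: the quotients
    \<open>sin (s r) / s\<close> tend to \<open>r\<close> and are dominated by
    \<open>\<bar>r\<bar>\<close>.\<close>
  have lim0: "(\<integral>f. r f * g (Y f) \<partial>\<mu>) = 0"
    if [measurable]: "g \<in> borel_measurable borel" and b: "\<And>y. \<bar>g y\<bar> \<le> 1"
      and z: "\<And>s. (\<integral>f. sin (s * r f) * g (Y f) \<partial>\<mu>) = 0" for g :: "real \<Rightarrow> real"
  proof -
    have "(\<lambda>n. \<integral>f. real (Suc n) * sin (r f / real (Suc n)) * g (Y f) \<partial>\<mu>) \<longlonglongrightarrow> (\<integral>f. r f * g (Y f) \<partial>\<mu>)"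
    proof (rule integral_dominated_convergence[where w="\<lambda>f. \<bar>r f\<bar>"])
      show "AE f in \<mu>. (\<lambda>n. real (Suc n) * sin (r f / real (Suc n)) * g (Y f)) \<longlonglongrightarrow> r f * g (Y f)"
        by (intro AE_I2 tendsto_mult scaled_sin_tendsto tendsto_const)
      show "AE f in \<mu>. norm (real (Suc n) * sin (r f / real (Suc n)) * g (Y f)) \<le> \<bar>r f\<bar>" for n
      proof (intro AE_I2)
        fix f
        have "real (Suc n) * \<bar>sin (r f / real (Suc n))\<bar> \<le> real (Suc n) * \<bar>r f / real (Suc n)\<bar>"
          by (intro mult_left_mono abs_sin_x_le_abs_x) auto
        also have "\<dots> = \<bar>r f\<bar>" by simp
        finally have "real (Suc n) * \<bar>sin (r f / real (Suc n))\<bar> * \<bar>g (Y f)\<bar> \<le> \<bar>r f\<bar> * 1"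
          using b[of "Y f"] by (intro mult_mono) auto
        then show "norm (real (Suc n) * sin (r f / real (Suc n)) * g (Y f)) \<le> \<bar>r f\<bar>"
          by (simp add: abs_mult)
      qed
    qed (use ri in auto)
    moreover have "(\<integral>f. real (Suc n) * sin (r f / real (Suc n)) * g (Y f) \<partial>\<mu>) = 0" for n
      using z[of "1 / real (Suc n)"] by (simp add: mult.assoc del: of_nat_Suc)
    ultimately show ?thesis by (simp add: LIMSEQ_const_iff)
  qed
  have int: "integrable \<mu> (\<lambda>f. g (Y f + s * r f))" if "g \<in> borel_measurable borel" "\<And>y. \<bar>g y\<bar> \<le> 1" for g :: "real \<Rightarrow> real" and s
    by (rule integrable_const_bound[of _ 1]) (use that in auto)
  show "(\<integral>f. r f * cos (Y f) \<partial>\<mu>) = 0"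
  proof (rule lim0)
    fix s
    \<comment> \<open>The addition theorem turns the product into a difference of one function at
      the two opposite shifts; for the second claim that function is the cosine.\<close>
    have "(\<integral>f. sin (s * r f) * cos (Y f) \<partial>\<mu>) = (\<integral>f. (sin (Y f + s * r f) - sin (Y f + (- s) * r f)) / 2 \<partial>\<mu>)"
      by (simp add: sin_add sin_diff mult.commute)
    also have "\<dots> = 0" using same[of sin s] int[of sin s] int[of sin "- s"] by simp
    finally show "(\<integral>f. sin (s * r f) * cos (Y f) \<partial>\<mu>) = 0" .
  qed auto
  show "(\<integral>f. r f * sin (Y f) \<partial>\<mu>) = 0"
  proof (rule lim0)
    fix s
    have "(\<integral>f. sin (s * r f) * sin (Y f) \<partial>\<mu>) = (\<integral>f. (cos (Y f + (- s) * r f) - cos (Y f + s * r f)) / 2 \<partial>\<mu>)"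
      by (simp add: cos_add cos_diff mult.commute)
    also have "\<dots> = 0" using same[of cos s] int[of cos s] int[of cos "- s"] by simp
    finally show "(\<integral>f. sin (s * r f) * sin (Y f) \<partial>\<mu>) = 0" .
  qed auto
qed

section \<open>Vanishing Fourier transforms\<close>

text \<open>The signed image of \<open>r\<close> under \<open>T\<close> is encoded by the images of
  its positive and negative parts; their equality says that the signed image is zero.\<close>

lemma integral_zero_of_pos_neg_distr_eq:
  fixes r :: "'a \<Rightarrow> real" and g :: "'b \<Rightarrow> real"
  assumes [measurable]: "r \<in> borel_measurable M" "T \<in> measurable M N" "g \<in> borel_measurable N"
    and int: "integrable M (\<lambda>x. r x * g (T x))"
    and eq: "distr (density M (\<lambda>x. ennreal (max 0 (r x)))) N T = distr (density M (\<lambda>x. ennreal (max 0 (- r x)))) N T"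
  shows "(\<integral>x. r x * g (T x) \<partial>M) = 0"
proof -
  have d: "(\<integral>x. g x \<partial>distr (density M (\<lambda>x. ennreal (max 0 (s x)))) N T) = (\<integral>x. max 0 (s x) * g (T x) \<partial>M)"
    if [measurable]: "s \<in> borel_measurable M" for s :: "'a \<Rightarrow> real"
  proof -
    have "(\<integral>x. g x \<partial>distr (density M (\<lambda>x. ennreal (max 0 (s x)))) N T)
      = (\<integral>x. g (T x) \<partial>density M (\<lambda>x. ennreal (max 0 (s x))))"
      by (rule integral_distr) auto
    also have "\<dots> = (\<integral>x. max 0 (s x) *\<^sub>R g (T x) \<partial>M)"
      by (rule integral_density) auto
    finally show ?thesis by simp
  qed
  have i: "integrable M (\<lambda>x. max 0 (r x) * g (T x))" "integrable M (\<lambda>x. max 0 (- r x) * g (T x))"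
    by (rule Bochner_Integration.integrable_bound[OF int]; auto simp: abs_mult intro!: mult_right_mono)+
  have "(\<integral>x. r x * g (T x) \<partial>M) = (\<integral>x. max 0 (r x) * g (T x) - max 0 (- r x) * g (T x) \<partial>M)"
    by (intro Bochner_Integration.integral_cong) (auto simp: max_def)
  also have "\<dots> = 0"
    using i d[of r] d[of "\<lambda>x. - r x"] eq by simp
  finally show ?thesis .
qed

lemma char_distr_density:
  fixes r :: "'a \<Rightarrow> real"
  assumes [measurable]: "X \<in> borel_measurable M" and r: "integrable M r" and nn: "\<And>x. 0 \<le> r x"
  shows "char (distr (density M (\<lambda>x. ennreal (r x))) borel X) t =
    of_real (\<integral>x. r x * cos (t * X x) \<partial>M) + \<i> * of_real (\<integral>x. r x * sin (t * X x) \<partial>M)"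
proof -
  have [measurable]: "r \<in> borel_measurable M" using r by simp
  have i: "integrable M (\<lambda>x. r x * cos (t * X x))" "integrable M (\<lambda>x. r x * sin (t * X x))"
    by (rule Bochner_Integration.integrable_bound[OF r]; auto simp: abs_mult intro!: mult_left_le)+
  have "char (distr (density M (\<lambda>x. ennreal (r x))) borel X) t = (\<integral>x. r x *\<^sub>R iexp (t * X x) \<partial>M)"
    using nn by (simp add: char_def integral_distr integral_density)
  also have "\<dots> = (\<integral>x. of_real (r x * cos (t * X x)) + \<i> * of_real (r x * sin (t * X x)) \<partial>M)"
    by (intro Bochner_Integration.integral_cong refl) (simp add: complex_eq_iff Re_exp Im_exp)
  also have "\<dots> = (\<integral>x. complex_of_real (r x * cos (t * X x)) \<partial>M) + \<i> * (\<integral>x. complex_of_real (r x * sin (t * X x)) \<partial>M)"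
    using integrable_of_real[OF i(1), where 'a=complex] integrable_of_real[OF i(2), where 'a=complex] by (subst Bochner_Integration.integral_add) (auto simp del: of_real_mult)
  finally show ?thesis by (simp del: of_real_mult)
qed

text \<open>The images of the positive and the negative part of \<open>r\<close> have the same
  characteristic function and coincide by Levy uniqueness. That theorem concerns probability
  measures, so both parts are first divided by their common mass \<open>k\<close>.\<close>

lemma trig_vanishing_indicator:
  fixes r :: "'a \<Rightarrow> real"
  assumes r: "integrable M r" and X[measurable]: "X \<in> borel_measurable M"
    and c: "\<And>t. (\<integral>x. r x * cos (t * X x) \<partial>M) = 0" and s: "\<And>t. (\<integral>x. r x * sin (t * X x) \<partial>M) = 0"
    and B[measurable]: "B \<in> sets borel"
  shows "(\<integral>x. r x * indicator B (X x) \<partial>M) = 0"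
proof -
  have rm[measurable]: "r \<in> borel_measurable M" using r by simp
  have rpn: "r x = max 0 (r x) - max 0 (- r x)" for x by (simp add: max_def)
  have ip: "integrable M (\<lambda>x. max 0 (r x))" and in': "integrable M (\<lambda>x. max 0 (- r x))"
    using r by auto
  define k where "k = (\<integral>x. max 0 (r x) \<partial>M)"
  \<comment> \<open>Frequency zero shows that both parts have the same mass.\<close>
  have "(\<integral>x. r x \<partial>M) = 0" using c[of 0] by simp
  moreover have "(\<integral>x. r x \<partial>M) = k - (\<integral>x. max 0 (- r x) \<partial>M)"
    by (subst rpn) (use ip in' in \<open>simp add: k_def\<close>)
  ultimately have k': "k = (\<integral>x. max 0 (- r x) \<partial>M)" by simp
  show ?thesis
  proof (cases "k = 0")
    case True
    have "AE x in M. max 0 (r x) = 0" "AE x in M. max 0 (- r x) = 0"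
      using True k' ip in' by (simp_all add: k_def flip: integral_nonneg_eq_0_iff_AE)
    then have "AE x in M. r x * indicator B (X x) = 0" by eventually_elim (auto simp: max_def split: if_splits)
    then show ?thesis by (rule integral_eq_zero_AE)
  next
    case False
    moreover have "0 \<le> k" by (simp add: k_def)
    ultimately have k0: "0 < k" by simp
    define q where "q x = r x / k" for x
    have qm[measurable]: "q \<in> borel_measurable M" by (simp add: q_def[abs_def])
    have qpos: "max 0 (q x) = max 0 (r x) / k" "max 0 (- q x) = max 0 (- r x) / k" for x
      using k0 by (auto simp: q_def max_def field_simps)
    have ii: "integrable M (\<lambda>x. max 0 (q x))" "integrable M (\<lambda>x. max 0 (- q x))"
      unfolding qpos using ip in' by auto
    have I1: "(\<integral>x. max 0 (q x) \<partial>M) = 1" "(\<integral>x. max 0 (- q x) \<partial>M) = 1"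
      unfolding qpos using k0 k' by (simp_all flip: k_def)
    have rd: "real_distribution (distr (density M (\<lambda>x. ennreal (f x))) borel X)"
      if "integrable M f" "\<And>x. 0 \<le> f x" "(\<integral>x. f x \<partial>M) = 1" for f :: "'a \<Rightarrow> real"
    proof -
      have "emeasure (density M (\<lambda>x. ennreal (f x))) (space M) = 1"
        using that by (simp add: emeasure_density nn_integral_eq_integral cong: nn_integral_cong)
      then interpret prob_space "density M (\<lambda>x. ennreal (f x))" by (intro prob_spaceI) simp
      show ?thesis by (rule real_distribution_distr) simp
    qed
    have "distr (density M (\<lambda>x. ennreal (max 0 (q x)))) borel X = distr (density M (\<lambda>x. ennreal (max 0 (- q x)))) borel X"
    proof (rule Levy_uniqueness)
      show "char (distr (density M (\<lambda>x. ennreal (max 0 (q x)))) borel X) = char (distr (density M (\<lambda>x. ennreal (max 0 (- q x)))) borel X)"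
      proof
        fix t
        have e: "(\<integral>x. max 0 (q x) * w x \<partial>M) = (\<integral>x. max 0 (- q x) * w x \<partial>M)"
          if [measurable]: "w \<in> borel_measurable M" and "\<And>x. \<bar>w x\<bar> \<le> 1" and z: "(\<integral>x. r x * w x \<partial>M) = 0" for w
        proof -
          have i: "integrable M (\<lambda>x. max 0 (q x) * w x)" "integrable M (\<lambda>x. max 0 (- q x) * w x)"
            by (rule Bochner_Integration.integrable_bound[OF ii(1)] Bochner_Integration.integrable_bound[OF ii(2)];
                use that(2) in \<open>auto simp: abs_mult intro!: mult_left_le\<close>)+
          have "(\<integral>x. max 0 (q x) * w x \<partial>M) - (\<integral>x. max 0 (- q x) * w x \<partial>M) = (\<integral>x. max 0 (q x) * w x - max 0 (- q x) * w x \<partial>M)"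
            using i by simp
          also have "\<dots> = (\<integral>x. (r x * w x) / k \<partial>M)"
            by (intro Bochner_Integration.integral_cong refl) (auto simp: q_def max_def)
          also have "\<dots> = 0" using z by simp
          finally show ?thesis by simp
        qed
        show "char (distr (density M (\<lambda>x. ennreal (max 0 (q x)))) borel X) t = char (distr (density M (\<lambda>x. ennreal (max 0 (- q x)))) borel X) t"
          using e[of "\<lambda>x. cos (t * X x)"] e[of "\<lambda>x. sin (t * X x)"] c[of t] s[of t]
          unfolding char_distr_density[OF X ii(1) max.cobounded1] char_distr_density[OF X ii(2) max.cobounded1]
          by simp
      qed
    qed (use rd[OF ii(1) max.cobounded1 I1(1)] rd[OF ii(2) max.cobounded1 I1(2)] in simp_all)
    moreover have "integrable M (\<lambda>x. q x * indicator B (X x))"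
      unfolding q_def by (rule Bochner_Integration.integrable_bound[where f="\<lambda>x. r x / k"]) (use r in \<open>auto simp: indicator_def\<close>)
    ultimately have "(\<integral>x. q x * indicator B (X x) \<partial>M) = 0"
      by (intro integral_zero_of_pos_neg_distr_eq[where N=borel]) auto
    then show ?thesis using k0 by (simp add: q_def)
  qed
qed

text \<open>The coordinates are converted one at a time: at stage \<open>k\<close> the first
  \<open>k\<close> frequencies have been replaced by arbitrary Borel sets. Each stage then needs
  only the one-dimensional uniqueness result.\<close>

lemma trig_vanishing_rectangle:
  fixes r :: "'a \<Rightarrow> real" and X :: "nat \<Rightarrow> 'a \<Rightarrow> real"
  assumes r: "integrable M r" and X[measurable]: "\<And>i. X i \<in> borel_measurable M"
    and c: "\<And>t. (\<integral>x. r x * cos (\<Sum>i<m. t i * X i x) \<partial>M) = 0"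
    and s: "\<And>t. (\<integral>x. r x * sin (\<Sum>i<m. t i * X i x) \<partial>M) = 0"
    and B[measurable]: "\<And>i. B i \<in> sets borel" and "k \<le> m"
  shows "(\<integral>x. r x * (\<Prod>i<k. indicator (B i) (X i x)) * cos (\<Sum>i=k..<m. t i * X i x) \<partial>M) = 0 \<and>
    (\<integral>x. r x * (\<Prod>i<k. indicator (B i) (X i x)) * sin (\<Sum>i=k..<m. t i * X i x) \<partial>M) = 0"
  using \<open>k \<le> m\<close>
proof (induction k arbitrary: t)
  case 0
  then show ?case using c[of t] s[of t] by (simp add: atLeast0LessThan)
next
  case (Suc k)
  have rm[measurable]: "r \<in> borel_measurable M" using r by simp
  define w where "w x = r x * (\<Prod>i<k. indicator (B i) (X i x))" for x
  define \<theta> where "\<theta> x = (\<Sum>i=Suc k..<m. t i * X i x)" for x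
  have wm[measurable]: "w \<in> borel_measurable M" and tm[measurable]: "\<theta> \<in> borel_measurable M"
    unfolding w_def \<theta>_def by measurable
  have pr: "\<bar>\<Prod>i<k. indicator (B i) (X i x) :: real\<bar> \<le> 1" for x
    unfolding abs_prod by (intro prod_le_1) (auto simp: indicator_def)
  have w: "integrable M w"
    unfolding w_def
    by (rule Bochner_Integration.integrable_bound[OF r]) (use pr in \<open>auto simp: abs_mult intro!: mult_left_le\<close>)
  have bd: "integrable M (\<lambda>x. w x * g x)" if [measurable]: "g \<in> borel_measurable M" and "\<And>x. \<bar>g x\<bar> \<le> 1" for g
    by (rule Bochner_Integration.integrable_bound[OF w]) (use that in \<open>auto simp: abs_mult intro!: mult_left_le\<close>)
  have IH: "(\<integral>x. w x * cos (\<theta> x + a * X k x) \<partial>M) = 0" "(\<integral>x. w x * sin (\<theta> x + a * X k x) \<partial>M) = 0" for a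
  proof -
    have "(\<Sum>i=k..<m. (t(k := a)) i * X i x) = \<theta> x + a * X k x" for x
    proof -
      have "(\<Sum>i=k..<m. (t(k := a)) i * X i x) = a * X k x + (\<Sum>i=Suc k..<m. (t(k := a)) i * X i x)"
        using Suc.prems by (subst sum.atLeast_Suc_lessThan) auto
      also have "(\<Sum>i=Suc k..<m. (t(k := a)) i * X i x) = \<theta> x"
        unfolding \<theta>_def by (intro sum.cong) auto
      finally show ?thesis by simp
    qed
    then show "(\<integral>x. w x * cos (\<theta> x + a * X k x) \<partial>M) = 0" "(\<integral>x. w x * sin (\<theta> x + a * X k x) \<partial>M) = 0"
      using Suc.IH[of "t(k := a)"] Suc.prems by (simp_all add: w_def)
  qed
  have ic: "integrable M (\<lambda>x. w x * cos (\<theta> x + a * X k x))" "integrable M (\<lambda>x. w x * sin (\<theta> x + a * X k x))" for a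
    by (intro bd; simp)+
  \<comment> \<open>Combining the frequencies \<open>a\<close> and \<open>- a\<close> by product
    formulas separates coordinate \<open>k\<close> from the phase \<open>\<theta>\<close> of the
    later ones.\<close>
  have cc: "(\<integral>x. w x * cos (\<theta> x) * cos (a * X k x) \<partial>M) = 0" for a
  proof -
    have "(\<integral>x. w x * cos (\<theta> x) * cos (a * X k x) \<partial>M) = (\<integral>x. (w x * cos (\<theta> x + a * X k x) + w x * cos (\<theta> x + (- a) * X k x)) / 2 \<partial>M)"
      by (intro Bochner_Integration.integral_cong refl) (simp add: cos_add cos_diff algebra_simps)
    also have "\<dots> = 0" using ic[of a] ic[of "- a"] IH[of a] IH[of "- a"] by simp
    finally show ?thesis .
  qed
  have cs: "(\<integral>x. w x * cos (\<theta> x) * sin (a * X k x) \<partial>M) = 0" for a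
  proof -
    have "(\<integral>x. w x * cos (\<theta> x) * sin (a * X k x) \<partial>M) = (\<integral>x. (w x * sin (\<theta> x + a * X k x) - w x * sin (\<theta> x + (- a) * X k x)) / 2 \<partial>M)"
      by (intro Bochner_Integration.integral_cong refl) (simp add: sin_add sin_diff algebra_simps)
    also have "\<dots> = 0" using ic[of a] ic[of "- a"] IH[of a] IH[of "- a"] by simp
    finally show ?thesis .
  qed
  have sc: "(\<integral>x. w x * sin (\<theta> x) * cos (a * X k x) \<partial>M) = 0" for a
  proof -
    have "(\<integral>x. w x * sin (\<theta> x) * cos (a * X k x) \<partial>M) = (\<integral>x. (w x * sin (\<theta> x + a * X k x) + w x * sin (\<theta> x + (- a) * X k x)) / 2 \<partial>M)"
      by (intro Bochner_Integration.integral_cong refl) (simp add: sin_add sin_diff algebra_simps)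
    also have "\<dots> = 0" using ic[of a] ic[of "- a"] IH[of a] IH[of "- a"] by simp
    finally show ?thesis .
  qed
  have ss: "(\<integral>x. w x * sin (\<theta> x) * sin (a * X k x) \<partial>M) = 0" for a
  proof -
    have "(\<integral>x. w x * sin (\<theta> x) * sin (a * X k x) \<partial>M) = (\<integral>x. (w x * cos (\<theta> x + (- a) * X k x) - w x * cos (\<theta> x + a * X k x)) / 2 \<partial>M)"
      by (intro Bochner_Integration.integral_cong refl) (simp add: cos_add cos_diff algebra_simps)
    also have "\<dots> = 0" using ic[of a] ic[of "- a"] IH[of a] IH[of "- a"] by simp
    finally show ?thesis .
  qed
  have "(\<integral>x. w x * cos (\<theta> x) * indicator (B k) (X k x) \<partial>M) = 0"
    by (rule trig_vanishing_indicator) (use cc cs in \<open>auto intro: bd\<close>)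
  moreover have "(\<integral>x. w x * sin (\<theta> x) * indicator (B k) (X k x) \<partial>M) = 0"
    by (rule trig_vanishing_indicator) (use sc ss in \<open>auto intro: bd\<close>)
  ultimately show ?case
    by (simp add: w_def \<theta>_def mult_ac)
qed

text \<open>Rectangles generate the product sigma-algebra and are closed under intersection. The
  images of the positive and the negative part of \<open>r\<close> agree on them, hence
  everywhere.\<close>

lemma trig_vanishing_PiM:
  fixes r :: "'a \<Rightarrow> real" and X :: "nat \<Rightarrow> 'a \<Rightarrow> real"
  assumes r: "integrable M r" and X[measurable]: "\<And>i. X i \<in> borel_measurable M"
    and c: "\<And>t. (\<integral>x. r x * cos (\<Sum>i<m. t i * X i x) \<partial>M) = 0"
    and s: "\<And>t. (\<integral>x. r x * sin (\<Sum>i<m. t i * X i x) \<partial>M) = 0"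
    and g[measurable]: "g \<in> borel_measurable (PiM {..<m} (\<lambda>_. borel))"
    and int: "integrable M (\<lambda>x. r x * g (\<lambda>i\<in>{..<m}. X i x))"
  shows "(\<integral>x. r x * g (\<lambda>i\<in>{..<m}. X i x) \<partial>M) = 0"
proof -
  let ?N = "PiM {..<m} (\<lambda>_. borel :: real measure)"
  let ?T = "\<lambda>x. \<lambda>i\<in>{..<m}. X i x"
  have rm[measurable]: "r \<in> borel_measurable M" using r by simp
  have T[measurable]: "?T \<in> measurable M ?N" by measurable
  have em: "emeasure (distr (density M (\<lambda>x. ennreal (max 0 (f x)))) ?N ?T) (Pi\<^sub>E {..<m} A)
      = ennreal (\<integral>x. max 0 (f x) * (\<Prod>i<m. indicator (A i) (X i x)) \<partial>M)"
    and ei: "integrable M (\<lambda>x. max 0 (f x) * (\<Prod>i<m. indicator (A i) (X i x)))"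
    if f: "integrable M f" and A: "\<And>i. A i \<in> sets borel" for A f
  proof -
    have [measurable]: "f \<in> borel_measurable M" using f by simp
    have [measurable]: "A i \<in> sets borel" for i by (rule A)
    have [measurable]: "Pi\<^sub>E {..<m} A \<in> sets ?N" by (intro sets_PiM_I_finite) (use A in auto)
    have pr: "\<bar>\<Prod>i<m. indicator (A i) (X i x) :: real\<bar> \<le> 1" for x
      unfolding abs_prod by (intro prod_le_1) (auto simp: indicator_def)
    have "integrable M (\<lambda>x. max 0 (f x))" using f by auto
    then show ei: "integrable M (\<lambda>x. max 0 (f x) * (\<Prod>i<m. indicator (A i) (X i x)))"
      by (rule Bochner_Integration.integrable_bound) (use pr in \<open>auto simp: abs_mult intro!: mult_left_le\<close>)
    have "emeasure (distr (density M (\<lambda>x. ennreal (max 0 (f x)))) ?N ?T) (Pi\<^sub>E {..<m} A)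
      = (\<integral>\<^sup>+x. ennreal (max 0 (f x)) * indicator (?T -` Pi\<^sub>E {..<m} A \<inter> space M) x \<partial>M)"
      by (simp add: emeasure_distr emeasure_density)
    also have "\<dots> = (\<integral>\<^sup>+x. ennreal (max 0 (f x) * (\<Prod>i<m. indicator (A i) (X i x))) \<partial>M)"
    proof (intro nn_integral_cong)
      fix x assume "x \<in> space M"
      have "(\<Prod>i<m. indicator (A i) (X i x) :: real) = (if \<forall>i<m. X i x \<in> A i then 1 else 0)"
        by (auto simp: indicator_def)
      moreover have "?T x \<in> Pi\<^sub>E {..<m} A \<longleftrightarrow> (\<forall>i<m. X i x \<in> A i)"
        by (auto simp: PiE_iff)
      ultimately show "ennreal (max 0 (f x)) * indicator (?T -` Pi\<^sub>E {..<m} A \<inter> space M) x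
        = ennreal (max 0 (f x) * (\<Prod>i<m. indicator (A i) (X i x)))"
        using \<open>x \<in> space M\<close> by (simp add: indicator_def)
    qed
    also have "\<dots> = ennreal (\<integral>x. max 0 (f x) * (\<Prod>i<m. indicator (A i) (X i x)) \<partial>M)"
      by (intro nn_integral_eq_integral ei AE_I2 mult_nonneg_nonneg prod_nonneg) auto
    finally show "emeasure (distr (density M (\<lambda>x. ennreal (max 0 (f x)))) ?N ?T) (Pi\<^sub>E {..<m} A)
      = ennreal (\<integral>x. max 0 (f x) * (\<Prod>i<m. indicator (A i) (X i x)) \<partial>M)" .
  qed
  have rn: "integrable M (\<lambda>x. - r x)" using r by simp
  have rect: "emeasure (distr (density M (\<lambda>x. ennreal (max 0 (r x)))) ?N ?T) (Pi\<^sub>E {..<m} A)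
      = emeasure (distr (density M (\<lambda>x. ennreal (max 0 (- r x)))) ?N ?T) (Pi\<^sub>E {..<m} A)"
    if A: "\<And>i. A i \<in> sets borel" for A
  proof -
    have "(\<integral>x. max 0 (r x) * (\<Prod>i<m. indicator (A i) (X i x)) \<partial>M) - (\<integral>x. max 0 (- r x) * (\<Prod>i<m. indicator (A i) (X i x)) \<partial>M)
      = (\<integral>x. max 0 (r x) * (\<Prod>i<m. indicator (A i) (X i x)) - max 0 (- r x) * (\<Prod>i<m. indicator (A i) (X i x)) \<partial>M)"
      using ei[OF r A] ei[OF rn A] by simp
    also have "\<dots> = (\<integral>x. r x * (\<Prod>i<m. indicator (A i) (X i x)) \<partial>M)"
      by (intro Bochner_Integration.integral_cong refl) (auto simp: max_def)
    \<comment> \<open>For \<open>k = m\<close> no frequency is left and the cosine is 1.\<close>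
    also have "\<dots> = 0"
      using trig_vanishing_rectangle[where B=A and k=m and t="\<lambda>_. 0", OF r X c s A order.refl] by simp
    finally show ?thesis using em[OF r A] em[OF rn A] by simp
  qed
  have "distr (density M (\<lambda>x. ennreal (max 0 (r x)))) ?N ?T = distr (density M (\<lambda>x. ennreal (max 0 (- r x)))) ?N ?T"
  proof (rule measure_eqI_PiM_finite[where I="{..<m}" and M="\<lambda>_. borel :: real measure" and A="\<lambda>_. space ?N"])
    show "emeasure (distr (density M (\<lambda>x. ennreal (max 0 (r x)))) ?N ?T) (Pi\<^sub>E {..<m} A)
      = emeasure (distr (density M (\<lambda>x. ennreal (max 0 (- r x)))) ?N ?T) (Pi\<^sub>E {..<m} A)"
      if "\<And>i. i \<in> {..<m} \<Longrightarrow> A i \<in> sets borel" for A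
    proof -
      \<comment> \<open>\<open>rect\<close> asks for Borel sets at every index, whereas
        \<open>A\<close> is only constrained below \<open>m\<close>.\<close>
      define A' where "A' i = (if i < m then A i else {})" for i
      have "Pi\<^sub>E {..<m} A = Pi\<^sub>E {..<m} A'" by (intro PiE_cong) (simp add: A'_def)
      moreover have "A' i \<in> sets borel" for i using that by (simp add: A'_def)
      ultimately show ?thesis using rect[of A'] by simp
    qed
    have sp: "space ?N = Pi\<^sub>E {..<m} (\<lambda>_. UNIV)" by (simp add: space_PiM)
    show "range (\<lambda>_::nat. space ?N) \<subseteq> prod_algebra {..<m} (\<lambda>_. borel)"
      unfolding sp by (auto intro!: prod_algebraI_finite)
    show "(\<Union>i::nat. space ?N) = space ?N" by simp
    show "emeasure (distr (density M (\<lambda>x. ennreal (max 0 (r x)))) ?N ?T) (space ?N) \<noteq> \<infinity>"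
      unfolding sp using em[OF r, of "\<lambda>_. UNIV"] by simp
  qed simp_all
  then show ?thesis by (intro integral_zero_of_pos_neg_distr_eq[of r M ?T ?N g] rm T g int)
qed

section \<open>Fekete points\<close>

definition eval_mat :: "nat \<Rightarrow> (nat \<Rightarrow> 'b \<Rightarrow> real) \<Rightarrow> (nat \<Rightarrow> 'b) \<Rightarrow> real mat" where
  "eval_mat p e X = mat p p (\<lambda>(i, j). e j (X i))"

lemma eval_mat_carrier[simp]: "eval_mat p e X \<in> carrier_mat p p"
  by (simp add: eval_mat_def)

lemma eval_mat_index: "i < p \<Longrightarrow> j < p \<Longrightarrow> eval_mat p e X $$ (i, j) = e j (X i)"
  by (simp add: eval_mat_def)

lemma cofactor_eval_mat_upd: "i < p \<Longrightarrow> cofactor (eval_mat p e (X(i := y))) i j = cofactor (eval_mat p e X) i j"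
proof -
  assume i: "i < p"
  have "mat_delete (eval_mat p e (X(i := y))) i j = mat_delete (eval_mat p e X) i j"
    unfolding mat_delete_def eval_mat_def by (intro eq_matI) auto
  then show ?thesis by (simp add: cofactor_def)
qed

text \<open>As a function of its \<open>i\<close>th point the determinant lies in the span of the
  \<open>e j\<close>; divided by the original determinant it is the \<open>i\<close>th Lagrange
  function.\<close>

lemma det_eval_mat_upd:
  assumes "i < p"
  shows "det (eval_mat p e (X(i := y))) = (\<Sum>j<p. cofactor (eval_mat p e X) i j * e j y)"
proof -
  have "det (eval_mat p e (X(i := y)))
    = (\<Sum>j<p. eval_mat p e (X(i := y)) $$ (i, j) * cofactor (eval_mat p e (X(i := y))) i j)"
    by (rule laplace_expansion_row) (use assms in auto)
  also have "\<dots> = (\<Sum>j<p. cofactor (eval_mat p e X) i j * e j y)"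
    using assms by (intro sum.cong) (auto simp: cofactor_eval_mat_upd eval_mat_index)
  finally show ?thesis .
qed

lemma orthonormal_mono: "orthonormal M p e \<Longrightarrow> k \<le> p \<Longrightarrow> orthonormal M k e"
  by (auto simp: orthonormal_def)

text \<open>Points are added one at a time. If no new point worked, the expanded determinant would
  be a combination of the orthonormal \<open>e j\<close> that vanishes almost everywhere, although
  its last coefficient is the previous, nonzero determinant.\<close>

lemma exists_unisolvent_points:
  assumes o: "orthonormal P p e" and D: "AE x in P. x \<in> D" and "k \<le> p"
  shows "\<exists>X. (\<forall>i<k. X i \<in> D) \<and> det (eval_mat k e X) \<noteq> 0"
  using \<open>k \<le> p\<close>
proof (induction k)
  case 0
  then show ?case by (auto intro!: exI simp: eval_mat_def)
next
  case (Suc k)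
  then obtain X where X: "\<And>i. i < k \<Longrightarrow> X i \<in> D" and d: "det (eval_mat k e X) \<noteq> 0"
    using Suc_leD by blast
  define c where "c j = cofactor (eval_mat (Suc k) e X) k j" for j
  have "mat_delete (eval_mat (Suc k) e X) k k = eval_mat k e X"
    unfolding mat_delete_def eval_mat_def by (intro eq_matI) auto
  then have ck: "c k \<noteq> 0" using d by (simp add: c_def cofactor_def)
  have o': "orthonormal P (Suc k) e" using orthonormal_mono[OF o] Suc.prems by blast
  have "\<exists>y\<in>D. (\<Sum>j<Suc k. c j * e j y) \<noteq> 0"
  proof (rule ccontr)
    assume "\<not> ?thesis"
    then have "(\<Sum>j<Suc k. c j * e j y)\<^sup>2 = 0" if "y \<in> D" for y using that by auto
    with D have "AE y in P. (\<Sum>j<Suc k. c j * e j y)\<^sup>2 = 0" by (rule eventually_mono)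
    then have "(\<integral>y. (\<Sum>j<Suc k. c j * e j y)\<^sup>2 \<partial>P) = 0" by (rule integral_eq_zero_AE)
    then have "(\<Sum>j<Suc k. (c j)\<^sup>2) = 0" using orthonormal_norm_comb[OF o'] by simp
    then show False using ck by (subst (asm) sum_nonneg_eq_0_iff) auto
  qed
  then obtain y where y: "y \<in> D" "(\<Sum>j<Suc k. c j * e j y) \<noteq> 0" by blast
  have "det (eval_mat (Suc k) e (X(k := y))) \<noteq> 0"
    using y(2) by (subst det_eval_mat_upd) (auto simp: c_def)
  moreover have "\<forall>i<Suc k. (X(k := y)) i \<in> D" using X y(1) by (auto simp: less_Suc_eq)
  ultimately show ?case by blast
qed

text \<open>This crude Leibniz bound only has to make a supremum finite; its factorial never reaches
  the error estimate.\<close>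

lemma det_eval_mat_le:
  assumes "\<And>i j. i < p \<Longrightarrow> j < p \<Longrightarrow> \<bar>e j (X i)\<bar> \<le> b i"
  shows "\<bar>det (eval_mat p e X)\<bar> \<le> fact p * (\<Prod>i<p. b i)"
proof -
  have "\<bar>det (eval_mat p e X)\<bar> = \<bar>\<Sum>\<sigma> | \<sigma> permutes {0..<p}. signof \<sigma> * (\<Prod>i = 0..<p. eval_mat p e X $$ (i, \<sigma> i))\<bar>"
    by (subst det_def'[of _ p]) auto
  also have "\<dots> \<le> (\<Sum>\<sigma> | \<sigma> permutes {0..<p}. \<bar>signof \<sigma> * (\<Prod>i = 0..<p. eval_mat p e X $$ (i, \<sigma> i))\<bar>)"
    by (rule sum_abs)
  also have "\<dots> \<le> (\<Sum>\<sigma> | \<sigma> permutes {0..<p}. \<Prod>i<p. b i)"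
  proof (rule sum_mono)
    fix \<sigma> assume "\<sigma> \<in> {\<sigma>. \<sigma> permutes {0..<p}}"
    then have s: "\<sigma> i < p" if "i < p" for i using that permutes_in_image[of \<sigma> "{0..<p}" i] by auto
    have "\<bar>signof \<sigma> :: real\<bar> = 1" by (simp add: sign_def)
    then have "\<bar>signof \<sigma> * (\<Prod>i = 0..<p. eval_mat p e X $$ (i, \<sigma> i))\<bar> = (\<Prod>i<p. \<bar>e (\<sigma> i) (X i)\<bar>)"
      using s by (simp add: abs_mult abs_prod eval_mat_def atLeast0LessThan)
    also have "\<dots> \<le> (\<Prod>i<p. b i)" using assms s by (intro prod_mono) auto
    finally show "\<bar>signof \<sigma> * (\<Prod>i = 0..<p. eval_mat p e X $$ (i, \<sigma> i))\<bar> \<le> (\<Prod>i<p. b i)" .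
  qed
  also have "\<dots> = fact p * (\<Prod>i<p. b i)"
    by (simp add: card_permutations[of _ p])
  finally show ?thesis .
qed

text \<open>Points nearly maximizing the weighted determinant have weighted Lagrange functions bounded by 2.\<close>

lemma fekete_points:
  assumes o: "orthonormal P p e" and D: "AE x in P. x \<in> D"
    and u0: "\<And>x. 0 < u x" and eu: "\<And>x. (\<Sum>k<p. (e k x)\<^sup>2) \<le> u x" and u: "integrable P u"
  obtains X c where "\<And>i. i < p \<Longrightarrow> X i \<in> D"
    "\<And>j k. j < p \<Longrightarrow> k < p \<Longrightarrow> (\<Sum>i<p. c k i * e j (X i)) = (if j = k then 1 else (0::real))"
    "\<And>i. i < p \<Longrightarrow> u (X i) * (\<Sum>k<p. (c k i)\<^sup>2) \<le> 4 * (\<integral>x. u x \<partial>P)"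
proof -
  define W where "W X = (\<Prod>i<p. sqrt (u (X i)))" for X
  define V where "V X = \<bar>det (eval_mat p e X)\<bar> / W X" for X
  have W0: "0 < W X" for X unfolding W_def using u0 by (intro prod_pos) auto
  let ?T = "{X. \<forall>i<p. X i \<in> D}"
  have V_le: "V X \<le> fact p" for X
  proof -
    have "\<bar>e j (X i)\<bar> \<le> sqrt (u (X i))" if "j < p" for i j
    proof (rule real_le_rsqrt)
      have "(e j (X i))\<^sup>2 \<le> (\<Sum>k<p. (e k (X i))\<^sup>2)" using that by (intro member_le_sum) auto
      then show "\<bar>e j (X i)\<bar>\<^sup>2 \<le> u (X i)" using eu[of "X i"] by simp
    qed
    then have "\<bar>det (eval_mat p e X)\<bar> \<le> fact p * W X"
      unfolding W_def by (intro det_eval_mat_le) auto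
    then show ?thesis using W0[of X] by (simp add: V_def divide_le_eq)
  qed
  then have bdd: "bdd_above (V ` ?T)" by (intro bdd_aboveI[of _ "fact p"]) auto
  obtain X0 where X0: "X0 \<in> ?T" "det (eval_mat p e X0) \<noteq> 0"
    using exists_unisolvent_points[OF o D order.refl] by auto
  have "0 < V X0" using X0(2) W0[of X0] by (simp add: V_def)
  also have "\<dots> \<le> Sup (V ` ?T)" using X0(1) bdd by (intro cSup_upper) auto
  finally have s: "0 < Sup (V ` ?T)" .
  \<comment> \<open>A maximiser need not exist, so half of the supremum has to do. This is the
    origin of the factor 2 for the Lagrange functions and of the 4 for their squares.\<close>
  then have "Sup (V ` ?T) / 2 < Sup (V ` ?T)" by simp
  then obtain X where X: "X \<in> ?T" "Sup (V ` ?T) / 2 < V X"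
    using less_cSup_iff[of "V ` ?T" "Sup (V ` ?T) / 2"] bdd X0(1) by auto
  define E where "E = eval_mat p e X"
  have dE: "det E \<noteq> 0" using X(2) s by (auto simp: V_def E_def)
  \<comment> \<open>The inverse of \<open>E\<close>, read off from the adjugate: column
    \<open>i\<close> holds the coefficients of the \<open>i\<close>th Lagrange function.\<close>
  define c where "c k i = cofactor E i k / det E" for k i
  show ?thesis
  proof (rule that)
    show "X i \<in> D" if "i < p" for i using X(1) that by auto
  next
    fix j k assume jk: "j < p" "k < p"
    have "(adj_mat E * E) $$ (k, j) = (det E \<cdot>\<^sub>m 1\<^sub>m p) $$ (k, j)"
      by (subst adj_mat(3)[of E p]) (auto simp: E_def)
    also have "(adj_mat E * E) $$ (k, j) = (\<Sum>i<p. cofactor E i k * e j (X i))"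
      using jk by (simp add: E_def eval_mat_def adj_mat_def scalar_prod_def atLeast0LessThan)
    also have "(det E \<cdot>\<^sub>m 1\<^sub>m p) $$ (k, j) = (if j = k then det E else 0)" using jk by auto
    finally have "(\<Sum>i<p. cofactor E i k * e j (X i)) / det E = (if j = k then 1 else 0)" using dE by simp
    then show "(\<Sum>i<p. c k i * e j (X i)) = (if j = k then 1 else (0::real))"
      by (simp add: c_def sum_divide_distrib)
  next
    fix i assume i: "i < p"
    have le: "u (X i) * (\<Sum>k<p. c k i * e k y)\<^sup>2 \<le> 4 * u y" if y: "y \<in> D" for y
    proof -
      have l: "(\<Sum>k<p. c k i * e k y) = det (eval_mat p e (X(i := y))) / det E"
        unfolding det_eval_mat_upd[OF i] by (simp add: c_def sum_divide_distrib E_def)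
      have w: "W (X(i := y)) * sqrt (u (X i)) = W X * sqrt (u y)"
      proof -
        have "W (X(i := y)) = sqrt (u y) * (\<Prod>j\<in>{..<p} - {i}. sqrt (u (X j)))"
          unfolding W_def using i by (subst prod.remove[of _ i]) (auto intro!: prod.cong)
        moreover have "W X = sqrt (u (X i)) * (\<Prod>j\<in>{..<p} - {i}. sqrt (u (X j)))"
          unfolding W_def using i by (subst prod.remove[of _ i]) auto
        ultimately show ?thesis by simp
      qed
      have "X(i := y) \<in> ?T" using X(1) y by auto
      then have "V (X(i := y)) \<le> Sup (V ` ?T)" using bdd by (intro cSup_upper) auto
      then have "V (X(i := y)) \<le> 2 * V X" using X(2) by simp
      then have "\<bar>det (eval_mat p e (X(i := y)))\<bar> * W X \<le> 2 * \<bar>det E\<bar> * W (X(i := y))"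
        using W0[of X] W0[of "X(i := y)"] by (simp add: V_def E_def field_simps)
      then have "\<bar>det (eval_mat p e (X(i := y)))\<bar> * W X * sqrt (u (X i)) \<le> 2 * \<bar>det E\<bar> * W (X(i := y)) * sqrt (u (X i))"
        using u0[of "X i"] by (intro mult_right_mono) auto
      also have "\<dots> = 2 * \<bar>det E\<bar> * (W (X(i := y)) * sqrt (u (X i)))" by (simp only: mult.assoc)
      also have "\<dots> = W X * (2 * \<bar>det E\<bar> * sqrt (u y))" unfolding w by (simp only: mult_ac)
      finally have "W X * (\<bar>det (eval_mat p e (X(i := y)))\<bar> * sqrt (u (X i))) \<le> W X * (2 * \<bar>det E\<bar> * sqrt (u y))"
        by (simp only: mult_ac)
      then have "\<bar>det (eval_mat p e (X(i := y)))\<bar> * sqrt (u (X i)) \<le> 2 * \<bar>det E\<bar> * sqrt (u y)"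
        using W0[of X] by (simp only: mult_le_cancel_left_pos)
      then have "\<bar>\<Sum>k<p. c k i * e k y\<bar> * sqrt (u (X i)) \<le> 2 * sqrt (u y)"
        unfolding l abs_divide using dE by (simp add: divide_le_eq mult_ac)
      then have "(\<bar>\<Sum>k<p. c k i * e k y\<bar> * sqrt (u (X i)))\<^sup>2 \<le> (2 * sqrt (u y))\<^sup>2"
        using u0[of "X i"] by (intro power_mono) auto
      moreover have "(\<bar>\<Sum>k<p. c k i * e k y\<bar> * sqrt (u (X i)))\<^sup>2 = u (X i) * (\<Sum>k<p. c k i * e k y)\<^sup>2"
        unfolding power_mult_distrib power2_abs real_sqrt_pow2[OF less_imp_le[OF u0]] by (rule mult.commute)
      moreover have "(2 * sqrt (u y))\<^sup>2 = 4 * u y"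
        unfolding power_mult_distrib real_sqrt_pow2[OF less_imp_le[OF u0]] by simp
      ultimately show ?thesis by simp
    qed
    \<comment> \<open>Parseval turns the pointwise bound, once integrated, into a bound on the
      coefficient vector.\<close>
    have "u (X i) * (\<Sum>k<p. (c k i)\<^sup>2) = (\<integral>y. u (X i) * (\<Sum>k<p. c k i * e k y)\<^sup>2 \<partial>P)"
      using orthonormal_norm_comb[OF o, of "\<lambda>k. c k i"] by simp
    also have "\<dots> \<le> (\<integral>y. 4 * u y \<partial>P)"
    proof (rule integral_mono_AE)
      show "integrable P (\<lambda>y. u (X i) * (\<Sum>k<p. c k i * e k y)\<^sup>2)"
        using sq_integrable_sq[OF orthonormal_comb_sq[OF o]] by simp
      show "AE y in P. u (X i) * (\<Sum>k<p. c k i * e k y)\<^sup>2 \<le> 4 * u y"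
        using D by eventually_elim (rule le)
    qed (use u in simp)
    finally show "u (X i) * (\<Sum>k<p. (c k i)\<^sup>2) \<le> 4 * (\<integral>x. u x \<partial>P)" by simp
  qed
qed

section \<open>Recovery of square integrable kernels from samples\<close>

text \<open>From here on only second moments matter, so the Gaussian measure is abstracted to a
  probability space \<open>M\<close>. The random function is \<open>h \<omega>\<close>, and
  \<open>P\<close> is the measure of the error norm. Values at single points are required to be
  square integrable only on \<open>D\<close>, where samples are taken.\<close>

locale sq_kernel = M: prob_space M + Q: prob_space P
  for M :: "'a measure" and P :: "'b measure" +
  fixes h :: "'a \<Rightarrow> 'b \<Rightarrow> real" and D :: "'b set"
  assumes h_sq: "sq_integrable (M \<Otimes>\<^sub>M P) (\<lambda>z. h (fst z) (snd z))"
    and h_point: "\<And>x. x \<in> D \<Longrightarrow> sq_integrable M (\<lambda>\<omega>. h \<omega> x)"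
    and h_fun: "\<And>\<omega>. sq_integrable P (h \<omega>)"
    and D_ae: "AE x in P. x \<in> D"
begin

sublocale pair_sigma_finite M P ..

lemma sq_integrable_product:
  assumes a: "sq_integrable M a" and b: "sq_integrable P b"
  shows "sq_integrable (M \<Otimes>\<^sub>M P) (\<lambda>z. a (fst z) * b (snd z))"
proof -
  have [measurable]: "a \<in> borel_measurable M" "b \<in> borel_measurable P"
    using a b by (auto simp: sq_integrable_def)
  have "integrable (M \<Otimes>\<^sub>M P) (\<lambda>z. (a (fst z))\<^sup>2 * (b (snd z))\<^sup>2)"
  proof (rule Fubini_integrable)
    show "integrable M (\<lambda>x. \<integral>y. norm ((a (fst (x, y)))\<^sup>2 * (b (snd (x, y)))\<^sup>2) \<partial>P)"
      using a by (simp add: sq_integrable_def)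
    show "AE x in M. integrable P (\<lambda>y. (a (fst (x, y)))\<^sup>2 * (b (snd (x, y)))\<^sup>2)"
      using b by (simp add: sq_integrable_def)
  qed measurable
  then show ?thesis by (simp add: sq_integrable_def power_mult_distrib)
qed

text \<open>The assumptions on \<open>h\<close> as a predicate, because residuals of
  \<open>h\<close> are sampled and expanded as well.\<close>

definition nice_kernel :: "('a \<Rightarrow> 'b \<Rightarrow> real) \<Rightarrow> bool" where
  "nice_kernel g \<longleftrightarrow> sq_integrable (M \<Otimes>\<^sub>M P) (\<lambda>z. g (fst z) (snd z)) \<and>
    (\<forall>x\<in>D. sq_integrable M (\<lambda>\<omega>. g \<omega> x)) \<and> (\<forall>\<omega>. sq_integrable P (g \<omega>))"

lemma nice_kernel_sub_lin:
  assumes e: "\<And>k. k < (p::nat) \<Longrightarrow> sq_integrable P (e k)" and a: "\<And>k. k < p \<Longrightarrow> sq_integrable M (a k)"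
  shows "nice_kernel (\<lambda>\<omega> y. h \<omega> y - (\<Sum>k<p. a k \<omega> * e k y))"
  unfolding nice_kernel_def
proof (intro conjI ballI allI)
  show "sq_integrable (M \<Otimes>\<^sub>M P) (\<lambda>z. h (fst z) (snd z) - (\<Sum>k<p. a k (fst z) * e k (snd z)))"
    by (intro sq_integrable_diff h_sq sq_integrable_sum sq_integrable_product a e) auto
  show "sq_integrable P (\<lambda>y. h \<omega> y - (\<Sum>k<p. a k \<omega> * e k y))" for \<omega>
    by (intro sq_integrable_diff h_fun sq_integrable_lin_sum e) auto
  show "sq_integrable M (\<lambda>\<omega>. h \<omega> x - (\<Sum>k<p. a k \<omega> * e k x))" if "x \<in> D" for x
    using sq_integrable_lin_sum[of "{..<p}" M a "\<lambda>k. e k x"] a h_point[OF that]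
    by (intro sq_integrable_diff) (auto simp: mult.commute)
qed

lemma nice_kernel_sub_comb:
  assumes "orthonormal P p e" and "\<And>k. k < p \<Longrightarrow> sq_integrable M (a k)"
  shows "nice_kernel (\<lambda>\<omega> y. h \<omega> y - (\<Sum>k<p. a k \<omega> * e k y))"
  by (intro nice_kernel_sub_lin orthonormal_sq[OF assms(1)] assms(2)) auto

lemma nice_kernel_ip_sq_integrable:
  assumes g: "nice_kernel g" and o: "orthonormal P p e" and k: "k < p"
  shows "sq_integrable M (\<lambda>\<omega>. \<integral>y. g \<omega> y * e k y \<partial>P)"
proof -
  have gm[measurable]: "(\<lambda>z. g (fst z) (snd z)) \<in> borel_measurable (M \<Otimes>\<^sub>M P)"
    and g2: "integrable (M \<Otimes>\<^sub>M P) (\<lambda>z. (g (fst z) (snd z))\<^sup>2)"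
    using g by (auto simp: nice_kernel_def sq_integrable_def)
  have [measurable]: "e k \<in> borel_measurable P" using orthonormal_sq[OF o k] by (simp add: sq_integrable_def)
  have m: "(\<lambda>\<omega>. \<integral>y. g \<omega> y * e k y \<partial>P) \<in> borel_measurable M"
  proof -
    have "(\<lambda>z. g (fst z) (snd z) * e k (snd z)) \<in> borel_measurable (M \<Otimes>\<^sub>M P)" by measurable
    then show ?thesis
      using Q.borel_measurable_lebesgue_integral[of "\<lambda>\<omega> y. g \<omega> y * e k y" M] by (simp add: case_prod_unfold)
  qed
  have i: "integrable M (\<lambda>\<omega>. \<integral>y. (g \<omega> y)\<^sup>2 \<partial>P)"
    using integrable_fst'[OF g2] by simp
  have "integrable M (\<lambda>\<omega>. (\<integral>y. g \<omega> y * e k y \<partial>P)\<^sup>2)"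
  proof (rule Bochner_Integration.integrable_bound[OF i])
    show "AE \<omega> in M. norm ((\<integral>y. g \<omega> y * e k y \<partial>P)\<^sup>2) \<le> norm (\<integral>y. (g \<omega> y)\<^sup>2 \<partial>P)"
    proof (intro AE_I2)
      fix \<omega>
      have "(\<integral>y. g \<omega> y * e k y \<partial>P)\<^sup>2 \<le> (\<Sum>k<p. (\<integral>y. g \<omega> y * e k y \<partial>P)\<^sup>2)"
        using k by (intro member_le_sum) auto
      also have "\<dots> \<le> (\<integral>y. (g \<omega> y)\<^sup>2 \<partial>P)"
        using g by (intro bessel[OF o]) (auto simp: nice_kernel_def)
      finally show "norm ((\<integral>y. g \<omega> y * e k y \<partial>P)\<^sup>2) \<le> norm (\<integral>y. (g \<omega> y)\<^sup>2 \<partial>P)" by simp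
    qed
  qed (use m in measurable)
  then show ?thesis using m by (simp add: sq_integrable_def)
qed

definition sqnorm :: "('a \<Rightarrow> 'b \<Rightarrow> real) \<Rightarrow> real" where
  "sqnorm g = (\<integral>\<omega>. (\<integral>y. (g \<omega> y)\<^sup>2 \<partial>P) \<partial>M)"

lemma sqnorm_nonneg: "0 \<le> sqnorm g"
  by (simp add: sqnorm_def)

lemma nice_kernel_swap:
  assumes "nice_kernel g"
  shows "integrable P (\<lambda>y. \<integral>\<omega>. (g \<omega> y)\<^sup>2 \<partial>M)" "(\<integral>y. (\<integral>\<omega>. (g \<omega> y)\<^sup>2 \<partial>M) \<partial>P) = sqnorm g"
    "integrable M (\<lambda>\<omega>. \<integral>y. (g \<omega> y)\<^sup>2 \<partial>P)"
proof -
  have g2: "integrable (M \<Otimes>\<^sub>M P) (\<lambda>(\<omega>, y). (g \<omega> y)\<^sup>2)"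
    using assms by (simp add: nice_kernel_def sq_integrable_def case_prod_unfold)
  show "integrable P (\<lambda>y. \<integral>\<omega>. (g \<omega> y)\<^sup>2 \<partial>M)" by (rule integrable_snd[OF g2])
  show "(\<integral>y. (\<integral>\<omega>. (g \<omega> y)\<^sup>2 \<partial>M) \<partial>P) = sqnorm g" unfolding sqnorm_def by (rule Fubini_integral[OF g2])
  show "integrable M (\<lambda>\<omega>. \<integral>y. (g \<omega> y)\<^sup>2 \<partial>P)" by (rule integrable_fst[OF g2])
qed

abbreviation coef :: "(nat \<Rightarrow> 'b \<Rightarrow> real) \<Rightarrow> nat \<Rightarrow> 'a \<Rightarrow> real" where
  "coef e k \<omega> \<equiv> (\<integral>y. h \<omega> y * e k y \<partial>P)"

lemma nice_kernel_h: "nice_kernel h"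
  using h_sq h_point h_fun by (simp add: nice_kernel_def)

lemma coef_sq: "orthonormal P p e \<Longrightarrow> k < p \<Longrightarrow> sq_integrable M (coef e k)"
  by (rule nice_kernel_ip_sq_integrable[OF nice_kernel_h])

abbreviation proj_err :: "nat \<Rightarrow> (nat \<Rightarrow> 'b \<Rightarrow> real) \<Rightarrow> real" where
  "proj_err p e \<equiv> sqnorm (\<lambda>\<omega> y. h \<omega> y - (\<Sum>k<p. coef e k \<omega> * e k y))"

text \<open>Pythagoras for each \<open>\<omega>\<close>, integrated. The last sum is the quantity
  \<open>\<Delta>\<close> of the overview.\<close>

lemma sqnorm_sub_comb:
  assumes o: "orthonormal P p e" and a: "\<And>k. k < p \<Longrightarrow> sq_integrable M (a k)"
  shows "sqnorm (\<lambda>\<omega> y. h \<omega> y - (\<Sum>k<p. a k \<omega> * e k y))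
    = proj_err p e + (\<Sum>k<p. \<integral>\<omega>. (coef e k \<omega> - a k \<omega>)\<^sup>2 \<partial>M)"
proof -
  have i: "integrable M (\<lambda>\<omega>. (coef e k \<omega> - a k \<omega>)\<^sup>2)" if "k < p" for k
    by (intro sq_integrable_sq sq_integrable_diff coef_sq[OF o] a that)
  have "sqnorm (\<lambda>\<omega> y. h \<omega> y - (\<Sum>k<p. a k \<omega> * e k y))
    = (\<integral>\<omega>. (\<integral>y. (h \<omega> y - (\<Sum>k<p. coef e k \<omega> * e k y))\<^sup>2 \<partial>P) + (\<Sum>k<p. (coef e k \<omega> - a k \<omega>)\<^sup>2) \<partial>M)"
    unfolding sqnorm_def
    by (intro Bochner_Integration.integral_cong refl residual_pythagoras[OF o h_fun])
  also have "\<dots> = proj_err p e + (\<integral>\<omega>. (\<Sum>k<p. (coef e k \<omega> - a k \<omega>)\<^sup>2) \<partial>M)"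
    unfolding sqnorm_def
    by (intro Bochner_Integration.integral_add nice_kernel_swap(3) nice_kernel_sub_comb[OF o] coef_sq[OF o]
        Bochner_Integration.integrable_sum i) auto
  also have "(\<integral>\<omega>. (\<Sum>k<p. (coef e k \<omega> - a k \<omega>)\<^sup>2) \<partial>M) = (\<Sum>k<p. \<integral>\<omega>. (coef e k \<omega> - a k \<omega>)\<^sup>2 \<partial>M)"
    using i by (intro Bochner_Integration.integral_sum) auto
  finally show ?thesis .
qed

section \<open>Random variables computable from finitely many samples\<close>

definition hspan :: "'b set \<Rightarrow> ('a \<Rightarrow> real) set" where
  "hspan A = {f. \<exists>c. f = (\<lambda>\<omega>. \<Sum>x\<in>A. c x * h \<omega> x)}"

lemma hspan_add: assumes "f \<in> hspan A" "g \<in> hspan A" shows "(\<lambda>\<omega>. f \<omega> + g \<omega>) \<in> hspan A"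
proof -
  obtain c d where "f = (\<lambda>\<omega>. \<Sum>x\<in>A. c x * h \<omega> x)" "g = (\<lambda>\<omega>. \<Sum>x\<in>A. d x * h \<omega> x)"
    using assms by (auto simp: hspan_def)
  then have "(\<lambda>\<omega>. f \<omega> + g \<omega>) = (\<lambda>\<omega>. \<Sum>x\<in>A. (c x + d x) * h \<omega> x)"
    by (simp add: sum.distrib algebra_simps)
  then show ?thesis by (force simp: hspan_def)
qed

lemma hspan_cmult: assumes "f \<in> hspan A" shows "(\<lambda>\<omega>. t * f \<omega>) \<in> hspan A"
proof -
  obtain c where "f = (\<lambda>\<omega>. \<Sum>x\<in>A. c x * h \<omega> x)" using assms by (auto simp: hspan_def)
  then have "(\<lambda>\<omega>. t * f \<omega>) = (\<lambda>\<omega>. \<Sum>x\<in>A. (t * c x) * h \<omega> x)"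
    by (simp add: sum_distrib_left algebra_simps)
  then show ?thesis by (force simp: hspan_def)
qed

lemma hspan_sum: assumes "\<And>i. i \<in> I \<Longrightarrow> f i \<in> hspan A" shows "(\<lambda>\<omega>. \<Sum>i\<in>I. t i * f i \<omega>) \<in> hspan A"
  using assms
proof (induction I rule: infinite_finite_induct)
  case (insert i I)
  then show ?case by (simp add: hspan_add hspan_cmult)
qed (auto simp: hspan_def intro!: exI[of _ "\<lambda>_. 0"])

lemma hspan_point: assumes "finite A" "x \<in> A" shows "(\<lambda>\<omega>. h \<omega> x) \<in> hspan A"
proof -
  have "h \<omega> x = (\<Sum>y\<in>A. (if y = x then 1 else 0) * h \<omega> y)" for \<omega>
    using assms by (subst sum.remove[of _ x]) (auto intro!: sum.neutral)
  then show ?thesis by (force simp: hspan_def)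
qed

lemma hspan_mono: assumes "finite B" "A \<subseteq> B" "f \<in> hspan A" shows "f \<in> hspan B"
proof -
  obtain c where f: "f = (\<lambda>\<omega>. \<Sum>x\<in>A. c x * h \<omega> x)" using assms by (auto simp: hspan_def)
  show ?thesis unfolding f using assms by (intro hspan_sum hspan_point) auto
qed

lemma hspan_sq: assumes "A \<subseteq> D" "f \<in> hspan A" shows "sq_integrable M f"
  using assms by (auto simp: hspan_def intro!: sq_integrable_lin_sum h_point)

lemma square_of_sum_le: "(\<Sum>i<n. a i :: real)\<^sup>2 \<le> real n * (\<Sum>i<n. (a i)\<^sup>2)"
  using Cauchy_Schwarz_ineq_sum[of "\<lambda>_. 1" a "{..<n}"] by simp

text \<open>Interpolation reproduces the span of \<open>e\<close>, so up to sign its coefficient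
  error is the interpolation of the projection residual \<open>r\<close>. That is bounded by the
  mean squares of \<open>r\<close> at the points, which a suitable Fekete weight controls.\<close>

lemma interpolation_start:
  assumes o: "orthonormal P p e"
  obtains A a where "finite A" "A \<subseteq> D" "card A \<le> p" "\<And>k. k < p \<Longrightarrow> a k \<in> hspan A"
    "(\<Sum>k<p. \<integral>\<omega>. (coef e k \<omega> - a k \<omega>)\<^sup>2 \<partial>M) \<le> 4 * real p ^ 2 * (real p + 2) * proj_err p e"
proof -
  define r where "r \<omega> y = h \<omega> y - (\<Sum>k<p. coef e k \<omega> * e k y)" for \<omega> y
  have r: "nice_kernel r" unfolding r_def[abs_def] by (rule nice_kernel_sub_comb[OF o coef_sq[OF o]])
  define R where "R y = (\<integral>\<omega>. (r \<omega> y)\<^sup>2 \<partial>M)" for y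
  define E where "E = proj_err p e"
  have E: "E = sqnorm r" unfolding E_def r_def[abs_def] ..
  have E0: "0 \<le> E" unfolding E by (rule sqnorm_nonneg)
  have R0: "0 \<le> R y" for y by (simp add: R_def)
  have Ri: "integrable P R" and RE: "(\<integral>y. R y \<partial>P) = E"
    using nice_kernel_swap[OF r] by (simp_all add: R_def[abs_def] E)
  \<comment> \<open>The first summand is the domination required for Fekete points,
    \<open>R / E\<close> bounds the mean square residual at a point by \<open>E * u\<close>, and the
    1 makes the weight positive. Their integrals add up to at most \<open>p + 2\<close>.\<close>
  define u where "u y = (\<Sum>k<p. (e k y)\<^sup>2) + R y / E + 1" for y
  \<comment> \<open>For \<open>E = 0\<close> the term \<open>R y / E\<close> is 0 by convention and
    bounds nothing, so the points are confined to the set of full measure where \<open>R\<close>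
    vanishes.\<close>
  define D' where "D' = {y \<in> D. E = 0 \<longrightarrow> R y = 0}"
  have "AE y in P. E = 0 \<longrightarrow> R y = 0"
  proof (cases "E = 0")
    case True
    have "AE y in P. R y = 0" using True RE Ri R0 by (subst integral_nonneg_eq_0_iff_AE[symmetric]) auto
    then show ?thesis by auto
  qed auto
  with D_ae have D': "AE y in P. y \<in> D'" by eventually_elim (auto simp: D'_def)
  have u0: "0 < u y" and ue: "(\<Sum>k<p. (e k y)\<^sup>2) \<le> u y" for y
    using R0[of y] E0 by (auto simp: u_def intro!: add_nonneg_pos add_nonneg_nonneg sum_nonneg)
  have ei: "integrable P (\<lambda>y. (e k y)\<^sup>2)" "(\<integral>y. (e k y)\<^sup>2 \<partial>P) = 1" if "k < p" for k
    using orthonormal_sq[OF o that] orthonormal_ip[OF o that that] by (auto simp: sq_integrable_def power2_eq_square)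
  have ui: "integrable P u" unfolding u_def[abs_def]
    by (intro Bochner_Integration.integrable_add Bochner_Integration.integrable_sum ei(1) integrable_divide Ri) auto
  have "(\<integral>y. u y \<partial>P) = (\<integral>y. (\<Sum>k<p. (e k y)\<^sup>2) + R y / E \<partial>P) + (\<integral>y. 1 \<partial>P)"
    unfolding u_def
    by (intro Bochner_Integration.integral_add Bochner_Integration.integrable_add
        Bochner_Integration.integrable_sum ei(1) integrable_divide Ri) auto
  also have "(\<integral>y. (\<Sum>k<p. (e k y)\<^sup>2) + R y / E \<partial>P) = (\<integral>y. (\<Sum>k<p. (e k y)\<^sup>2) \<partial>P) + (\<integral>y. R y / E \<partial>P)"
    by (intro Bochner_Integration.integral_add Bochner_Integration.integrable_sum ei(1) integrable_divide Ri) auto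
  also have "(\<integral>y. (\<Sum>k<p. (e k y)\<^sup>2) \<partial>P) = (\<Sum>k<p. \<integral>y. (e k y)\<^sup>2 \<partial>P)"
    by (intro Bochner_Integration.integral_sum ei(1)) auto
  also have "(\<integral>y. R y / E \<partial>P) = E / E" using RE by simp
  also have "(\<integral>y. (1::real) \<partial>P) = 1" by (simp add: Q.prob_space)
  also have "(\<Sum>k<p. \<integral>y. (e k y)\<^sup>2 \<partial>P) = real p" by (simp add: ei(2))
  finally have "(\<integral>y. u y \<partial>P) = real p + E / E + 1" .
  then have U: "(\<integral>y. u y \<partial>P) \<le> real p + 2" by (cases "E = 0") auto
  obtain X c where X: "\<And>i. i < p \<Longrightarrow> X i \<in> D'"
    and c: "\<And>j k. j < p \<Longrightarrow> k < p \<Longrightarrow> (\<Sum>i<p. c k i * e j (X i)) = (if j = k then 1 else (0::real))"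
    and uc: "\<And>i. i < p \<Longrightarrow> u (X i) * (\<Sum>k<p. (c k i)\<^sup>2) \<le> 4 * (\<integral>x. u x \<partial>P)"
    using fekete_points[OF o D' u0 ue ui] by blast
  have XD: "X i \<in> D" if "i < p" for i using X[OF that] by (simp add: D'_def)
  have RX: "R (X i) \<le> E * u (X i)" if "i < p" for i
  proof (cases "E = 0")
    case True then show ?thesis using X[OF that] by (simp add: D'_def)
  next
    case False
    then have "R (X i) = E * (R (X i) / E)" by simp
    also have "\<dots> \<le> E * u (X i)" using E0 by (intro mult_left_mono) (auto simp: u_def sum_nonneg)
    finally show ?thesis .
  qed
  define a where "a k \<omega> = (\<Sum>i<p. c k i * h \<omega> (X i))" for k \<omega>
  show ?thesis
  proof (rule that)
    show "finite (X ` {..<p})" "X ` {..<p} \<subseteq> D" "card (X ` {..<p}) \<le> p"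
      using XD card_image_le[of "{..<p}" X] by auto
    show "a k \<in> hspan (X ` {..<p})" if "k < p" for k
      unfolding a_def[abs_def] by (intro hspan_sum hspan_point) auto
    have diff: "coef e k \<omega> - a k \<omega> = - (\<Sum>i<p. c k i * r \<omega> (X i))" if "k < p" for k \<omega>
    proof -
      have "(\<Sum>i<p. c k i * r \<omega> (X i)) = a k \<omega> - (\<Sum>i<p. \<Sum>j<p. c k i * (coef e j \<omega> * e j (X i)))"
        by (simp add: r_def a_def right_diff_distrib sum_subtractf sum_distrib_left)
      also have "(\<Sum>i<p. \<Sum>j<p. c k i * (coef e j \<omega> * e j (X i))) = (\<Sum>j<p. coef e j \<omega> * (\<Sum>i<p. c k i * e j (X i)))"
        by (subst sum.swap) (simp add: sum_distrib_left mult_ac)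
      also have "\<dots> = (\<Sum>j<p. if j = k then coef e j \<omega> else 0)"
        using c that by (intro sum.cong) auto
      finally show ?thesis using that by simp
    qed
    have ri: "integrable M (\<lambda>\<omega>. (r \<omega> (X i))\<^sup>2)" if "i < p" for i
      using r XD[OF that] by (auto simp: nice_kernel_def sq_integrable_def)
    have rsq: "sq_integrable M (\<lambda>\<omega>. r \<omega> (X i))" if "i < p" for i
      using r XD[OF that] by (auto simp: nice_kernel_def)
    \<comment> \<open>Cauchy-Schwarz over the \<open>p\<close> points gives one factor
      \<open>p\<close> and the sum over the points another; \<open>4 * (p + 2)\<close> is the Fekete
      bound.\<close>
    have "(\<Sum>k<p. \<integral>\<omega>. (coef e k \<omega> - a k \<omega>)\<^sup>2 \<partial>M) \<le> (\<Sum>k<p. real p * (\<Sum>i<p. (c k i)\<^sup>2 * R (X i)))"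
    proof (rule sum_mono)
      fix k assume "k \<in> {..<p}"
      then have k: "k < p" by simp
      have "(\<integral>\<omega>. (coef e k \<omega> - a k \<omega>)\<^sup>2 \<partial>M) \<le> (\<integral>\<omega>. real p * (\<Sum>i<p. (c k i)\<^sup>2 * (r \<omega> (X i))\<^sup>2) \<partial>M)"
      proof (rule integral_mono)
        show "integrable M (\<lambda>\<omega>. (coef e k \<omega> - a k \<omega>)\<^sup>2)"
          unfolding diff[OF k] by (simp, intro sq_integrable_sq sq_integrable_lin_sum rsq, simp)
        show "integrable M (\<lambda>\<omega>. real p * (\<Sum>i<p. (c k i)\<^sup>2 * (r \<omega> (X i))\<^sup>2))"
          using ri by auto
        show "(coef e k \<omega> - a k \<omega>)\<^sup>2 \<le> real p * (\<Sum>i<p. (c k i)\<^sup>2 * (r \<omega> (X i))\<^sup>2)" for \<omega>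
          unfolding diff[OF k] using square_of_sum_le[of "\<lambda>i. c k i * r \<omega> (X i)" p]
          by (simp add: power_mult_distrib)
      qed
      also have "\<dots> = real p * (\<Sum>i<p. (c k i)\<^sup>2 * R (X i))"
        using ri by (simp add: R_def Bochner_Integration.integral_sum)
      finally show "(\<integral>\<omega>. (coef e k \<omega> - a k \<omega>)\<^sup>2 \<partial>M) \<le> real p * (\<Sum>i<p. (c k i)\<^sup>2 * R (X i))" .
    qed
    also have "\<dots> = real p * (\<Sum>i<p. R (X i) * (\<Sum>k<p. (c k i)\<^sup>2))"
      by (subst sum_distrib_left[symmetric], subst sum.swap) (simp add: sum_distrib_left mult_ac)
    also have "\<dots> \<le> real p * (\<Sum>i<p. E * (4 * (real p + 2)))"
    proof (intro mult_left_mono sum_mono)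
      fix i assume "i \<in> {..<p}"
      then have i: "i < p" by simp
      have "R (X i) * (\<Sum>k<p. (c k i)\<^sup>2) \<le> E * u (X i) * (\<Sum>k<p. (c k i)\<^sup>2)"
        by (intro mult_right_mono RX i sum_nonneg) auto
      also have "\<dots> = E * (u (X i) * (\<Sum>k<p. (c k i)\<^sup>2))" by simp
      also have "\<dots> \<le> E * (4 * (real p + 2))"
        using uc[OF i] U E0 by (intro mult_left_mono) auto
      finally show "R (X i) * (\<Sum>k<p. (c k i)\<^sup>2) \<le> E * (4 * (real p + 2))" .
    qed simp
    also have "\<dots> = 4 * real p ^ 2 * (real p + 2) * E" by (simp add: power2_eq_square)
    finally show "(\<Sum>k<p. \<integral>\<omega>. (coef e k \<omega> - a k \<omega>)\<^sup>2 \<partial>M) \<le> 4 * real p ^ 2 * (real p + 2) * proj_err p e"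
      by (simp add: E_def)
  qed
qed

section \<open>Importance sampled Monte Carlo correction\<close>

definition mc_weight :: "nat \<Rightarrow> (nat \<Rightarrow> 'b \<Rightarrow> real) \<Rightarrow> 'b \<Rightarrow> real" where
  "mc_weight p e x = (\<Sum>k<p. (e k x)\<^sup>2) / real p"

text \<open>A one-point estimate of the \<open>k\<close>th coefficient of \<open>g\<close> minus its
  true value. Where the weight vanishes, so do all \<open>e k\<close> with \<open>k < p\<close>, and
  the quotient is 0.\<close>

definition mc_dev :: "nat \<Rightarrow> (nat \<Rightarrow> 'b \<Rightarrow> real) \<Rightarrow> ('a \<Rightarrow> 'b \<Rightarrow> real) \<Rightarrow> nat \<Rightarrow> 'b \<Rightarrow> 'a \<Rightarrow> real" where
  "mc_dev p e g k x \<omega> = g \<omega> x * e k x / mc_weight p e x - (\<integral>y. g \<omega> y * e k y \<partial>P)"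

lemma mc_dev_sq:
  assumes "orthonormal P p e" "nice_kernel g" "k < p" "x \<in> D"
  shows "sq_integrable M (mc_dev p e g k x)"
proof -
  have "sq_integrable M (\<lambda>\<omega>. (e k x / mc_weight p e x) * g \<omega> x)"
    using assms by (intro sq_integrable_cmult) (auto simp: nice_kernel_def)
  from sq_integrable_diff[OF this nice_kernel_ip_sq_integrable[OF assms(2,1,3)]]
  show ?thesis unfolding mc_dev_def[abs_def] by (simp add: mult.commute)
qed

text \<open>Under the density \<open>mc_weight\<close> the deviations have mean zero and total second moment at most
  \<open>p\<close> times the squared norm of \<open>g\<close>, so some point is at least as good as the average.\<close>

lemma mc_point:
  assumes o: "orthonormal P p e" and p: "0 < p" and g: "nice_kernel g"
    and s: "\<And>k. k < p \<Longrightarrow> sq_integrable M (s k)"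
  shows "\<exists>x\<in>D. (\<Sum>k<p. \<integral>\<omega>. (s k \<omega> + mc_dev p e g k x \<omega>)\<^sup>2 \<partial>M) \<le> (\<Sum>k<p. \<integral>\<omega>. (s k \<omega>)\<^sup>2 \<partial>M) + real p * sqnorm g"
proof (rule ccontr)
  define B where "B = (\<Sum>k<p. \<integral>\<omega>. (s k \<omega>)\<^sup>2 \<partial>M) + real p * sqnorm g"
  define T where "T x = (\<Sum>k<p. \<integral>\<omega>. (s k \<omega> + mc_dev p e g k x \<omega>)\<^sup>2 \<partial>M)" for x
  assume "\<not> ?thesis"
  then have TB: "B < T x" if "x \<in> D" for x using that by (auto simp: T_def B_def not_le)
  define b where "b k \<omega> = (\<integral>y. g \<omega> y * e k y \<partial>P)" for k \<omega>
  \<comment> \<open>With the mean \<open>b\<close> absorbed into \<open>d\<close>, the only term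
    that depends on the point is \<open>g \<omega> x * e k x / w x\<close>.\<close>
  define d where "d k \<omega> = s k \<omega> - b k \<omega>" for k \<omega>
  define w where "w = mc_weight p e"
  have bs: "sq_integrable M (b k)" if "k < p" for k
    unfolding b_def[abs_def] by (rule nice_kernel_ip_sq_integrable[OF g o that])
  have ds: "sq_integrable M (d k)" if "k < p" for k
    unfolding d_def[abs_def] by (intro sq_integrable_diff s bs that)
  define I where "I k x = (\<integral>\<omega>. d k \<omega> * g \<omega> x \<partial>M)" for k x
  define G where "G x = (\<integral>\<omega>. (g \<omega> x)\<^sup>2 \<partial>M)" for x
  define A where "A = (\<Sum>k<p. \<integral>\<omega>. (d k \<omega>)\<^sup>2 \<partial>M)"
  \<comment> \<open>This is \<open>w * T\<close> with the square expanded and the quotient by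
    \<open>w\<close> cancelled, using that the squares of the \<open>e k\<close> sum to
    \<open>p * w\<close>. It is integrable and bounds \<open>w * T\<close> also where
    \<open>w\<close> vanishes.\<close>
  define Z where "Z x = w x * A + 2 * (\<Sum>k<p. I k x * e k x) + real p * G x" for x
  have w0: "0 \<le> w x" for x by (simp add: w_def mc_weight_def sum_nonneg)
  have wT: "w x * T x \<le> Z x" if x: "x \<in> D" for x
  proof (cases "w x = 0")
    case True
    then have "(\<Sum>k<p. (e k x)\<^sup>2) = 0" using p by (simp add: w_def mc_weight_def)
    then have "e k x = 0" if "k < p" for k using that by (subst (asm) sum_nonneg_eq_0_iff) auto
    moreover have "0 \<le> G x" by (simp add: G_def)
    ultimately show ?thesis using True by (simp add: Z_def)
  next
    case False
    have gx: "sq_integrable M (\<lambda>\<omega>. g \<omega> x)" using g x by (simp add: nice_kernel_def)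
    have "w x * (\<integral>\<omega>. (s k \<omega> + mc_dev p e g k x \<omega>)\<^sup>2 \<partial>M)
      = w x * (\<integral>\<omega>. (d k \<omega>)\<^sup>2 \<partial>M) + 2 * (I k x * e k x) + (e k x)\<^sup>2 / w x * G x" if k: "k < p" for k
    proof -
      define t where "t = e k x / w x"
      have "(\<integral>\<omega>. (s k \<omega> + mc_dev p e g k x \<omega>)\<^sup>2 \<partial>M)
        = (\<integral>\<omega>. (d k \<omega>)\<^sup>2 + (2 * t * (d k \<omega> * g \<omega> x) + t\<^sup>2 * (g \<omega> x)\<^sup>2) \<partial>M)"
        by (intro Bochner_Integration.integral_cong refl)
          (simp add: mc_dev_def d_def b_def t_def w_def power2_eq_square algebra_simps)
      also have "\<dots> = (\<integral>\<omega>. (d k \<omega>)\<^sup>2 \<partial>M) + ((\<integral>\<omega>. 2 * t * (d k \<omega> * g \<omega> x) \<partial>M) + (\<integral>\<omega>. t\<^sup>2 * (g \<omega> x)\<^sup>2 \<partial>M))"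
        using sq_integrable_sq[OF ds[OF k]] sq_integrable_sq[OF gx] sq_integrable_mult[OF ds[OF k] gx]
        by (subst Bochner_Integration.integral_add; (subst Bochner_Integration.integral_add)?) auto
      also have "\<dots> = (\<integral>\<omega>. (d k \<omega>)\<^sup>2 \<partial>M) + (2 * t * I k x + t\<^sup>2 * G x)"
        by (simp add: I_def G_def)
      finally show ?thesis using False by (simp add: t_def power2_eq_square field_simps)
    qed
    then have "w x * T x = (\<Sum>k<p. w x * (\<integral>\<omega>. (d k \<omega>)\<^sup>2 \<partial>M) + 2 * (I k x * e k x) + (e k x)\<^sup>2 / w x * G x)"
      by (simp add: T_def sum_distrib_left)
    also have "\<dots> = w x * A + 2 * (\<Sum>k<p. I k x * e k x) + (\<Sum>k<p. (e k x)\<^sup>2) / w x * G x"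
      by (simp add: A_def sum.distrib sum_distrib_left sum_distrib_right sum_divide_distrib)
    also have "(\<Sum>k<p. (e k x)\<^sup>2) = real p * w x" using p by (simp add: w_def mc_weight_def)
    finally show ?thesis using False by (simp add: Z_def)
  qed
  have e2: "integrable P (\<lambda>y. (e k y)\<^sup>2)" "(\<integral>y. (e k y)\<^sup>2 \<partial>P) = 1" if "k < p" for k
    using orthonormal_sq[OF o that] orthonormal_ip[OF o that that] by (auto simp: sq_integrable_def power2_eq_square)
  have wi: "integrable P w" unfolding w_def mc_weight_def[abs_def]
    by (intro integrable_divide Bochner_Integration.integrable_sum e2) auto
  have w1: "(\<integral>x. w x \<partial>P) = 1"
  proof -
    have "(\<integral>x. w x \<partial>P) = (\<integral>x. (\<Sum>k<p. (e k x)\<^sup>2) \<partial>P) / real p" by (simp add: w_def mc_weight_def)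
    also have "(\<integral>x. (\<Sum>k<p. (e k x)\<^sup>2) \<partial>P) = (\<Sum>k<p. \<integral>x. (e k x)\<^sup>2 \<partial>P)"
      by (intro Bochner_Integration.integral_sum e2) auto
    finally show ?thesis using e2 p by simp
  qed
  have dge: "integrable (M \<Otimes>\<^sub>M P) (\<lambda>(\<omega>, y). d k \<omega> * g \<omega> y * e k y)" if k: "k < p" for k
  proof -
    have "integrable (M \<Otimes>\<^sub>M P) (\<lambda>z. (d k (fst z) * e k (snd z)) * g (fst z) (snd z))"
      using g by (intro sq_integrable_mult sq_integrable_product ds k orthonormal_sq[OF o k]) (simp add: nice_kernel_def)
    then show ?thesis by (simp add: case_prod_unfold mult_ac)
  qed
  have Ii: "integrable P (\<lambda>y. I k y * e k y)" "(\<integral>y. I k y * e k y \<partial>P) = (\<integral>\<omega>. d k \<omega> * b k \<omega> \<partial>M)" if k: "k < p" for k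
  proof -
    show "integrable P (\<lambda>y. I k y * e k y)" using integrable_snd[OF dge[OF k]] by (simp add: I_def)
    have "(\<integral>y. I k y * e k y \<partial>P) = (\<integral>y. (\<integral>\<omega>. d k \<omega> * g \<omega> y * e k y \<partial>M) \<partial>P)" by (simp add: I_def)
    also have "\<dots> = (\<integral>\<omega>. (\<integral>y. d k \<omega> * g \<omega> y * e k y \<partial>P) \<partial>M)" by (rule Fubini_integral[OF dge[OF k]])
    also have "\<dots> = (\<integral>\<omega>. d k \<omega> * b k \<omega> \<partial>M)" unfolding b_def mult.assoc by simp
    finally show "(\<integral>y. I k y * e k y \<partial>P) = (\<integral>\<omega>. d k \<omega> * b k \<omega> \<partial>M)" .
  qed
  have Gi: "integrable P G" "(\<integral>y. G y \<partial>P) = sqnorm g"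
    using nice_kernel_swap[OF g] by (simp_all add: G_def[abs_def])
  have Zi: "integrable P Z" unfolding Z_def[abs_def]
    by (intro Bochner_Integration.integrable_add integrable_mult_left integrable_mult_right
        Bochner_Integration.integrable_sum wi Ii Gi) auto
  have ZB: "(\<integral>x. Z x \<partial>P) \<le> B"
  proof -
    have "(\<integral>x. Z x \<partial>P) = (\<integral>x. w x * A \<partial>P) + (\<integral>x. 2 * (\<Sum>k<p. I k x * e k x) \<partial>P) + (\<integral>x. real p * G x \<partial>P)"
      unfolding Z_def
      by (subst Bochner_Integration.integral_add, (intro Bochner_Integration.integrable_add integrable_mult_left integrable_mult_right
        Bochner_Integration.integrable_sum wi Ii Gi; simp)+,
        subst Bochner_Integration.integral_add, (intro Bochner_Integration.integrable_add integrable_mult_left integrable_mult_right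
        Bochner_Integration.integrable_sum wi Ii Gi; simp)+, rule refl)
    also have "(\<integral>x. 2 * (\<Sum>k<p. I k x * e k x) \<partial>P) = 2 * (\<Sum>k<p. \<integral>\<omega>. d k \<omega> * b k \<omega> \<partial>M)"
    proof -
      have "(\<integral>x. (\<Sum>k<p. I k x * e k x) \<partial>P) = (\<Sum>k<p. \<integral>x. I k x * e k x \<partial>P)"
        by (intro Bochner_Integration.integral_sum Ii) auto
      then show ?thesis using Ii(2) by simp
    qed
    also have "(\<integral>x. w x * A \<partial>P) = A" by (simp add: w1)
    also have "(\<integral>x. real p * G x \<partial>P) = real p * sqnorm g" by (simp add: Gi)
    \<comment> \<open>Since \<open>d = s - b\<close>, the left side is the second moment of
      \<open>s\<close> minus that of \<open>b\<close>, summed over \<open>k\<close>.\<close>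
    also have "A + 2 * (\<Sum>k<p. \<integral>\<omega>. d k \<omega> * b k \<omega> \<partial>M) \<le> (\<Sum>k<p. \<integral>\<omega>. (s k \<omega>)\<^sup>2 \<partial>M)"
      unfolding A_def sum_distrib_left sum.distrib[symmetric]
    proof (rule sum_mono)
      fix k assume "k \<in> {..<p}"
      then have k: "k < p" by simp
      have "(\<integral>\<omega>. (d k \<omega>)\<^sup>2 \<partial>M) + 2 * (\<integral>\<omega>. d k \<omega> * b k \<omega> \<partial>M) = (\<integral>\<omega>. (d k \<omega>)\<^sup>2 + 2 * (d k \<omega> * b k \<omega>) \<partial>M)"
        using sq_integrable_sq[OF ds[OF k]] sq_integrable_mult[OF ds[OF k] bs[OF k]] by simp
      also have "\<dots> \<le> (\<integral>\<omega>. (s k \<omega>)\<^sup>2 \<partial>M)"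
      proof (rule integral_mono)
        show "integrable M (\<lambda>\<omega>. (d k \<omega>)\<^sup>2 + 2 * (d k \<omega> * b k \<omega>))"
          using sq_integrable_sq[OF ds[OF k]] sq_integrable_mult[OF ds[OF k] bs[OF k]] by simp
        show "(d k \<omega>)\<^sup>2 + 2 * (d k \<omega> * b k \<omega>) \<le> (s k \<omega>)\<^sup>2" for \<omega>
        proof -
          have "(s k \<omega>)\<^sup>2 = (d k \<omega>)\<^sup>2 + 2 * (d k \<omega> * b k \<omega>) + (b k \<omega>)\<^sup>2"
            by (simp add: d_def power2_eq_square algebra_simps)
          then show ?thesis by simp
        qed
      qed (use sq_integrable_sq[OF s[OF k]] in simp)
      finally show "(\<integral>\<omega>. (d k \<omega>)\<^sup>2 \<partial>M) + 2 * (\<integral>\<omega>. d k \<omega> * b k \<omega> \<partial>M) \<le> (\<integral>\<omega>. (s k \<omega>)\<^sup>2 \<partial>M)" .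
    qed
    finally show ?thesis by (simp add: B_def)
  qed
  \<comment> \<open>If every point were worse than the average, \<open>Z - w * B\<close> would be
    nonnegative with integral at most 0, hence zero almost everywhere. The strict inequality
    \<open>TB\<close> then forces \<open>w = 0\<close> almost everywhere, against
    \<open>w1\<close>.\<close>
  have ge: "AE x in P. 0 \<le> Z x - w x * B"
    using D_ae
  proof eventually_elim
    case (elim x)
    have "w x * B \<le> w x * T x" using TB[OF elim] w0[of x] by (intro mult_left_mono) auto
    then show ?case using wT[OF elim] by simp
  qed
  have i: "integrable P (\<lambda>x. Z x - w x * B)" using Zi wi by simp
  have "(\<integral>x. Z x - w x * B \<partial>P) = (\<integral>x. Z x \<partial>P) - B" using Zi wi w1 by simp
  then have "(\<integral>x. Z x - w x * B \<partial>P) \<le> 0" using ZB by simp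
  moreover have "0 \<le> (\<integral>x. Z x - w x * B \<partial>P)" using ge by (rule integral_nonneg_AE)
  ultimately have "(\<integral>x. Z x - w x * B \<partial>P) = 0" by simp
  then have "AE x in P. Z x - w x * B = 0" using integral_nonneg_eq_0_iff_AE[OF i ge] by simp
  with D_ae have "AE x in P. w x = 0"
  proof eventually_elim
    case (elim x)
    then have "w x * (T x - B) \<le> 0" using wT[of x] by (simp add: right_diff_distrib)
    then show ?case using TB[of x] elim w0[of x] by (simp add: mult_le_0_iff)
  qed
  then have "(\<integral>x. w x \<partial>P) = 0" by (rule integral_eq_zero_AE)
  then show False using w1 by simp
qed

text \<open>Greedy derandomisation: each point is chosen in view of the deviations accumulated so
  far, so that the bounds on second moments add up as for independent mean zero variables.\<close>

lemma mc_points: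
  assumes o: "orthonormal P p e" and p: "0 < p" and g: "nice_kernel g"
  shows "\<exists>xs. (\<forall>i<N. xs i \<in> D) \<and>
    (\<Sum>k<p. \<integral>\<omega>. (\<Sum>i<N. mc_dev p e g k (xs i) \<omega>)\<^sup>2 \<partial>M) \<le> real N * (real p * sqnorm g)"
proof (induction N)
  case 0
  then show ?case by simp
next
  case (Suc N)
  then obtain xs where xs: "\<And>i. i < N \<Longrightarrow> xs i \<in> D"
    and le: "(\<Sum>k<p. \<integral>\<omega>. (\<Sum>i<N. mc_dev p e g k (xs i) \<omega>)\<^sup>2 \<partial>M) \<le> real N * (real p * sqnorm g)"
    by blast
  have sq: "sq_integrable M (\<lambda>\<omega>. \<Sum>i<N. mc_dev p e g k (xs i) \<omega>)" if "k < p" for k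
    using xs that by (intro sq_integrable_sum mc_dev_sq[OF o g]) auto
  from mc_point[OF o p g, of "\<lambda>k \<omega>. \<Sum>i<N. mc_dev p e g k (xs i) \<omega>", OF sq] obtain x where x: "x \<in> D"
    and le2: "(\<Sum>k<p. \<integral>\<omega>. ((\<Sum>i<N. mc_dev p e g k (xs i) \<omega>) + mc_dev p e g k x \<omega>)\<^sup>2 \<partial>M)
      \<le> (\<Sum>k<p. \<integral>\<omega>. (\<Sum>i<N. mc_dev p e g k (xs i) \<omega>)\<^sup>2 \<partial>M) + real p * sqnorm g"
    by blast
  have "(\<Sum>k<p. \<integral>\<omega>. (\<Sum>i<Suc N. mc_dev p e g k ((xs(N := x)) i) \<omega>)\<^sup>2 \<partial>M) \<le> real (Suc N) * (real p * sqnorm g)"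
    using le le2 by (simp add: distrib_right)
  moreover have "\<forall>i<Suc N. (xs(N := x)) i \<in> D" using xs x by (auto simp: less_Suc_eq)
  ultimately show ?case by blast
qed

text \<open>The average of \<open>N\<close> deviations has total second moment at most
  \<open>p / N\<close> times the squared norm of the residual \<open>g\<close>, which is the
  projection error plus the current coefficient error. The choice \<open>N = 2 * p\<close> yields
  one half.\<close>

lemma mc_refine:
  assumes o: "orthonormal P p e" and p: "0 < p"
    and A: "finite A" "A \<subseteq> D" and a: "\<And>k. k < p \<Longrightarrow> a k \<in> hspan A"
  obtains A' a' where "finite A'" "A' \<subseteq> D" "card A' \<le> card A + 2 * p" "\<And>k. k < p \<Longrightarrow> a' k \<in> hspan A'"
    "(\<Sum>k<p. \<integral>\<omega>. (coef e k \<omega> - a' k \<omega>)\<^sup>2 \<partial>M) \<le> (proj_err p e + (\<Sum>k<p. \<integral>\<omega>. (coef e k \<omega> - a k \<omega>)\<^sup>2 \<partial>M)) / 2"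
proof -
  define N where "N = 2 * p"
  have as: "sq_integrable M (a k)" if "k < p" for k by (rule hspan_sq[OF A(2) a[OF that]])
  define g where "g \<omega> y = h \<omega> y - (\<Sum>k<p. a k \<omega> * e k y)" for \<omega> y
  have g: "nice_kernel g" unfolding g_def[abs_def] by (rule nice_kernel_sub_comb[OF o as])
  define E where "E = sqnorm g"
  have E: "E = proj_err p e + (\<Sum>k<p. \<integral>\<omega>. (coef e k \<omega> - a k \<omega>)\<^sup>2 \<partial>M)"
    unfolding E_def g_def[abs_def] by (rule sqnorm_sub_comb[OF o as])
  have gb: "(\<integral>y. g \<omega> y * e k y \<partial>P) = coef e k \<omega> - a k \<omega>" if k: "k < p" for k \<omega>
  proof -
    have i: "integrable P (\<lambda>y. h \<omega> y * e k y)" "\<And>j. j < p \<Longrightarrow> integrable P (\<lambda>y. e j y * e k y)"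
      using h_fun orthonormal_sq[OF o] k by (auto intro!: sq_integrable_mult)
    have "(\<integral>y. g \<omega> y * e k y \<partial>P) = (\<integral>y. h \<omega> y * e k y - (\<Sum>j<p. a j \<omega> * (e j y * e k y)) \<partial>P)"
      by (simp add: g_def left_diff_distrib sum_distrib_right mult.assoc)
    also have "\<dots> = coef e k \<omega> - (\<integral>y. (\<Sum>j<p. a j \<omega> * (e j y * e k y)) \<partial>P)"
      using i by (intro Bochner_Integration.integral_diff Bochner_Integration.integrable_sum) auto
    also have "(\<integral>y. (\<Sum>j<p. a j \<omega> * (e j y * e k y)) \<partial>P) = (\<Sum>j<p. \<integral>y. a j \<omega> * (e j y * e k y) \<partial>P)"
      using i by (intro Bochner_Integration.integral_sum) auto
    also have "\<dots> = (\<Sum>j<p. if j = k then a j \<omega> else 0)"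
      using k by (intro sum.cong) (auto simp: orthonormal_ip[OF o])
    finally show ?thesis using k by simp
  qed
  obtain xs where xs: "\<And>i. i < N \<Longrightarrow> xs i \<in> D"
    and le: "(\<Sum>k<p. \<integral>\<omega>. (\<Sum>i<N. mc_dev p e g k (xs i) \<omega>)\<^sup>2 \<partial>M) \<le> real N * (real p * E)"
    using mc_points[OF o p g, of N] unfolding E_def by blast
  define B where "B = A \<union> xs ` {..<N}"
  define t where "t k x = e k x / mc_weight p e x" for k x
  define a' where "a' k \<omega> = a k \<omega> + (1 / real N) * (\<Sum>i<N. t k (xs i) * g \<omega> (xs i))" for k \<omega>
  have N0: "real N > 0" using p by (simp add: N_def)
  have diff: "coef e k \<omega> - a' k \<omega> = - (1 / real N) * (\<Sum>i<N. mc_dev p e g k (xs i) \<omega>)" if "k < p" for k \<omega>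
  proof -
    have "mc_dev p e g k x \<omega> = t k x * g \<omega> x - (coef e k \<omega> - a k \<omega>)" for x
      unfolding mc_dev_def gb[OF that] t_def by simp
    then have "(\<Sum>i<N. mc_dev p e g k (xs i) \<omega>) = (\<Sum>i<N. t k (xs i) * g \<omega> (xs i)) - real N * (coef e k \<omega> - a k \<omega>)"
      by (simp add: sum_subtractf)
    then have "(1 / real N) * (\<Sum>i<N. mc_dev p e g k (xs i) \<omega>)
      = (1 / real N) * (\<Sum>i<N. t k (xs i) * g \<omega> (xs i)) - (coef e k \<omega> - a k \<omega>)"
      using N0 by (simp add: diff_divide_distrib)
    then show ?thesis by (simp add: a'_def)
  qed
  show ?thesis
  proof (rule that)
    show fB: "finite B" "B \<subseteq> D" using A xs by (auto simp: B_def)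
    show "card B \<le> card A + 2 * p"
      using card_Un_le[of A "xs ` {..<N}"] card_image_le[of "{..<N}" xs] by (simp add: B_def N_def)
    have aB: "a k \<in> hspan B" if "k < p" for k using hspan_mono[OF fB(1) _ a[OF that]] by (auto simp: B_def)
    have gB: "(\<lambda>\<omega>. g \<omega> (xs i)) \<in> hspan B" if "i < N" for i
    proof -
      have 1: "(\<lambda>\<omega>. h \<omega> (xs i)) \<in> hspan B" using that by (intro hspan_point fB) (auto simp: B_def)
      have 2: "(\<lambda>\<omega>. \<Sum>k<p. e k (xs i) * a k \<omega>) \<in> hspan B" by (intro hspan_sum aB) auto
      \<comment> \<open>A residual value costs a single sample of \<open>h\<close>: the subtracted
        part is a combination of the \<open>a k\<close>, which are already known from the points of
        \<open>A\<close>.\<close>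
      have "(\<lambda>\<omega>. g \<omega> (xs i)) = (\<lambda>\<omega>. h \<omega> (xs i) + (- 1) * (\<Sum>k<p. e k (xs i) * a k \<omega>))"
        by (simp add: g_def mult.commute)
      then show ?thesis using hspan_add[OF 1 hspan_cmult[OF 2, of "-1"]] by simp
    qed
    show "a' k \<in> hspan B" if "k < p" for k
      unfolding a'_def[abs_def] by (intro hspan_add aB that hspan_cmult hspan_sum gB) auto
    have "(\<Sum>k<p. \<integral>\<omega>. (coef e k \<omega> - a' k \<omega>)\<^sup>2 \<partial>M) = (\<Sum>k<p. \<integral>\<omega>. (1 / real N)\<^sup>2 * (\<Sum>i<N. mc_dev p e g k (xs i) \<omega>)\<^sup>2 \<partial>M)"
      by (intro sum.cong refl) (simp add: diff power_mult_distrib power_divide)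
    also have "\<dots> = (1 / real N)\<^sup>2 * (\<Sum>k<p. \<integral>\<omega>. (\<Sum>i<N. mc_dev p e g k (xs i) \<omega>)\<^sup>2 \<partial>M)"
      by (simp add: sum_distrib_left)
    also have "\<dots> \<le> (1 / real N)\<^sup>2 * (real N * (real p * E))" by (intro mult_left_mono le) auto
    also have "\<dots> = E / 2" using p by (simp add: N_def power2_eq_square field_simps)
    finally show "(\<Sum>k<p. \<integral>\<omega>. (coef e k \<omega> - a' k \<omega>)\<^sup>2 \<partial>M) \<le> (proj_err p e + (\<Sum>k<p. \<integral>\<omega>. (coef e k \<omega> - a k \<omega>)\<^sup>2 \<partial>M)) / 2"
      by (simp add: E)
  qed
qed

text \<open>The map \<open>\<Delta> \<mapsto> (\<epsilon>\<^sup>2 + \<Delta>) / 2\<close> fixes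
  \<open>\<epsilon>\<^sup>2\<close>, so each round halves only the excess over it; hence the summand
  1. The interpolation takes \<open>p\<close> points and every round adds
  \<open>2 * p\<close>.\<close>

lemma mc_iterate:
  assumes o: "orthonormal P p e" and p: "0 < p"
  shows "\<exists>A a. finite A \<and> A \<subseteq> D \<and> card A \<le> p + 2 * p * J \<and> (\<forall>k<p. a k \<in> hspan A) \<and>
    (\<Sum>k<p. \<integral>\<omega>. (coef e k \<omega> - a k \<omega>)\<^sup>2 \<partial>M) \<le> (4 * real p ^ 2 * (real p + 2) / 2 ^ J + 1) * proj_err p e"
proof (induction J)
  case 0
  obtain A a where *: "finite A" "A \<subseteq> D" "card A \<le> p" "\<And>k. k < p \<Longrightarrow> a k \<in> hspan A"
    "(\<Sum>k<p. \<integral>\<omega>. (coef e k \<omega> - a k \<omega>)\<^sup>2 \<partial>M) \<le> 4 * real p ^ 2 * (real p + 2) * proj_err p e"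
    using interpolation_start[OF o] by blast
  have "(4 * real p ^ 2 * (real p + 2) / 2 ^ 0 + 1) * proj_err p e
    = 4 * real p ^ 2 * (real p + 2) * proj_err p e + proj_err p e" by (simp add: distrib_right)
  then show ?case using * sqnorm_nonneg[of "\<lambda>\<omega> y. h \<omega> y - (\<Sum>k<p. coef e k \<omega> * e k y)"]
    by (intro exI[of _ A] exI[of _ a]) auto
next
  case (Suc J)
  then obtain A a where A: "finite A" "A \<subseteq> D" and c: "card A \<le> p + 2 * p * J" and a: "\<And>k. k < p \<Longrightarrow> a k \<in> hspan A"
    and le: "(\<Sum>k<p. \<integral>\<omega>. (coef e k \<omega> - a k \<omega>)\<^sup>2 \<partial>M) \<le> (4 * real p ^ 2 * (real p + 2) / 2 ^ J + 1) * proj_err p e"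
    by blast
  obtain A' a' where A': "finite A'" "A' \<subseteq> D" "card A' \<le> card A + 2 * p" "\<And>k. k < p \<Longrightarrow> a' k \<in> hspan A'"
    "(\<Sum>k<p. \<integral>\<omega>. (coef e k \<omega> - a' k \<omega>)\<^sup>2 \<partial>M) \<le> (proj_err p e + (\<Sum>k<p. \<integral>\<omega>. (coef e k \<omega> - a k \<omega>)\<^sup>2 \<partial>M)) / 2"
    using mc_refine[of p e A a, OF o p A a] by blast
  have half: "(E + (c / t + 1) * E) / 2 = (c / (2 * t) + 1) * E" for E c t :: real
    by (simp add: algebra_simps)
  note A'(5)
  also have "(proj_err p e + (\<Sum>k<p. \<integral>\<omega>. (coef e k \<omega> - a k \<omega>)\<^sup>2 \<partial>M)) / 2
    \<le> (proj_err p e + (4 * real p ^ 2 * (real p + 2) / 2 ^ J + 1) * proj_err p e) / 2"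
    by (intro divide_right_mono add_left_mono le) auto
  also have "\<dots> = (4 * real p ^ 2 * (real p + 2) / 2 ^ Suc J + 1) * proj_err p e"
    unfolding half power_Suc ..
  finally show ?case using A'(1-4) c
    by (intro exI[of _ A'] exI[of _ a'] conjI allI impI) auto
qed

text \<open>Because of \<open>4 p^2 (p + 2) \<le> 12 p^3\<close> the coefficient error is at most 13
  times the projection error, and the projection error itself makes it 14. The 16 is the square of
  the factor 4 in the theorem.\<close>

lemma sampling_recovery:
  assumes o: "orthonormal P p e" and J: "p ^ 3 \<le> 2 ^ J"
  obtains A a where "finite A" "A \<subseteq> D" "card A \<le> p + 2 * p * J" "\<And>k. k < p \<Longrightarrow> a k \<in> hspan A"
    "sqnorm (\<lambda>\<omega> y. h \<omega> y - (\<Sum>k<p. a k \<omega> * e k y)) \<le> 16 * proj_err p e"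
proof (cases "p = 0")
  case True
  show ?thesis
    by (rule that[of "{}"]) (use True sqnorm_nonneg[of h] in auto)
next
  case False
  obtain A a where A: "finite A" "A \<subseteq> D" "card A \<le> p + 2 * p * J" "\<And>k. k < p \<Longrightarrow> a k \<in> hspan A"
    and le: "(\<Sum>k<p. \<integral>\<omega>. (coef e k \<omega> - a k \<omega>)\<^sup>2 \<partial>M) \<le> (4 * real p ^ 2 * (real p + 2) / 2 ^ J + 1) * proj_err p e"
    using mc_iterate[OF o, of J] False by auto
  have "4 * real p ^ 2 * (real p + 2) \<le> 4 * real p ^ 2 * (3 * real p)"
    using False by (intro mult_left_mono) auto
  also have "\<dots> = 12 * real (p ^ 3)" by (simp add: power2_eq_square power3_eq_cube)
  also have "\<dots> \<le> 12 * 2 ^ J" using J of_nat_mono[of "p ^ 3" "2 ^ J", where 'a=real] by simp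
  finally have "4 * real p ^ 2 * (real p + 2) / 2 ^ J \<le> 12" by (simp add: divide_le_eq)
  then have "(4 * real p ^ 2 * (real p + 2) / 2 ^ J + 1) * proj_err p e \<le> 13 * proj_err p e"
    by (intro mult_right_mono sqnorm_nonneg) auto
  with le have "(\<Sum>k<p. \<integral>\<omega>. (coef e k \<omega> - a k \<omega>)\<^sup>2 \<partial>M) \<le> 13 * proj_err p e" by simp
  then have "sqnorm (\<lambda>\<omega> y. h \<omega> y - (\<Sum>k<p. a k \<omega> * e k y)) \<le> 16 * proj_err p e"
    using sqnorm_sub_comb[of p e a, OF o hspan_sq[OF A(2) A(4)]] sqnorm_nonneg[of "\<lambda>\<omega> y. h \<omega> y - (\<Sum>k<p. coef e k \<omega> * e k y)"]
    by simp
  with A show ?thesis by (intro that) auto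
qed

end

section \<open>The average case setting\<close>

text \<open>A Paley--Zygmund argument that takes the place of Fernique's theorem.\<close>

lemma (in prob_space) fourth_moment_expectation_bound:
  fixes X :: "'a \<Rightarrow> real"
  assumes X: "integrable M X" and X2: "integrable M (\<lambda>w. (X w)\<^sup>2)" and nn: "\<And>w. 0 \<le> X w"
    and le: "expectation (\<lambda>w. (X w)\<^sup>2) \<le> 3 * (expectation X)\<^sup>2"
    and pr: "prob {w \<in> space M. c < X w} \<le> 1 / 6" and c: "0 \<le> c"
  shows "expectation X \<le> 4 * c"
proof (cases "expectation X = 0")
  case False
  define s where "s = expectation X"
  have "0 \<le> s" using nn by (simp add: s_def)
  with False have s: "0 < s" by (simp add: s_def)
  let ?A = "{w \<in> space M. c < X w}"
  have [measurable]: "X \<in> borel_measurable M" using X by simp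
  have iA: "integrable M (indicator ?A :: 'a \<Rightarrow> real)"
    by (intro integrable_real_indicator) (auto simp: less_top[symmetric])
  \<comment> \<open>The inequality \<open>X \<le> X^2 / (6 s) + 3 s / 2\<close> is used where
    \<open>X\<close> exceeds \<open>c\<close>. The three terms have means at most \<open>c\<close>,
    \<open>s / 2\<close> and \<open>s / 4\<close>, which leaves
    \<open>s / 4 \<le> c\<close>.\<close>
  have "s \<le> expectation (\<lambda>w. c + (X w)\<^sup>2 / (6 * s) + 3 * s / 2 * indicator ?A w)"
    unfolding s_def
  proof (rule integral_mono[OF X])
    show "integrable M (\<lambda>w. c + (X w)\<^sup>2 / (6 * expectation X) + 3 * expectation X / 2 * indicator ?A w)"
      using X2 iA by (intro Bochner_Integration.integrable_add integrable_divide integrable_mult_right) auto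
  next
    fix w assume w: "w \<in> space M"
    have "0 \<le> (X w - 3 * s)\<^sup>2" by simp
    then have "6 * s * X w \<le> (X w)\<^sup>2 + 9 * s\<^sup>2" by (simp add: power2_diff power_mult_distrib mult_ac)
    then have "X w \<le> ((X w)\<^sup>2 + 9 * s\<^sup>2) / (6 * s)" using s by (simp add: le_divide_eq mult.commute)
    also have "\<dots> = (X w)\<^sup>2 / (6 * s) + 3 * s / 2" using s by (simp add: add_divide_distrib power2_eq_square)
    finally have "X w \<le> (X w)\<^sup>2 / (6 * s) + 3 * s / 2" .
    moreover have "0 \<le> (X w)\<^sup>2 / (6 * s)" using s by simp
    ultimately have "X w \<le> c + (X w)\<^sup>2 / (6 * s) + 3 * s / 2 * indicator ?A w"
      using c w by (cases "c < X w") (auto simp: indicator_def)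
    then show "X w \<le> c + (X w)\<^sup>2 / (6 * expectation X) + 3 * expectation X / 2 * indicator ?A w"
      by (simp add: s_def)
  qed
  also have "\<dots> = c + expectation (\<lambda>w. (X w)\<^sup>2) / (6 * s) + 3 * s / 2 * prob ?A"
  proof -
    have "expectation (\<lambda>w. c + (X w)\<^sup>2 / (6 * s) + 3 * s / 2 * indicator ?A w)
      = expectation (\<lambda>w. c + (X w)\<^sup>2 / (6 * s)) + expectation (\<lambda>w. 3 * s / 2 * indicator ?A w)"
      using X2 iA by (intro Bochner_Integration.integral_add Bochner_Integration.integrable_add integrable_divide integrable_mult_right) auto
    also have "expectation (\<lambda>w. c + (X w)\<^sup>2 / (6 * s)) = c + expectation (\<lambda>w. (X w)\<^sup>2) / (6 * s)"
      using X2 by (subst Bochner_Integration.integral_add) (auto simp: prob_space)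
    finally show ?thesis by simp
  qed
  also have "\<dots> \<le> c + 3 * s\<^sup>2 / (6 * s) + 3 * s / 2 * (1 / 6)"
    using s le pr by (intro add_mono divide_right_mono mult_left_mono) (auto simp: s_def)
  also have "\<dots> = c + 3 / 4 * s" using s by (simp add: power2_eq_square)
  finally show ?thesis by (simp add: s_def)
qed (use c in simp)

section \<open>Arithmetic of the sample budget and of geometric tails\<close>

lemma sample_budget:
  assumes n: "n \<ge> 1" and p: "p \<le> m_of n"
  shows "\<exists>J. p ^ 3 \<le> 2 ^ J \<and> p + 2 * p * J \<le> n"
proof (cases "p = 0")
  case False
  then have p1: "1 \<le> p" by simp
  define l where "l = ln (4 * real n)"
  have "exp 1 \<le> 4 * real n" using n exp_le by linarith
  then have l1: "1 \<le> l" unfolding l_def using n by (subst ln_ge_iff) auto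
  have c: "48 \<le> 48 * sqrt (2::real)" by simp
  have "real p \<le> real n / (48 * sqrt 2 * l)"
  proof -
    have "0 \<le> real n / (48 * sqrt 2 * l)" using l1 by simp
    then have "real (m_of n) \<le> real n / (48 * sqrt 2 * l)"
      unfolding m_of_def l_def[symmetric] by linarith
    then show ?thesis using p by linarith
  qed
  then have "real p * (48 * sqrt 2 * l) \<le> real n" using l1 by (simp add: le_divide_eq)
  moreover have "real p * (48 * l) \<le> real p * (48 * sqrt 2 * l)"
    using c l1 by (intro mult_left_mono mult_right_mono) auto
  ultimately have pn: "real p * (48 * l) \<le> real n" by linarith
  \<comment> \<open>The binary logarithm of \<open>p\<close>, rounded up; the number of rounds is
    \<open>J = 3 * k\<close>. From \<open>2 ^ k \<le> 2 * p \<le> 4 * n\<close> follows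
    \<open>k \<le> 2 * ln (4 * n)\<close>, so \<open>1 + 6 * k\<close> stays below
    \<open>48 * ln (4 * n)\<close>.\<close>
  define k where "k = (LEAST k. p \<le> 2 ^ k)"
  have "p \<le> 2 ^ p" by (simp add: less_imp_le)
  then have pk: "p \<le> 2 ^ k" unfolding k_def by (rule LeastI)
  have k2: "2 ^ k \<le> 2 * p"
  proof (cases k)
    case (Suc j)
    then have "\<not> p \<le> 2 ^ j" using not_less_Least[of j "\<lambda>k. p \<le> 2 ^ k"] by (simp add: k_def)
    then show ?thesis using Suc by simp
  qed (use p1 in simp)
  have "real p * 1 \<le> real p * (48 * l)" using l1 by (intro mult_left_mono) auto
  then have "real p \<le> real n" using pn by linarith
  have "real (2 ^ k) \<le> real (2 * p)" using k2 by (rule of_nat_mono)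
  then have "2 ^ k \<le> 4 * real n" using \<open>real p \<le> real n\<close> by simp
  then have "ln (2 ^ k) \<le> l" unfolding l_def using n by (subst ln_le_cancel_iff) auto
  then have "real k * ln 2 \<le> l" by (simp add: ln_realpow)
  moreover have "real k * (2 / 3) \<le> real k * ln 2" using ln2_ge_two_thirds by (intro mult_left_mono) auto
  ultimately have "real k \<le> 2 * l" using l1 by linarith
  then have "1 + 6 * real k \<le> 48 * l" using l1 by linarith
  then have "real p * (1 + 6 * real k) \<le> real p * (48 * l)" by (intro mult_left_mono) auto
  then have "real (p + 2 * p * (3 * k)) \<le> real n" using pn by (simp add: algebra_simps)
  then have "p + 2 * p * (3 * k) \<le> n" by (simp only: of_nat_le_iff)
  moreover have "p ^ 3 \<le> 2 ^ (3 * k)"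
    using power_mono[OF pk, of 3] by (simp add: power_mult[symmetric] mult.commute)
  ultimately show ?thesis by blast
qed simp

lemma suminf_tail_le:
  fixes lam :: "nat \<Rightarrow> real"
  assumes nn: "\<And>k. 0 \<le> lam k" and le: "\<And>k. lam k \<le> K * r ^ Suc k" and r: "0 < r" "r < 1"
  shows "summable lam" and "suminf lam - (\<Sum>k<m. lam k) \<le> K * r ^ Suc m / (1 - r)"
proof -
  have g: "summable (\<lambda>k. K * r ^ Suc k)" using r by (intro summable_mult) (simp add: summable_geometric)
  show s: "summable lam"
    by (rule summable_comparison_test'[OF g, of 0]) (use nn le in simp)
  have "suminf lam - (\<Sum>k<m. lam k) = (\<Sum>k. lam (k + m))" using suminf_split_initial_segment[OF s, of m] by simp
  also have "\<dots> \<le> (\<Sum>k. K * r ^ Suc m * r ^ k)"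
  proof (rule suminf_le)
    show "lam (k + m) \<le> K * r ^ Suc m * r ^ k" for k using le[of "k + m"] by (simp add: power_add mult_ac)
    show "summable (\<lambda>k. lam (k + m))" using s by (simp add: summable_iff_shift)
    show "summable (\<lambda>k. K * r ^ Suc m * r ^ k)" using r by (intro summable_mult) (simp add: summable_geometric)
  qed
  also have "\<dots> = K * r ^ Suc m / (1 - r)"
    using r by (subst suminf_mult) (simp_all add: suminf_geometric summable_geometric)
  finally show "suminf lam - (\<Sum>k<m. lam k) \<le> K * r ^ Suc m / (1 - r)" .
qed

text \<open>The eigenvalue tail starts with the power \<open>m + 1\<close>, which is at least the
  quotient that \<open>m_of\<close> rounds down; hence the rounding costs no constant.\<close>

lemma power_Suc_m_of_le:
  assumes q: "0 < q" "q < 1"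
  shows "q ^ Suc (m_of n) \<le> (q powr (1 / (48 * sqrt 2))) powr (real n / ln (4 * real n))"
proof -
  have "real n / (48 * sqrt 2 * ln (4 * real n)) \<le> real (Suc (m_of n))"
    unfolding m_of_def by linarith
  then have "q powr real (Suc (m_of n)) \<le> q powr (real n / (48 * sqrt 2 * ln (4 * real n)))"
    using q by (intro powr_mono') auto
  also have "\<dots> = (q powr (1 / (48 * sqrt 2))) powr (real n / ln (4 * real n))"
    by (simp add: powr_powr)
  finally show ?thesis using q by (simp add: powr_realpow del: power_Suc of_nat_Suc)
qed

section \<open>Transfer of the setting to probability measures\<close>

locale avg_case =
  fixes D :: "(real^'d) set" and \<rho> :: "real^'d \<Rightarrow> real"
    and evl :: "'f::{banach,second_countable_topology} \<Rightarrow> real^'d \<Rightarrow> real"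
    and \<mu> :: "'f measure"
  assumes setting: "avg_setting D \<rho> evl" and gauss: "centered_gaussian \<mu>"
begin

definition P :: "(real^'d) measure" where
  "P = density lborel (\<lambda>x. ennreal (indicator D x * \<rho> x))"

text \<open>The values \<open>evl f x\<close> outside \<open>D\<close> are unconstrained; the cutoff
  makes every point evaluation bounded linear and every function Borel measurable on the whole
  space.\<close>

definition hf :: "'f \<Rightarrow> real^'d \<Rightarrow> real" where
  "hf f x = indicator D x * evl f x"

lemma D_meas[measurable]: "D \<in> sets borel" and rho_meas[measurable]: "\<rho> \<in> borel_measurable borel"
  and rho_nonneg: "x \<in> D \<Longrightarrow> 0 \<le> \<rho> x"
  and evl_linear: "x \<in> D \<Longrightarrow> bounded_linear (\<lambda>f. evl f x)"
  and evl_member: "L2_member D \<rho> (evl f)"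
  and D_pos: "emeasure lborel D > 0"
  and rho_int: "(\<integral>\<^sup>+x\<in>D. ennreal (\<rho> x) \<partial>lborel) = 1"
  using setting by (auto simp: avg_setting_def)

lemma wt_nonneg: "0 \<le> indicator D x * \<rho> x"
  using rho_nonneg by (auto simp: indicator_def)

lemma sets_P[simp, measurable_cong]: "sets P = sets borel"
  by (simp add: P_def)

lemma space_P[simp]: "space P = UNIV"
  by (simp add: P_def)

lemma borel_measurable_P: "borel_measurable P = borel_measurable borel"
  by (intro measurable_cong_sets) auto

lemma prob_space_P: "prob_space P"
proof (rule prob_spaceI)
  have "emeasure P (space P) = (\<integral>\<^sup>+x. ennreal (indicator D x * \<rho> x) \<partial>lborel)"
    unfolding P_def by (subst emeasure_density) auto
  also have "\<dots> = (\<integral>\<^sup>+x\<in>D. ennreal (\<rho> x) \<partial>lborel)"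
    by (intro nn_integral_cong) (auto simp: indicator_def)
  finally show "emeasure P (space P) = 1" using rho_int by simp
qed

lemma AE_P_D: "AE x in P. x \<in> D"
  unfolding P_def by (subst AE_density) (auto simp: indicator_def)

lemma nn_integral_P:
  assumes "g \<in> borel_measurable borel"
  shows "(\<integral>\<^sup>+x. g x \<partial>P) = (\<integral>\<^sup>+x. ennreal (indicator D x * \<rho> x) * g x \<partial>lborel)"
  unfolding P_def using assms by (subst nn_integral_density) auto

lemma integral_P:
  fixes g :: "real^'d \<Rightarrow> real"
  assumes "g \<in> borel_measurable borel"
  shows "(\<integral>x. g x \<partial>P) = (\<integral>x. indicator D x * \<rho> x * g x \<partial>lborel)"
    and "integrable P g \<longleftrightarrow> integrable lborel (\<lambda>x. indicator D x * \<rho> x * g x)"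
  unfolding P_def using assms wt_nonneg
  by (auto simp: integral_density integrable_density)

lemma L2_member_iff:
  "L2_member D \<rho> g \<longleftrightarrow> sq_integrable P (\<lambda>x. indicator D x * g x)"
proof -
  have e: "indicator D x * \<rho> x * (indicator D x * g x)\<^sup>2 = indicator D x * \<rho> x * (g x)\<^sup>2" for x
    by (simp add: indicator_def)
  have "integrable P (\<lambda>x. (indicator D x * g x)\<^sup>2) \<longleftrightarrow> integrable lborel (\<lambda>x. indicator D x * \<rho> x * (g x)\<^sup>2)"
    if [measurable]: "(\<lambda>x. indicator D x * g x) \<in> borel_measurable borel"
    by (subst integral_P(2)) (auto simp: e)
  then show ?thesis by (auto simp: L2_member_def sq_integrable_def borel_measurable_P)
qed

lemma L2_inner_eq:
  assumes "L2_member D \<rho> g" "L2_member D \<rho> h"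
  shows "L2_inner D \<rho> g h = (\<integral>x. (indicator D x * g x) * (indicator D x * h x) \<partial>P)"
proof -
  have m: "(\<lambda>x. (indicator D x * g x) * (indicator D x * h x)) \<in> borel_measurable borel"
    using assms by (intro borel_measurable_times[of "\<lambda>x. indicator D x * g x"]) (simp_all add: L2_member_def)
  show ?thesis unfolding L2_inner_def
    by (subst integral_P(1)[OF m], intro Bochner_Integration.integral_cong refl) (simp add: indicator_def)
qed

lemma L2_sqnorm_eq:
  assumes [measurable]: "(\<lambda>x. indicator D x * g x) \<in> borel_measurable borel"
  shows "L2_sqnorm D \<rho> g = (\<integral>\<^sup>+x. ennreal ((indicator D x * g x)\<^sup>2) \<partial>P)"
  unfolding L2_sqnorm_def
  by (subst nn_integral_P; (simp; fail)?; intro nn_integral_cong) (auto simp: indicator_def ennreal_mult' rho_nonneg)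

lemma hf_sq: "sq_integrable P (hf f)"
  using evl_member[of f] by (simp add: L2_member_iff hf_def[abs_def])

lemma hf_measurable: "hf f \<in> borel_measurable borel"
  using hf_sq[of f] by (simp add: sq_integrable_def borel_measurable_P)

lemma hf_linear: "bounded_linear (\<lambda>f. hf f x)"
proof (cases "x \<in> D")
  case True then show ?thesis using evl_linear[OF True] by (simp add: hf_def)
qed (simp add: hf_def)

lemma sets_mu[measurable_cong]: "sets \<mu> = sets borel"
  using gauss by (simp add: centered_gaussian_def)

lemma space_mu[simp]: "space \<mu> = UNIV"
  using sets_eq_imp_space_eq[OF sets_mu] by simp

lemma prob_space_mu: "prob_space \<mu>"
  using gauss by (simp add: centered_gaussian_def)

lemma hf_point_sq: "sq_integrable \<mu> (\<lambda>f. hf f x)"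
  by (rule centered_gaussian_distr(1)[OF gauss hf_linear])

lemma hf_joint_measurable[measurable]: "(\<lambda>z. hf (fst z) (snd z)) \<in> borel_measurable (\<mu> \<Otimes>\<^sub>M P)"
proof -
  have "(\<lambda>z. hf (fst z) (snd z)) \<in> borel_measurable (borel \<Otimes>\<^sub>M P)"
    by (rule caratheodory_measurable) (auto intro: linear_continuous_on hf_linear simp: hf_measurable borel_measurable_P)
  moreover have "sets (\<mu> \<Otimes>\<^sub>M P) = sets (borel \<Otimes>\<^sub>M P)"
    by (intro sets_pair_measure_cong sets_mu refl)
  ultimately show ?thesis using measurable_cong_sets by blast
qed

sublocale mu: prob_space \<mu> by (rule prob_space_mu)
sublocale pr: prob_space P by (rule prob_space_P)
sublocale mp: pair_sigma_finite \<mu> P ..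

section \<open>Square integrability of the Gaussian random function\<close>

definition pvar :: "real^'d \<Rightarrow> real" where
  "pvar x = (\<integral>f. (hf f x)\<^sup>2 \<partial>\<mu>)"

lemma pvar_nonneg: "0 \<le> pvar x"
  by (simp add: pvar_def)

lemma nn_pvar: "(\<integral>\<^sup>+f. ennreal ((hf f x)\<^sup>2) \<partial>\<mu>) = ennreal (pvar x)"
  unfolding pvar_def by (intro nn_integral_eq_integral sq_integrable_sq hf_point_sq) auto

lemma nn_fourth: "(\<integral>\<^sup>+f. ennreal ((hf f x) ^ 4) \<partial>\<mu>) = ennreal (3 * (pvar x)\<^sup>2)"
  unfolding pvar_def centered_gaussian_distr(3)[OF gauss hf_linear, symmetric]
  by (intro nn_integral_eq_integral centered_gaussian_distr(2)[OF gauss hf_linear]) auto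

lemma pvar_measurable[measurable]: "pvar \<in> borel_measurable borel"
proof -
  have "(\<lambda>z. (hf (snd z) (fst z))\<^sup>2) \<in> borel_measurable (P \<Otimes>\<^sub>M \<mu>)"
    using measurable_compose[OF measurable_pair_swap' hf_joint_measurable] by (simp add: case_prod_unfold)
  then have "(\<lambda>(x, f). (hf f x)\<^sup>2) \<in> borel_measurable (P \<Otimes>\<^sub>M \<mu>)" by (simp add: case_prod_unfold)
  from mu.borel_measurable_lebesgue_integral[OF this]
  show ?thesis by (simp add: pvar_def[abs_def] borel_measurable_P)
qed

lemma nn_hf_finite: "(\<integral>\<^sup>+x. ennreal ((hf f x)\<^sup>2) \<partial>P) < \<infinity>"
  using sq_integrable_sq[OF hf_sq[of f]] by (auto simp: integrable_iff_bounded)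

lemma hf_swap_measurable[measurable]: "(\<lambda>z. hf (snd z) (fst z)) \<in> borel_measurable (P \<Otimes>\<^sub>M \<mu>)"
  using measurable_compose[OF measurable_pair_swap' hf_joint_measurable] by (simp add: case_prod_unfold)

text \<open>The truncation \<open>0 < pvar \<le> k\<close> makes the moments finite; the bound is uniform in \<open>k\<close>.\<close>

lemma truncated_trace_bound:
  assumes c: "mu.prob {f \<in> space \<mu>. ennreal c < (\<integral>\<^sup>+x. ennreal ((hf f x)\<^sup>2) \<partial>P)} \<le> 1 / 6" and c0: "0 \<le> c"
  shows "(\<integral>\<^sup>+x. ennreal (pvar x) * indicator {x. 0 < pvar x \<and> pvar x \<le> k} x \<partial>P) \<le> ennreal (4 * c)"
proof -
  let ?I = "\<lambda>x. indicator {x. 0 < pvar x \<and> pvar x \<le> k} x :: ennreal"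
  define S where "S f = (\<integral>\<^sup>+x. ennreal ((hf f x)\<^sup>2) * ?I x \<partial>P)" for f
  define s where "s = (\<integral>\<^sup>+x. ennreal (pvar x) * ?I x \<partial>P)"
  have Sm[measurable]: "S \<in> borel_measurable \<mu>" unfolding S_def[abs_def] by measurable
  have "s \<le> (\<integral>\<^sup>+x. ennreal \<bar>k\<bar> \<partial>P)"
    unfolding s_def by (intro nn_integral_mono) (auto simp: indicator_def intro!: ennreal_leI)
  also have "\<dots> = ennreal \<bar>k\<bar>" using pr.emeasure_space_1 by simp
  finally have s_fin: "s < \<infinity>" by (auto intro: le_less_trans)
  have Ss: "(\<integral>\<^sup>+f. S f \<partial>\<mu>) = s"
  proof -
    have "(\<integral>\<^sup>+f. S f \<partial>\<mu>) = (\<integral>\<^sup>+x. \<integral>\<^sup>+f. ennreal ((hf f x)\<^sup>2) * ?I x \<partial>\<mu> \<partial>P)"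
      unfolding S_def by (rule mp.Fubini'[symmetric]) measurable
    also have "\<dots> = s" unfolding s_def
      by (intro nn_integral_cong) (subst nn_integral_multc, auto simp: nn_pvar intro!: sq_integrable_measurable hf_point_sq measurable_compose[OF _ measurable_ennreal] borel_measurable_power)
    finally show ?thesis .
  qed
  \<comment> \<open>The constant 3 of a single Gaussian value survives integration over
    \<open>x\<close>: splitting the integrand by \<open>sqrt (pvar x)\<close> before Cauchy-Schwarz
    leaves \<open>s\<close> and an integral of fourth powers over \<open>pvar\<close>, whose mean is
    \<open>3 * s\<close>. The truncation excludes the points with \<open>pvar x = 0\<close>.\<close>
  have S2: "(\<integral>\<^sup>+f. (S f)\<^sup>2 \<partial>\<mu>) \<le> 3 * s\<^sup>2"
  proof -
    define Q where "Q f = (\<integral>\<^sup>+x. ennreal ((hf f x) ^ 4 / pvar x) * ?I x \<partial>P)" for f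
    have Qm[measurable]: "Q \<in> borel_measurable \<mu>" unfolding Q_def[abs_def] by measurable
    have CS: "(S f)\<^sup>2 \<le> Q f * s" for f
    proof -
      have hm[measurable]: "hf f \<in> borel_measurable P" by (simp add: borel_measurable_P hf_measurable)
      let ?a = "\<lambda>x. ennreal ((hf f x)\<^sup>2 / sqrt (pvar x)) * ?I x"
      let ?b = "\<lambda>x. ennreal (sqrt (pvar x)) * ?I x"
      have "S f = (\<integral>\<^sup>+x. ?a x * ?b x \<partial>P)"
        unfolding S_def by (intro nn_integral_cong) (auto simp: indicator_def simp flip: ennreal_mult)
      then have "(S f)\<^sup>2 \<le> (\<integral>\<^sup>+x. (?a x)\<^sup>2 \<partial>P) * (\<integral>\<^sup>+x. (?b x)\<^sup>2 \<partial>P)"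
        using Cauchy_Schwarz_nn_integral[of ?a P ?b] by simp
      also have "(\<integral>\<^sup>+x. (?a x)\<^sup>2 \<partial>P) = Q f"
        unfolding Q_def by (intro nn_integral_cong)
          (auto simp: indicator_def ennreal_power power_divide simp flip: power_mult)
      also have "(\<integral>\<^sup>+x. (?b x)\<^sup>2 \<partial>P) = s"
        unfolding s_def by (intro nn_integral_cong) (auto simp: indicator_def ennreal_power)
      finally show ?thesis .
    qed
    have "(\<integral>\<^sup>+f. (S f)\<^sup>2 \<partial>\<mu>) \<le> (\<integral>\<^sup>+f. Q f * s \<partial>\<mu>)" by (intro nn_integral_mono CS)
    also have "\<dots> = (\<integral>\<^sup>+f. Q f \<partial>\<mu>) * s" by (rule nn_integral_multc) measurable
    also have "(\<integral>\<^sup>+f. Q f \<partial>\<mu>) = (\<integral>\<^sup>+x. \<integral>\<^sup>+f. ennreal ((hf f x) ^ 4 / pvar x) * ?I x \<partial>\<mu> \<partial>P)"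
      unfolding Q_def by (rule mp.Fubini'[symmetric]) measurable
    also have "\<dots> = (\<integral>\<^sup>+x. 3 * (ennreal (pvar x) * ?I x) \<partial>P)"
    proof (intro nn_integral_cong)
      fix x
      have [measurable]: "(\<lambda>f. hf f x) \<in> borel_measurable \<mu>" using hf_point_sq[of x] by (simp add: sq_integrable_def)
      show "(\<integral>\<^sup>+f. ennreal ((hf f x) ^ 4 / pvar x) * ?I x \<partial>\<mu>) = 3 * (ennreal (pvar x) * ?I x)"
      proof (cases "0 < pvar x \<and> pvar x \<le> k")
        case True
        have "(\<integral>\<^sup>+f. ennreal ((hf f x) ^ 4 / pvar x) \<partial>\<mu>) = (\<integral>\<^sup>+f. ennreal (1 / pvar x) * ennreal ((hf f x) ^ 4) \<partial>\<mu>)"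
          using True by (intro nn_integral_cong) (simp flip: ennreal_mult)
        also have "\<dots> = ennreal (1 / pvar x) * (\<integral>\<^sup>+f. ennreal ((hf f x) ^ 4) \<partial>\<mu>)"
          by (rule nn_integral_cmult) measurable
        also have "\<dots> = ennreal (1 / pvar x * (3 * (pvar x)\<^sup>2))"
          unfolding nn_fourth using True by (simp flip: ennreal_mult)
        also have "1 / pvar x * (3 * (pvar x)\<^sup>2) = 3 * pvar x" using True by (simp add: power2_eq_square)
        also have "ennreal (3 * pvar x) = 3 * ennreal (pvar x)"
          using True by (simp add: ennreal_mult)
        finally show ?thesis using True by simp
      qed simp
    qed
    also have "\<dots> = 3 * s" unfolding s_def by (rule nn_integral_cmult) measurable
    finally show ?thesis by (simp add: power2_eq_square mult.assoc)
  qed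
  have S_le: "S f \<le> (\<integral>\<^sup>+x. ennreal ((hf f x)\<^sup>2) \<partial>P)" for f
    unfolding S_def by (intro nn_integral_mono) (auto simp: indicator_def)
  then have S_fin: "S f < \<infinity>" for f using nn_hf_finite[of f] by (rule le_less_trans)
  define X where "X f = enn2real (S f)" for f
  have XS: "ennreal (X f) = S f" for f using S_fin[of f] by (simp add: X_def)
  have Xm[measurable]: "X \<in> borel_measurable \<mu>" unfolding X_def[abs_def] by measurable
  have X0: "0 \<le> X f" for f by (simp add: X_def)
  define t where "t = enn2real s"
  have ts: "ennreal t = s" and t0: "0 \<le> t" using s_fin by (simp_all add: t_def)
  have EX: "has_bochner_integral \<mu> X t"
    using Ss t0 by (intro has_bochner_integral_nn_integral) (auto simp: X0 XS ts)
  have nX2: "(\<integral>\<^sup>+f. ennreal ((X f)\<^sup>2) \<partial>\<mu>) \<le> ennreal (3 * t\<^sup>2)"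
    using S2 by (simp add: XS ts t0 X0 ennreal_mult flip: ennreal_power)
  have X2i: "integrable \<mu> (\<lambda>f. (X f)\<^sup>2)"
    using nX2 by (intro integrableI_bounded) (auto intro: le_less_trans)
  have EX2: "mu.expectation (\<lambda>f. (X f)\<^sup>2) \<le> 3 * t\<^sup>2"
    using nX2 nn_integral_eq_integral[OF X2i] by simp
  have "mu.prob {f \<in> space \<mu>. c < X f} \<le> mu.prob {f \<in> space \<mu>. ennreal c < (\<integral>\<^sup>+x. ennreal ((hf f x)\<^sup>2) \<partial>P)}"
  proof (rule mu.finite_measure_mono)
    show "{f \<in> space \<mu>. c < X f} \<subseteq> {f \<in> space \<mu>. ennreal c < (\<integral>\<^sup>+x. ennreal ((hf f x)\<^sup>2) \<partial>P)}"
    proof (safe, simp)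
      fix f assume "c < X f"
      then have "ennreal c < ennreal (X f)" using c0 by (simp add: ennreal_less_iff)
      then show "ennreal c < (\<integral>\<^sup>+x. ennreal ((hf f x)\<^sup>2) \<partial>P)" using S_le[of f] XS[of f] by simp
    qed
    show "{f \<in> space \<mu>. ennreal c < (\<integral>\<^sup>+x. ennreal ((hf f x)\<^sup>2) \<partial>P)} \<in> mu.events" by measurable
  qed
  then have "mu.expectation X \<le> 4 * c"
    using EX X2i EX2 c c0 X0
    by (intro mu.fourth_moment_expectation_bound) (auto simp: has_bochner_integral_iff)
  then have "t \<le> 4 * c" using EX by (simp add: has_bochner_integral_iff)
  then show ?thesis using ts by (simp add: s_def[symmetric] ennreal_leI flip: ts)
qed

text \<open>Every \<open>f\<close> has finite norm, so the probability that the squared norm exceeds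
  \<open>n\<close> tends to 0 and some \<open>n\<close> meets the threshold \<open>1 / 6\<close>.
  The resulting bound \<open>4 * n\<close> does not depend on the truncation level, which monotone
  convergence then removes.\<close>

lemma hf_sq_integrable_pair: "sq_integrable (\<mu> \<Otimes>\<^sub>M P) (\<lambda>z. hf (fst z) (snd z))"
proof -
  let ?S = "\<lambda>f. \<integral>\<^sup>+x. ennreal ((hf f x)\<^sup>2) \<partial>P"
  let ?A = "\<lambda>n. {f \<in> space \<mu>. ennreal (real n) < ?S f}"
  have Sm[measurable]: "?S \<in> borel_measurable \<mu>" by measurable
  have "(\<lambda>n. mu.prob (?A n)) \<longlonglongrightarrow> mu.prob (\<Inter>n. ?A n)"
  proof (rule mu.finite_Lim_measure_decseq)
    show "range ?A \<subseteq> mu.events" by auto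
    show "decseq ?A"
      by (intro decseq_SucI) (auto intro: le_less_trans[rotated] ennreal_leI)
  qed
  moreover have "(\<Inter>n. ?A n) = {}"
  proof -
    have "\<exists>n. \<not> ennreal (real n) < ?S f" for f
    proof -
      have "?S f = ennreal (enn2real (?S f))" using nn_hf_finite[of f] by simp
      moreover obtain n where "enn2real (?S f) \<le> real n" using real_arch_simple by blast
      ultimately have "?S f \<le> ennreal (real n)" by (metis ennreal_leI)
      then show ?thesis by (auto simp: not_less)
    qed
    then show ?thesis by auto
  qed
  ultimately have "(\<lambda>n. mu.prob (?A n)) \<longlonglongrightarrow> 0" by simp
  then have "\<forall>\<^sub>F n in sequentially. mu.prob (?A n) < 1 / 6" by (rule order_tendstoD) simp
  then obtain n where n: "mu.prob (?A n) \<le> 1 / 6" by (auto simp: eventually_sequentially intro: less_imp_le)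
  let ?I = "\<lambda>k x. indicator {x. 0 < pvar x \<and> pvar x \<le> real k} x :: ennreal"
  have "(\<integral>\<^sup>+x. ennreal (pvar x) \<partial>P) = (\<integral>\<^sup>+x. (SUP k. ennreal (pvar x) * ?I k x) \<partial>P)"
  proof (intro nn_integral_cong)
    fix x
    show "ennreal (pvar x) = (SUP k. ennreal (pvar x) * ?I k x)"
    proof (intro antisym SUP_least)
      obtain k where "pvar x \<le> real k" using real_arch_simple by blast
      then have "ennreal (pvar x) \<le> ennreal (pvar x) * ?I k x"
        using pvar_nonneg[of x] by (auto simp: indicator_def)
      then show "ennreal (pvar x) \<le> (SUP k. ennreal (pvar x) * ?I k x)" by (rule SUP_upper2[OF UNIV_I])
    qed (auto simp: indicator_def)
  qed
  also have "\<dots> = (SUP k. \<integral>\<^sup>+x. ennreal (pvar x) * ?I k x \<partial>P)"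
    by (rule nn_integral_monotone_convergence_SUP) (auto simp: incseq_def le_fun_def indicator_def)
  also have "\<dots> \<le> ennreal (4 * real n)"
    by (intro SUP_least truncated_trace_bound n) auto
  finally have fin: "(\<integral>\<^sup>+x. ennreal (pvar x) \<partial>P) < \<infinity>" by (auto intro: le_less_trans)
  have "(\<integral>\<^sup>+z. ennreal ((hf (fst z) (snd z))\<^sup>2) \<partial>(\<mu> \<Otimes>\<^sub>M P)) = (\<integral>\<^sup>+x. \<integral>\<^sup>+f. ennreal ((hf f x)\<^sup>2) \<partial>\<mu> \<partial>P)"
    by (subst mp.nn_integral_snd[symmetric]) auto
  then have "(\<integral>\<^sup>+z. ennreal ((hf (fst z) (snd z))\<^sup>2) \<partial>(\<mu> \<Otimes>\<^sub>M P)) < \<infinity>"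
    using fin by (simp add: nn_pvar)
  then have "integrable (\<mu> \<Otimes>\<^sub>M P) (\<lambda>z. (hf (fst z) (snd z))\<^sup>2)"
    by (intro integrableI_bounded) auto
  then show ?thesis by (simp add: sq_integrable_def)
qed

sublocale sq_kernel \<mu> P hf D
  by standard (auto intro: hf_sq_integrable_pair hf_point_sq hf_sq AE_P_D)

section \<open>Reduction of arbitrary algorithms to orthogonal projections\<close>

lemma avg_err2_eq:
  assumes Am[measurable]: "(\<lambda>z. indicator D (snd z) * A (fst z) (snd z)) \<in> borel_measurable (\<mu> \<Otimes>\<^sub>M P)"
  shows "avg_err2 \<mu> evl D \<rho> A = (\<integral>\<^sup>+f. \<integral>\<^sup>+x. ennreal ((hf f x - indicator D x * A f x)\<^sup>2) \<partial>P \<partial>\<mu>)"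
  unfolding avg_err2_def
proof (intro nn_integral_cong)
  fix f
  have "(\<lambda>x. indicator D x * A f x) \<in> borel_measurable P"
    using measurable_compose[OF measurable_Pair1' Am, of f] by simp
  then have "(\<lambda>x. hf f x - indicator D x * A f x) \<in> borel_measurable borel"
    using hf_measurable[of f] by (simp add: borel_measurable_P)
  moreover have "indicator D x * (evl f x - A f x) = hf f x - indicator D x * A f x" for x
    by (simp add: hf_def right_diff_distrib)
  ultimately show "L2_sqnorm D \<rho> (\<lambda>x. evl f x - A f x) = (\<integral>\<^sup>+x. ennreal ((hf f x - indicator D x * A f x)\<^sup>2) \<partial>P)"
    by (subst L2_sqnorm_eq) auto
qed

lemma nn_sqnorm:
  assumes g: "nice_kernel g"
  shows "(\<integral>\<^sup>+f. \<integral>\<^sup>+x. ennreal ((g f x)\<^sup>2) \<partial>P \<partial>\<mu>) = ennreal (sqnorm g)"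
proof -
  have "(\<integral>\<^sup>+x. ennreal ((g f x)\<^sup>2) \<partial>P) = ennreal (\<integral>x. (g f x)\<^sup>2 \<partial>P)" for f
    using g by (intro nn_integral_eq_integral sq_integrable_sq) (auto simp: nice_kernel_def)
  then show ?thesis unfolding sqnorm_def
    using nn_integral_eq_integral[OF nice_kernel_swap(3)[OF g]] by simp
qed

lemma avg_err2_comb:
  assumes o: "orthonormal P p e" and a: "\<And>k. k < p \<Longrightarrow> sq_integrable \<mu> (a k)"
    and A: "\<And>f x. A f x = (\<Sum>k<p. a k f * e k x)"
  shows "avg_err2 \<mu> evl D \<rho> A = ennreal (sqnorm (\<lambda>f x. hf f x - (\<Sum>k<p. a k f * e k x)))"
proof -
  have [measurable]: "(\<lambda>z. \<Sum>k<p. a k (fst z) * e k (snd z)) \<in> borel_measurable (\<mu> \<Otimes>\<^sub>M P)"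
    using sq_integrable_sum[of "{..<p}" "\<mu> \<Otimes>\<^sub>M P", OF sq_integrable_product, of a e]
      a orthonormal_sq[OF o] by (simp add: sq_integrable_def)
  have "avg_err2 \<mu> evl D \<rho> A = (\<integral>\<^sup>+f. \<integral>\<^sup>+x. ennreal ((hf f x - indicator D x * A f x)\<^sup>2) \<partial>P \<partial>\<mu>)"
    by (rule avg_err2_eq) (simp add: A)
  also have "\<dots> = (\<integral>\<^sup>+f. \<integral>\<^sup>+x. ennreal ((hf f x - (\<Sum>k<p. a k f * e k x))\<^sup>2) \<partial>P \<partial>\<mu>)"
    using AE_P_D by (intro nn_integral_cong nn_integral_cong_AE) (auto simp: A elim!: eventually_mono)
  also have "\<dots> = ennreal (sqnorm (\<lambda>f x. hf f x - (\<Sum>k<p. a k f * e k x)))"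
    by (intro nn_sqnorm nice_kernel_sub_comb o a)
  finally show ?thesis .
qed

text \<open>Uncorrelated jointly Gaussian functionals are independent; here this is read off the Fourier
  transform of the signed law of the information weighted by \<open>r\<close>.\<close>

lemma uncorrelated_orthogonal_to_information:
  fixes L :: "nat \<Rightarrow> 'f \<Rightarrow> real"
  assumes r: "bounded_linear (r :: 'f \<Rightarrow> real)" and L: "\<And>i. i < m \<Longrightarrow> bounded_linear (L i)"
    and rL: "\<And>i. i < m \<Longrightarrow> (\<integral>f. r f * L i f \<partial>\<mu>) = 0"
    and g[measurable]: "g \<in> borel_measurable (PiM {..<m} (\<lambda>_. borel))"
    and u: "sq_integrable \<mu> (\<lambda>f. g (\<lambda>i\<in>{..<m}. L i f))"
  shows "(\<integral>f. r f * g (\<lambda>i\<in>{..<m}. L i f) \<partial>\<mu>) = 0"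
proof -
  define X where "X i = (if i < m then L i else (\<lambda>_. 0))" for i
  have Xb: "bounded_linear (X i)" for i using L by (simp add: X_def)
  have rX: "(\<integral>f. r f * X i f \<partial>\<mu>) = 0" for i using rL by (simp add: X_def)
  have rs: "sq_integrable \<mu> r" and Xs: "sq_integrable \<mu> (X i)" for i
    by (auto intro: centered_gaussian_distr(1)[OF gauss] r Xb)
  have Y: "bounded_linear (\<lambda>f. \<Sum>i<m. t i * X i f)" for t
    by (intro bounded_linear_sum bounded_linear_compose[OF bounded_linear_mult_right Xb])
  have rY: "(\<integral>f. r f * (\<Sum>i<m. t i * X i f) \<partial>\<mu>) = 0" for t
  proof -
    have "(\<integral>f. r f * (\<Sum>i<m. t i * X i f) \<partial>\<mu>) = (\<integral>f. (\<Sum>i<m. t i * (r f * X i f)) \<partial>\<mu>)"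
      by (simp add: sum_distrib_left mult_ac)
    also have "\<dots> = (\<Sum>i<m. \<integral>f. t i * (r f * X i f) \<partial>\<mu>)"
      using sq_integrable_mult[OF rs Xs] by (intro Bochner_Integration.integral_sum) auto
    finally show ?thesis by (simp add: rX)
  qed
  have X_eq: "(\<lambda>i\<in>{..<m}. X i f) = (\<lambda>i\<in>{..<m}. L i f)" for f by (auto simp: X_def)
  have "(\<integral>f. r f * g (\<lambda>i\<in>{..<m}. X i f) \<partial>\<mu>) = 0"
  proof (rule trig_vanishing_PiM[of \<mu> r X m g])
    show "integrable \<mu> r" by (rule mu.sq_integrable_integrable[OF rs])
    show "X i \<in> borel_measurable \<mu>" for i using Xs by (simp add: sq_integrable_def)
    show "(\<integral>f. r f * cos (\<Sum>i<m. t i * X i f) \<partial>\<mu>) = 0" for t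
      by (rule centered_gaussian_uncorrelated_trig(1)[OF gauss r Y rY])
    show "(\<integral>f. r f * sin (\<Sum>i<m. t i * X i f) \<partial>\<mu>) = 0" for t
      by (rule centered_gaussian_uncorrelated_trig(2)[OF gauss r Y rY])
    show "integrable \<mu> (\<lambda>f. r f * g (\<lambda>i\<in>{..<m}. X i f))"
      unfolding X_eq by (rule sq_integrable_mult[OF rs u])
  qed (rule g)
  then show ?thesis by (simp add: X_eq)
qed

text \<open>At a fixed \<open>x\<close> the residual of linear regression is uncorrelated with the
  information and therefore orthogonal to every square integrable function of it. So no predictor
  \<open>g\<close>, linear or not, beats the regression.\<close>

lemma regression_error_le:
  fixes L :: "nat \<Rightarrow> 'f \<Rightarrow> real"
  assumes l: "orthonormal \<mu> q l" and lb: "\<And>j. j < q \<Longrightarrow> bounded_linear (l j)"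
    and L: "\<And>i. i < m \<Longrightarrow> bounded_linear (L i)"
    and res: "\<And>i. i < m \<Longrightarrow> (\<integral>f. (L i f - (\<Sum>j<q. (\<integral>f. L i f * l j f \<partial>\<mu>) * l j f))\<^sup>2 \<partial>\<mu>) = 0"
    and gm[measurable]: "g \<in> borel_measurable (PiM {..<m} (\<lambda>_. borel))"
  shows "ennreal (\<integral>f. (hf f x - (\<Sum>j<q. (\<integral>f. hf f x * l j f \<partial>\<mu>) * l j f))\<^sup>2 \<partial>\<mu>)
    \<le> (\<integral>\<^sup>+f. ennreal ((hf f x - g (\<lambda>i\<in>{..<m}. L i f))\<^sup>2) \<partial>\<mu>)"
proof -
  define a where "a j = (\<integral>f. hf f x * l j f \<partial>\<mu>)" for j
  define r where "r f = hf f x - (\<Sum>j<q. a j * l j f)" for f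
  define \<psi> where "\<psi> f = g (\<lambda>i\<in>{..<m}. L i f)" for f
  have Ls: "sq_integrable \<mu> (L i)" if "i < m" for i
    by (rule centered_gaussian_distr(1)[OF gauss L[OF that]])
  have lin: "bounded_linear (\<lambda>f. u f + c * v f)" if "bounded_linear u" "bounded_linear v" for u v :: "'f \<Rightarrow> real" and c
    by (intro bounded_linear_add that bounded_linear_compose[OF bounded_linear_mult_right])
  have rb: "bounded_linear r"
    using lin_closed_sum[of "Collect bounded_linear" "\<lambda>f. hf f x" q l a] lin hf_linear lb
    by (simp add: r_def[abs_def])
  have rs: "sq_integrable \<mu> r" by (rule centered_gaussian_distr(1)[OF gauss rb])
  have rl: "(\<integral>f. r f * l j f \<partial>\<mu>) = 0" if "j < q" for j
    using residual_orthogonal[OF l hf_point_sq that] by (simp add: r_def a_def)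
  have rcomb: "(\<integral>f. r f * (\<Sum>j<q. c j * l j f) \<partial>\<mu>) = 0" for c
  proof -
    have "(\<integral>f. r f * (\<Sum>j<q. c j * l j f) \<partial>\<mu>) = (\<integral>f. (\<Sum>j<q. c j * (r f * l j f)) \<partial>\<mu>)"
      by (simp add: sum_distrib_left mult_ac)
    also have "\<dots> = (\<Sum>j<q. \<integral>f. c j * (r f * l j f) \<partial>\<mu>)"
      using sq_integrable_mult[OF rs orthonormal_sq[OF l]] by (intro Bochner_Integration.integral_sum) auto
    finally show ?thesis by (simp add: rl)
  qed
  have rL: "(\<integral>f. r f * L i f \<partial>\<mu>) = 0" if i: "i < m" for i
  proof -
    let ?c = "\<lambda>j. \<integral>f. L i f * l j f \<partial>\<mu>"
    let ?C = "\<lambda>f. \<Sum>j<q. ?c j * l j f"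
    have Cs: "sq_integrable \<mu> ?C" by (rule orthonormal_comb_sq[OF l])
    \<comment> \<open>\<open>L i\<close> agrees almost everywhere with its expansion in the
      \<open>l j\<close>, to which \<open>r\<close> is orthogonal.\<close>
    have "AE f in \<mu>. (L i f - ?C f)\<^sup>2 = 0"
      using res[OF i] sq_integrable_sq[OF sq_integrable_diff[OF Ls[OF i] Cs]]
      by (subst integral_nonneg_eq_0_iff_AE[symmetric]) auto
    then have "(\<integral>f. r f * L i f \<partial>\<mu>) = (\<integral>f. r f * ?C f \<partial>\<mu>)"
      using rs Ls[OF i] Cs by (intro integral_cong_AE) (auto simp: sq_integrable_def)
    then show ?thesis by (simp add: rcomb)
  qed
  have Lm[measurable]: "(\<lambda>f. \<lambda>i\<in>{..<m}. L i f) \<in> measurable \<mu> (PiM {..<m} (\<lambda>_. borel))"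
    using Ls by (intro measurable_restrict) (auto simp: sq_integrable_def)
  have psim[measurable]: "\<psi> \<in> borel_measurable \<mu>" unfolding \<psi>_def[abs_def] by measurable
  have hm[measurable]: "(\<lambda>f. hf f x) \<in> borel_measurable \<mu>" using hf_point_sq[of x] by (simp add: sq_integrable_def)
  have "ennreal (\<integral>f. (r f)\<^sup>2 \<partial>\<mu>) \<le> (\<integral>\<^sup>+f. ennreal ((hf f x - \<psi> f)\<^sup>2) \<partial>\<mu>)"
  proof (cases "(\<integral>\<^sup>+f. ennreal ((hf f x - \<psi> f)\<^sup>2) \<partial>\<mu>) = \<infinity>")
    \<comment> \<open>Only a finite right side needs an argument; finiteness makes
      \<open>\<psi>\<close> square integrable.\<close>
    case False
    then have "integrable \<mu> (\<lambda>f. (hf f x - \<psi> f)\<^sup>2)"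
      by (intro integrableI_bounded) (auto simp: less_top)
    then have us: "sq_integrable \<mu> (\<lambda>f. hf f x - \<psi> f)" by (simp add: sq_integrable_def)
    from sq_integrable_diff[OF hf_point_sq[of x] this] have ps: "sq_integrable \<mu> \<psi>" by simp
    define c where "c f = (\<Sum>j<q. a j * l j f) - \<psi> f" for f
    have cs: "sq_integrable \<mu> c" unfolding c_def[abs_def]
      by (intro sq_integrable_diff orthonormal_comb_sq[OF l] ps)
    have "(\<integral>f. r f * \<psi> f \<partial>\<mu>) = 0"
      using uncorrelated_orthogonal_to_information[of r m L g, OF rb L rL gm] ps unfolding \<psi>_def[abs_def] by simp
    then have rc: "(\<integral>f. r f * c f \<partial>\<mu>) = 0"
      using sq_integrable_mult[OF rs orthonormal_comb_sq[OF l, of a]] sq_integrable_mult[OF rs ps] rcomb[of a]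
      by (simp add: c_def right_diff_distrib)
    have "(\<integral>f. (r f)\<^sup>2 \<partial>\<mu>) \<le> (\<integral>f. (r f)\<^sup>2 + 2 * (r f * c f) + (c f)\<^sup>2 \<partial>\<mu>)"
    proof -
      have "(\<integral>f. (r f)\<^sup>2 + 2 * (r f * c f) + (c f)\<^sup>2 \<partial>\<mu>) = (\<integral>f. (r f)\<^sup>2 \<partial>\<mu>) + 2 * (\<integral>f. r f * c f \<partial>\<mu>) + (\<integral>f. (c f)\<^sup>2 \<partial>\<mu>)"
        using sq_integrable_sq[OF rs] sq_integrable_sq[OF cs] sq_integrable_mult[OF rs cs] by simp
      then show ?thesis using rc by simp
    qed
    also have "\<dots> = (\<integral>f. (hf f x - \<psi> f)\<^sup>2 \<partial>\<mu>)"
      by (intro Bochner_Integration.integral_cong refl) (simp add: r_def c_def power2_eq_square algebra_simps)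
    finally show ?thesis
      using nn_integral_eq_integral[OF sq_integrable_sq[OF us]] by (simp add: ennreal_leI)
  qed simp
  then show ?thesis by (simp add: r_def a_def \<psi>_def)
qed

text \<open>Regression improves the algorithm at each \<open>x\<close>, and Fubini turns this into a
  gain in the average error. The regression functions \<open>a j\<close> span a space of dimension
  at most \<open>m\<close>, and projecting each \<open>f\<close> onto it does at least as well.
  Gram-Schmidt is needed twice: over \<open>\<mu>\<close> for the functionals and over
  \<open>P\<close> for the functions.\<close>

lemma Lambda_all_lower_bound:
  assumes A: "A \<in> algorithms Lambda_all m D \<rho>"
  shows "\<exists>p\<le>m. \<exists>e. orthonormal P p e \<and> ennreal (proj_err p e) \<le> avg_err2 \<mu> evl D \<rho> A"
proof (cases "m = 0")
  case True
  then have "A f x = 0" for f x using A by (simp add: algorithms_def)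
  moreover have o: "orthonormal P 0 (\<lambda>_ _. 0)" by (simp add: orthonormal_def)
  ultimately have "avg_err2 \<mu> evl D \<rho> A = ennreal (proj_err 0 (\<lambda>_ _. 0))"
    using avg_err2_comb[OF o, of "\<lambda>_ _. 0" A] by simp
  then show ?thesis using o by (intro exI[of _ 0] conjI exI[of _ "\<lambda>_ _. 0"]) auto
next
  case False
  then obtain L \<phi> where L: "\<And>i. i < m \<Longrightarrow> bounded_linear (L i)" and adm: "admissible_phi m D \<rho> \<phi>"
    and A_eq: "A = (\<lambda>f. \<phi> (\<lambda>i\<in>{..<m}. L i f))"
    using A by (auto simp: algorithms_def Lambda_all_def)
  have Ls: "sq_integrable \<mu> (L i)" if "i < m" for i
    by (rule centered_gaussian_distr(1)[OF gauss L[OF that]])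
  have lin: "(\<lambda>f. u f + c * v f) \<in> Collect bounded_linear"
    if "u \<in> Collect bounded_linear" "v \<in> Collect bounded_linear" for u v :: "'f \<Rightarrow> real" and c
    using that by (auto intro!: bounded_linear_add bounded_linear_compose[OF bounded_linear_mult_right])
  \<comment> \<open>Orthonormalising inside the bounded linear functionals keeps the regression
    residuals Gaussian.\<close>
  obtain q l where q: "q \<le> m" and lb: "\<And>j. j < q \<Longrightarrow> bounded_linear (l j)" and l: "orthonormal \<mu> q l"
    and res: "\<And>i. i < m \<Longrightarrow> (\<integral>f. (L i f - (\<Sum>j<q. (\<integral>f. L i f * l j f \<partial>\<mu>) * l j f))\<^sup>2 \<partial>\<mu>) = 0"
    using gram_schmidt[of "Collect bounded_linear" \<mu> m L] lin L centered_gaussian_distr(1)[OF gauss]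
    by auto
  define a where "a j x = (\<integral>f. hf f x * l j f \<partial>\<mu>)" for j x
  have as: "sq_integrable P (a j)" if j: "j < q" for j
  proof -
    have lm[measurable]: "l j \<in> borel_measurable \<mu>" using orthonormal_sq[OF l j] by (simp add: sq_integrable_def)
    have "(\<lambda>z. hf (snd z) (fst z) * l j (snd z)) \<in> borel_measurable (P \<Otimes>\<^sub>M \<mu>)" by measurable
    then have am: "a j \<in> borel_measurable P"
      using mu.borel_measurable_lebesgue_integral[of "\<lambda>x f. hf f x * l j f" P] by (simp add: a_def[abs_def] case_prod_unfold)
    have "integrable P (\<lambda>x. (a j x)\<^sup>2)"
    proof (rule Bochner_Integration.integrable_bound[OF nice_kernel_swap(1)[OF nice_kernel_h]])
      show "AE x in P. norm ((a j x)\<^sup>2) \<le> norm (\<integral>f. (hf f x)\<^sup>2 \<partial>\<mu>)"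
      proof (intro AE_I2)
        fix x
        have "(a j x)\<^sup>2 \<le> (\<Sum>j<q. (a j x)\<^sup>2)" using j by (intro member_le_sum) auto
        also have "\<dots> \<le> (\<integral>f. (hf f x)\<^sup>2 \<partial>\<mu>)" unfolding a_def by (rule bessel[OF l hf_point_sq])
        finally show "norm ((a j x)\<^sup>2) \<le> norm (\<integral>f. (hf f x)\<^sup>2 \<partial>\<mu>)" by simp
      qed
    qed (use am in measurable)
    then show ?thesis using am by (simp add: sq_integrable_def)
  qed
  define r where "r f x = hf f x - (\<Sum>j<q. l j f * a j x)" for f x
  have rn: "nice_kernel r" unfolding r_def[abs_def] by (intro nice_kernel_sub_lin as orthonormal_sq[OF l])
  have phim: "(\<lambda>z. \<phi> (fst z) (snd z)) \<in> borel_measurable (PiM {..<m} (\<lambda>_. borel) \<Otimes>\<^sub>M P)"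
    using adm unfolding admissible_phi_def
    by (subst measurable_cong_sets[OF sets_pair_measure_cong[OF refl, of P lborel] refl]) auto
  have Lm[measurable]: "(\<lambda>f. \<lambda>i\<in>{..<m}. L i f) \<in> measurable \<mu> (PiM {..<m} (\<lambda>_. borel))"
    using Ls by (intro measurable_restrict) (auto simp: sq_integrable_def)
  have Dm[measurable]: "D \<in> sets P" by simp
  have Am[measurable]: "(\<lambda>z. A (fst z) (snd z)) \<in> borel_measurable (\<mu> \<Otimes>\<^sub>M P)"
    unfolding A_eq using measurable_compose[OF _ phim, of "\<lambda>z. (\<lambda>i\<in>{..<m}. L i (fst z), snd z)" "\<mu> \<Otimes>\<^sub>M P"]
    by simp
  have "ennreal (sqnorm r) = (\<integral>\<^sup>+x. ennreal (\<integral>f. (r f x)\<^sup>2 \<partial>\<mu>) \<partial>P)"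
    using nn_integral_eq_integral[OF nice_kernel_swap(1)[OF rn]] nice_kernel_swap(2)[OF rn] by simp
  also have "\<dots> \<le> (\<integral>\<^sup>+x. \<integral>\<^sup>+f. ennreal ((hf f x - indicator D x * A f x)\<^sup>2) \<partial>\<mu> \<partial>P)"
  proof (rule nn_integral_mono_AE)
    show "AE x in P. ennreal (\<integral>f. (r f x)\<^sup>2 \<partial>\<mu>) \<le> (\<integral>\<^sup>+f. ennreal ((hf f x - indicator D x * A f x)\<^sup>2) \<partial>\<mu>)"
      using AE_P_D
    proof eventually_elim
      case (elim x)
      have "(\<lambda>y. \<phi> y x) \<in> borel_measurable (PiM {..<m} (\<lambda>_. borel))"
        using measurable_compose[OF measurable_Pair2' phim, of x] by simp
      from regression_error_le[where x=x, OF l lb L res this] show ?case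
        using elim by (simp add: r_def a_def A_eq mult.commute)
    qed
  qed
  also have "\<dots> = (\<integral>\<^sup>+f. \<integral>\<^sup>+x. ennreal ((hf f x - indicator D x * A f x)\<^sup>2) \<partial>P \<partial>\<mu>)"
    by (rule mp.Fubini') measurable
  also have "\<dots> = avg_err2 \<mu> evl D \<rho> A" by (rule avg_err2_eq[symmetric]) measurable
  finally have lower: "ennreal (sqnorm r) \<le> avg_err2 \<mu> evl D \<rho> A" .
  have linP: "sq_integrable P (\<lambda>x. u x + c * v x)" if "sq_integrable P u" "sq_integrable P v" for u v c
    by (intro sq_integrable_add sq_integrable_cmult that)
  obtain p e where p: "p \<le> q" and e: "orthonormal P p e"
    and eres: "\<And>j. j < q \<Longrightarrow> (\<integral>x. (a j x - (\<Sum>k<p. (\<integral>y. a j y * e k y \<partial>P) * e k x))\<^sup>2 \<partial>P) = 0"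
    using gram_schmidt[of "Collect (sq_integrable P)" P q a] as linP by auto
  define c where "c f k = (\<Sum>j<q. l j f * (\<integral>y. a j y * e k y \<partial>P))" for f k
  have ae: "AE x in P. (\<Sum>j<q. l j f * a j x) = (\<Sum>k<p. c f k * e k x)" for f
  proof -
    have "AE x in P. \<forall>j\<in>{..<q}. a j x = (\<Sum>k<p. (\<integral>y. a j y * e k y \<partial>P) * e k x)"
    proof (rule AE_finite_allI)
      fix j assume "j \<in> {..<q}"
      then have j: "j < q" by simp
      have "AE x in P. (a j x - (\<Sum>k<p. (\<integral>y. a j y * e k y \<partial>P) * e k x))\<^sup>2 = 0"
        using eres[OF j] sq_integrable_sq[OF sq_integrable_diff[OF as[OF j] orthonormal_comb_sq[OF e]]]
        by (subst integral_nonneg_eq_0_iff_AE[symmetric]) auto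
      then show "AE x in P. a j x = (\<Sum>k<p. (\<integral>y. a j y * e k y \<partial>P) * e k x)" by eventually_elim simp
    qed simp
    then show ?thesis
    proof eventually_elim
      case (elim x)
      have "(\<Sum>j<q. l j f * a j x) = (\<Sum>j<q. \<Sum>k<p. l j f * ((\<integral>y. a j y * e k y \<partial>P) * e k x))"
        using elim by (intro sum.cong) (auto simp: sum_distrib_left)
      also have "\<dots> = (\<Sum>k<p. c f k * e k x)"
        unfolding c_def by (subst sum.swap) (simp add: sum_distrib_right mult.assoc)
      finally show ?case .
    qed
  qed
  have "proj_err p e \<le> sqnorm r"
    unfolding sqnorm_def
  proof (rule integral_mono)
    show "integrable \<mu> (\<lambda>f. \<integral>x. (hf f x - (\<Sum>k<p. coef e k f * e k x))\<^sup>2 \<partial>P)"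
      by (intro nice_kernel_swap(3) nice_kernel_sub_comb[OF e] coef_sq[OF e])
    show "integrable \<mu> (\<lambda>f. \<integral>x. (r f x)\<^sup>2 \<partial>P)" by (rule nice_kernel_swap(3)[OF rn])
    fix f
    have "(\<integral>x. (hf f x - (\<Sum>k<p. coef e k f * e k x))\<^sup>2 \<partial>P) \<le> (\<integral>x. (hf f x - (\<Sum>k<p. c f k * e k x))\<^sup>2 \<partial>P)"
      by (rule residual_le[OF e hf_sq])
    also have "\<dots> = (\<integral>x. (r f x)\<^sup>2 \<partial>P)"
    proof (rule integral_cong_AE)
      show "(\<lambda>x. (hf f x - (\<Sum>k<p. c f k * e k x))\<^sup>2) \<in> borel_measurable P"
        by (intro borel_measurable_power sq_integrable_measurable sq_integrable_diff hf_sq orthonormal_comb_sq[OF e])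
      show "(\<lambda>x. (r f x)\<^sup>2) \<in> borel_measurable P"
        using rn by (intro borel_measurable_power sq_integrable_measurable) (simp add: nice_kernel_def)
      show "AE x in P. (hf f x - (\<Sum>k<p. c f k * e k x))\<^sup>2 = (r f x)\<^sup>2"
        using ae[of f] by eventually_elim (simp add: r_def)
    qed
    finally show "(\<integral>x. (hf f x - (\<Sum>k<p. coef e k f * e k x))\<^sup>2 \<partial>P) \<le> (\<integral>x. (r f x)\<^sup>2 \<partial>P)" .
  qed
  then have "ennreal (proj_err p e) \<le> avg_err2 \<mu> evl D \<rho> A"
    using lower by (meson ennreal_leI order_trans)
  then show ?thesis using p q e by (intro exI[of _ p] conjI exI[of _ e]) auto
qed

section \<open>Sampling algorithms and the comparison of the two classes\<close>

lemma sq_integrable_indicator_D: "sq_integrable P g \<Longrightarrow> sq_integrable P (\<lambda>x. indicator D x * g x)"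
proof -
  assume g: "sq_integrable P g"
  then have [measurable]: "g \<in> borel_measurable P" by (simp add: sq_integrable_def)
  have Dm[measurable]: "D \<in> sets P" by simp
  have "integrable P (\<lambda>x. (indicator D x * g x)\<^sup>2)"
    by (rule Bochner_Integration.integrable_bound[OF sq_integrable_sq[OF g]]) (auto simp: indicator_def)
  then show ?thesis by (simp add: sq_integrable_def)
qed

lemma linear_admissible:
  assumes e: "orthonormal P p e"
  shows "admissible_phi n D \<rho> (\<lambda>y x. \<Sum>k<p. (\<Sum>i<n. c k i * y i) * e k x)"
  unfolding admissible_phi_def
proof (intro conjI ballI)
  have em[measurable]: "e k \<in> borel_measurable lborel" if "k < p" for k
    using orthonormal_sq[OF e that] by (simp add: sq_integrable_def borel_measurable_P)
  have cm: "(\<lambda>z. fst z i) \<in> borel_measurable (PiM {..<n} (\<lambda>_. borel :: real measure) \<Otimes>\<^sub>M lborel)" if "i < n" for i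
    using measurable_compose[OF measurable_fst measurable_component_singleton[of i "{..<n}" "\<lambda>_. borel :: real measure"]] that by simp
  show "(\<lambda>z. \<Sum>k<p. (\<Sum>i<n. c k i * fst z i) * e k (snd z)) \<in> borel_measurable (PiM {..<n} (\<lambda>_. borel) \<Otimes>\<^sub>M lborel)"
    by (intro borel_measurable_sum borel_measurable_times borel_measurable_const cm measurable_compose[OF measurable_snd em]) auto
  show "L2_member D \<rho> (\<lambda>x. \<Sum>k<p. (\<Sum>i<n. c k i * y i) * e k x)" for y
    unfolding L2_member_iff by (intro sq_integrable_indicator_D orthonormal_comb_sq[OF e])
qed

lemma std_algorithm:
  assumes A: "finite A" "A \<subseteq> D" and n: "card A \<le> n" "0 < n" and e: "orthonormal P p e"
    and a: "\<And>k. k < p \<Longrightarrow> a k \<in> hspan A"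
  shows "\<exists>B\<in>algorithms (Lambda_std evl D) n D \<rho>.
    avg_err2 \<mu> evl D \<rho> B = ennreal (sqnorm (\<lambda>f x. hf f x - (\<Sum>k<p. a k f * e k x)))"
proof -
  have "D \<noteq> {}" using D_pos by auto
  then obtain x0 where x0: "x0 \<in> D" by blast
  obtain b where b: "bij_betw b {0..<card A} A" using ex_bij_betw_nat_finite[OF A(1)] by blast
  \<comment> \<open>An algorithm uses exactly \<open>n\<close> functionals, so missing points are
    filled up with \<open>x0\<close>, whose coefficients are zero.\<close>
  define pts where "pts i = (if i < card A then b i else x0)" for i
  have bD: "b i \<in> D" if "i < card A" for i using b A(2) that by (auto simp: bij_betw_def)
  then have ptsD: "pts i \<in> D" for i using x0 by (simp add: pts_def)
  have "\<forall>k. \<exists>c. k < p \<longrightarrow> a k = (\<lambda>f. \<Sum>x\<in>A. c x * hf f x)" using a by (auto simp: hspan_def)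
  then obtain c where c: "\<And>k. k < p \<Longrightarrow> a k = (\<lambda>f. \<Sum>x\<in>A. c k x * hf f x)" by metis
  define d where "d k i = (if i < card A then c k (b i) else 0)" for k i
  have ad: "a k f = (\<Sum>i<n. d k i * evl f (pts i))" if "k < p" for k f
  proof -
    have "a k f = (\<Sum>i\<in>{0..<card A}. c k (b i) * hf f (b i))"
      using c[OF that] sum.reindex_bij_betw[OF b, of "\<lambda>x. c k x * hf f x"] by simp
    also have "\<dots> = (\<Sum>i\<in>{0..<card A}. d k i * evl f (pts i))"
      using bD by (intro sum.cong) (auto simp: d_def pts_def hf_def)
    also have "\<dots> = (\<Sum>i<n. d k i * evl f (pts i))"
      using n(1) by (intro sum.mono_neutral_left) (auto simp: d_def)
    finally show ?thesis .
  qed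
  define B where "B f x = (\<Sum>k<p. (\<Sum>i<n. d k i * (\<lambda>i\<in>{..<n}. evl f (pts i)) i) * e k x)" for f x
  have "B \<in> algorithms (Lambda_std evl D) n D \<rho>"
    unfolding algorithms_def using n(2)
    by (auto simp: Lambda_std_def B_def[abs_def] intro!: exI[of _ "\<lambda>i f. evl f (pts i)"]
      exI[of _ "\<lambda>y x. \<Sum>k<p. (\<Sum>i<n. d k i * y i) * e k x"] linear_admissible[OF e] ptsD)
  moreover have "avg_err2 \<mu> evl D \<rho> B = ennreal (sqnorm (\<lambda>f x. hf f x - (\<Sum>k<p. a k f * e k x)))"
  proof (rule avg_err2_comb[OF e])
    show "sq_integrable \<mu> (a k)" if "k < p" for k by (rule hspan_sq[OF A(2) a[OF that]])
    show "B f x = (\<Sum>k<p. a k f * e k x)" for f x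
      unfolding B_def by (intro sum.cong refl) (simp add: ad)
  qed
  ultimately show ?thesis by blast
qed

definition min_err2 :: "('f \<Rightarrow> real) set \<Rightarrow> nat \<Rightarrow> ennreal" where
  "min_err2 \<Lambda> n = (INF A \<in> algorithms \<Lambda> n D \<rho>. avg_err2 \<mu> evl D \<rho> A)"

lemma e_avg_eq: "e_avg \<mu> evl D \<rho> \<Lambda> n = sqrt (enn2real (min_err2 \<Lambda> n))"
  by (simp add: e_avg_def min_err2_def)

text \<open>\<open>e_avg\<close> passes through \<open>enn2real\<close>, which sends infinity to 0;
  without finiteness a right side equal to 0 could hide an infinite error.\<close>

lemma min_err2_Lambda_all_finite: "min_err2 Lambda_all n < \<infinity>"
proof -
  have o: "orthonormal P 0 (\<lambda>_ _. 0)" by (simp add: orthonormal_def)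
  have "(\<lambda>f x. 0) \<in> algorithms Lambda_all n D \<rho>"
  proof (cases "n = 0")
    case False
    then show ?thesis using linear_admissible[OF o, of n "\<lambda>_ _. 0"]
      by (auto simp: algorithms_def Lambda_all_def intro!: exI[of _ "\<lambda>_ _. 0"])
  qed (simp add: algorithms_def)
  then have "min_err2 Lambda_all n \<le> avg_err2 \<mu> evl D \<rho> (\<lambda>f x. 0)"
    unfolding min_err2_def by (rule INF_lower)
  also have "\<dots> = ennreal (sqnorm hf)" using avg_err2_comb[OF o, of "\<lambda>_ _. 0" "\<lambda>_ _. 0"] by simp
  finally show ?thesis by (auto intro: le_less_trans)
qed

lemma std_le_all:
  "e_avg \<mu> evl D \<rho> (Lambda_std evl D) n \<le> 4 * e_avg \<mu> evl D \<rho> Lambda_all (m_of n)"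
proof (cases "n = 0")
  \<comment> \<open>Here \<open>m_of 0 = 0\<close>, and without functionals both classes admit the
    zero algorithm only.\<close>
  case True
  have "min_err2 (Lambda_std evl D) 0 = min_err2 Lambda_all 0"
    by (simp add: min_err2_def algorithms_def)
  then show ?thesis using True by (simp add: e_avg_eq m_of_def)
next
  case False
  define S where "S = enn2real (min_err2 (Lambda_std evl D) n)"
  define I where "I = enn2real (min_err2 Lambda_all (m_of n))"
  have I: "min_err2 Lambda_all (m_of n) = ennreal I"
    using min_err2_Lambda_all_finite[of "m_of n"] by (simp add: I_def)
  have std: "S \<le> 16 * proj_err p e" if p: "p \<le> m_of n" and e: "orthonormal P p e" for p e
  proof -
    obtain J where J: "p ^ 3 \<le> 2 ^ J" "p + 2 * p * J \<le> n" using sample_budget[OF _ p] False by auto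
    obtain A a where A: "finite A" "A \<subseteq> D" "card A \<le> p + 2 * p * J" and a: "\<And>k. k < p \<Longrightarrow> a k \<in> hspan A"
      and le: "sqnorm (\<lambda>f x. hf f x - (\<Sum>k<p. a k f * e k x)) \<le> 16 * proj_err p e"
      using sampling_recovery[OF e J(1)] by blast
    obtain B where B: "B \<in> algorithms (Lambda_std evl D) n D \<rho>"
      "avg_err2 \<mu> evl D \<rho> B = ennreal (sqnorm (\<lambda>f x. hf f x - (\<Sum>k<p. a k f * e k x)))"
      using std_algorithm[of A n p e a] A J(2) False e a by auto
    have "min_err2 (Lambda_std evl D) n \<le> avg_err2 \<mu> evl D \<rho> B"
      unfolding min_err2_def by (rule INF_lower[OF B(1)])
    also have "\<dots> \<le> ennreal (16 * proj_err p e)" unfolding B(2) by (intro ennreal_leI le)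
    finally have "S \<le> enn2real (ennreal (16 * proj_err p e))"
      unfolding S_def by (rule enn2real_mono) simp
    also have "\<dots> = 16 * proj_err p e" by (intro enn2real_ennreal mult_nonneg_nonneg sqnorm_nonneg) simp
    finally show ?thesis .
  qed
  \<comment> \<open>The infimum need not be attained; the contrary assumption supplies an algorithm
    with squared error below \<open>S / 16\<close>, to which the lower bound applies.\<close>
  have "S \<le> 16 * I"
  proof (rule ccontr)
    assume "\<not> S \<le> 16 * I"
    then have "I < S / 16" by simp
    moreover have "0 \<le> I" by (simp add: I_def)
    ultimately have "ennreal I < ennreal (S / 16)" by (simp add: ennreal_less_iff)
    then have "(INF A \<in> algorithms Lambda_all (m_of n) D \<rho>. avg_err2 \<mu> evl D \<rho> A) < ennreal (S / 16)"
      by (simp add: I[symmetric] min_err2_def)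
    then obtain A where A: "A \<in> algorithms Lambda_all (m_of n) D \<rho>" "avg_err2 \<mu> evl D \<rho> A < ennreal (S / 16)"
      by (auto simp: INF_less_iff)
    obtain p e where p: "p \<le> m_of n" "orthonormal P p e" "ennreal (proj_err p e) \<le> avg_err2 \<mu> evl D \<rho> A"
      using Lambda_all_lower_bound[OF A(1)] by blast
    have "ennreal (proj_err p e) < ennreal (S / 16)" using p(3) A(2) by (rule le_less_trans)
    then have "proj_err p e < S / 16" using sqnorm_nonneg by (simp add: ennreal_less_iff)
    then show False using std[OF p(1,2)] by simp
  qed
  then have "sqrt S \<le> sqrt (16 * I)" by simp
  also have "\<dots> = 4 * sqrt I" by (simp add: real_sqrt_mult)
  finally show ?thesis by (simp add: e_avg_eq S_def I_def)
qed

section \<open>Trace of the covariance operator and eigenvalue tails\<close>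

lemma sqnorm_hf_eq:
  assumes o: "orthonormal P p g"
  shows "sqnorm hf = proj_err p g + (\<Sum>k<p. \<integral>f. (coef g k f)\<^sup>2 \<partial>\<mu>)"
  using sqnorm_sub_comb[OF o, of "\<lambda>_ _. 0"] by simp

lemma embedding_bound: "\<exists>C\<ge>0. \<forall>f. (\<integral>x. (hf f x)\<^sup>2 \<partial>P) \<le> C * (norm f)\<^sup>2"
proof -
  obtain C where C: "\<And>f. L2_inner D \<rho> (evl f) (evl f) \<le> C * (norm f)\<^sup>2"
    using setting by (auto simp: avg_setting_def)
  have "(\<integral>x. (hf f x)\<^sup>2 \<partial>P) \<le> \<bar>C\<bar> * (norm f)\<^sup>2" for f
  proof -
    have "(\<integral>x. (hf f x)\<^sup>2 \<partial>P) = L2_inner D \<rho> (evl f) (evl f)"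
      by (subst L2_inner_eq[OF evl_member evl_member]) (simp add: hf_def power2_eq_square)
    also have "\<dots> \<le> C * (norm f)\<^sup>2" by (rule C)
    also have "\<dots> \<le> \<bar>C\<bar> * (norm f)\<^sup>2" by (intro mult_right_mono) auto
    finally show ?thesis .
  qed
  then show ?thesis by (intro exI[of _ "\<bar>C\<bar>"]) auto
qed

text \<open>Bessel and the continuous embedding bound the coefficient functional, which makes
  projections admissible as algorithms from \<open>Lambda_all\<close>.\<close>

lemma coef_bounded_linear:
  assumes o: "orthonormal P p e" and k: "k < p"
  shows "bounded_linear (coef e k)"
proof -
  obtain C where C: "0 \<le> C" "\<And>f. (\<integral>x. (hf f x)\<^sup>2 \<partial>P) \<le> C * (norm f)\<^sup>2" using embedding_bound by blast
  have i: "integrable P (\<lambda>x. hf f x * e k x)" for f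
    by (rule sq_integrable_mult[OF hf_sq orthonormal_sq[OF o k]])
  show ?thesis
  proof (rule bounded_linear_intro)
    show "coef e k (f + g) = coef e k f + coef e k g" for f g
      using i by (simp add: linear_add[OF bounded_linear.linear[OF hf_linear]] distrib_right)
    show "coef e k (r *\<^sub>R f) = r *\<^sub>R coef e k f" for r f
      by (simp add: linear_scale[OF bounded_linear.linear[OF hf_linear]] mult.assoc)
    show "norm (coef e k f) \<le> norm f * sqrt C" for f
    proof -
      have "(coef e k f)\<^sup>2 \<le> (\<Sum>k<p. (coef e k f)\<^sup>2)" using k by (intro member_le_sum) auto
      also have "\<dots> \<le> (\<integral>x. (hf f x)\<^sup>2 \<partial>P)" by (rule bessel[OF o hf_sq])
      also have "\<dots> \<le> C * (norm f)\<^sup>2" by (rule C)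
      finally have "sqrt ((coef e k f)\<^sup>2) \<le> sqrt (C * (norm f)\<^sup>2)" by (rule real_sqrt_le_mono)
      then show ?thesis by (simp add: real_sqrt_mult mult.commute)
    qed
  qed
qed

text \<open>Separability of \<open>F\<close> takes the place of completeness of the eigenfunctions,
  which \<open>cov_eigenvalues\<close> does not state: projections onto the spans of initial parts
  of a dense sequence converge for every \<open>f\<close>, and dominated convergence passes to the
  mean.\<close>

lemma finite_rank_approximation:
  assumes \<epsilon>: "0 < \<epsilon>"
  shows "\<exists>p g. orthonormal P p g \<and> proj_err p g < \<epsilon>"
proof -
  obtain C where C: "0 \<le> C" "\<And>f. (\<integral>x. (hf f x)\<^sup>2 \<partial>P) \<le> C * (norm f)\<^sup>2" using embedding_bound by blast
  obtain d :: "nat \<Rightarrow> 'f" where d: "\<And>w r. 0 < r \<Longrightarrow> \<exists>i. dist w (d i) < r" using dense_sequence by blast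
  have linP: "sq_integrable P (\<lambda>x. u x + c * v x)" if "sq_integrable P u" "sq_integrable P v" for u v c
    by (intro sq_integrable_add sq_integrable_cmult that)
  have ex: "\<forall>n. \<exists>pg. orthonormal P (fst pg) (snd pg) \<and>
    (\<forall>i<n. (\<integral>x. (hf (d i) x - (\<Sum>k<fst pg. coef (snd pg) k (d i) * snd pg k x))\<^sup>2 \<partial>P) = 0)"
  proof
    fix n
    obtain p e where "orthonormal P p e"
      "\<And>i. i < n \<Longrightarrow> (\<integral>x. (hf (d i) x - (\<Sum>k<p. coef e k (d i) * e k x))\<^sup>2 \<partial>P) = 0"
      using gram_schmidt[of "Collect (sq_integrable P)" P n "\<lambda>i. hf (d i)"] linP hf_sq by auto
    then show "\<exists>pg. orthonormal P (fst pg) (snd pg) \<and>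
      (\<forall>i<n. (\<integral>x. (hf (d i) x - (\<Sum>k<fst pg. coef (snd pg) k (d i) * snd pg k x))\<^sup>2 \<partial>P) = 0)"
      by (intro exI[of _ "(p, e)"]) simp
  qed
  obtain pg where pg: "\<forall>n. orthonormal P (fst (pg n)) (snd (pg n)) \<and>
    (\<forall>i<n. (\<integral>x. (hf (d i) x - (\<Sum>k<fst (pg n). coef (snd (pg n)) k (d i) * snd (pg n) k x))\<^sup>2 \<partial>P) = 0)"
    using choice[OF ex] by blast
  define p where "p n = fst (pg n)" for n
  define g where "g n = snd (pg n)" for n
  have o: "orthonormal P (p n) (g n)" for n using pg by (simp add: p_def g_def)
  have res: "(\<integral>x. (hf (d i) x - (\<Sum>k<p n. coef (g n) k (d i) * g n k x))\<^sup>2 \<partial>P) = 0" if "i < n" for n i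
    using pg that by (simp add: p_def g_def)
  define F where "F n f = (\<integral>x. (hf f x - (\<Sum>k<p n. coef (g n) k f * g n k x))\<^sup>2 \<partial>P)" for n f
  have Fi: "integrable \<mu> (F n)" for n
    unfolding F_def[abs_def] by (intro nice_kernel_swap(3) nice_kernel_sub_comb[OF o] coef_sq[OF o])
  have F0: "0 \<le> F n f" for n f by (simp add: F_def)
  have Fle: "F n f \<le> (\<integral>x. (hf f x)\<^sup>2 \<partial>P)" for n f
    using residual_le[OF o[of n] hf_sq[of f], of "\<lambda>_. 0"] by (simp add: F_def)
  have Fd: "F n f \<le> C * (dist f (d i))\<^sup>2" if i: "i < n" for n i f
  proof -
    let ?G = "\<lambda>x. \<Sum>k<p n. coef (g n) k (d i) * g n k x"
    have Gs: "sq_integrable P ?G" by (rule orthonormal_comb_sq[OF o])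
    have "AE x in P. (hf (d i) x - ?G x)\<^sup>2 = 0"
      using res[OF i] sq_integrable_sq[OF sq_integrable_diff[OF hf_sq Gs]]
      by (subst integral_nonneg_eq_0_iff_AE[symmetric]) auto
    then have ae: "AE x in P. (hf f x - ?G x)\<^sup>2 = (hf (f - d i) x)\<^sup>2"
      by eventually_elim (simp add: linear_diff[OF bounded_linear.linear[OF hf_linear]])
    \<comment> \<open>The projection of \<open>f\<close> is at least as good as \<open>?G\<close>,
      the projection of \<open>d i\<close>, which is \<open>d i\<close> itself almost
      everywhere.\<close>
    have "F n f \<le> (\<integral>x. (hf f x - ?G x)\<^sup>2 \<partial>P)" unfolding F_def by (rule residual_le[OF o hf_sq])
    also have "\<dots> = (\<integral>x. (hf (f - d i) x)\<^sup>2 \<partial>P)"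
      using sq_integrable_diff[OF hf_sq[of f] Gs] hf_sq[of "f - d i"] ae
      by (intro integral_cong_AE) (auto simp: sq_integrable_def)
    also have "\<dots> \<le> C * (norm (f - d i))\<^sup>2" by (rule C)
    finally show ?thesis by (simp add: dist_norm)
  qed
  have Flim: "(\<lambda>n. F n f) \<longlonglongrightarrow> 0" for f
  proof (rule LIMSEQ_I)
    fix r :: real assume r: "0 < r"
    obtain i where i: "dist f (d i) < sqrt (r / (C + 1))"
      using d[of "sqrt (r / (C + 1))" f] r C(1) by auto
    have "(dist f (d i))\<^sup>2 < (sqrt (r / (C + 1)))\<^sup>2" using i by (intro power_strict_mono) auto
    then have "(dist f (d i))\<^sup>2 < r / (C + 1)" using r C(1) by simp
    then have "(C + 1) * (dist f (d i))\<^sup>2 < r" using C(1) by (simp add: less_divide_eq mult.commute)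
    moreover have "C * (dist f (d i))\<^sup>2 \<le> (C + 1) * (dist f (d i))\<^sup>2" by (intro mult_right_mono) auto
    ultimately have "C * (dist f (d i))\<^sup>2 < r" by linarith
    then have "norm (F n f - 0) < r" if "n \<ge> Suc i" for n
      using Fd[of i n f] F0[of n f] that by simp
    then show "\<exists>no. \<forall>n\<ge>no. norm (F n f - 0) < r" by blast
  qed
  have "(\<lambda>n. \<integral>f. F n f \<partial>\<mu>) \<longlonglongrightarrow> (\<integral>f. 0 \<partial>\<mu>)"
  proof (rule integral_dominated_convergence[where w="\<lambda>f. \<integral>x. (hf f x)\<^sup>2 \<partial>P"])
    show "integrable \<mu> (\<lambda>f. \<integral>x. (hf f x)\<^sup>2 \<partial>P)" by (rule nice_kernel_swap(3)[OF nice_kernel_h])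
    show "AE f in \<mu>. (\<lambda>n. F n f) \<longlonglongrightarrow> 0" using Flim by simp
    show "AE f in \<mu>. norm (F n f) \<le> (\<integral>x. (hf f x)\<^sup>2 \<partial>P)" for n using F0 Fle by simp
  qed (use Fi in auto)
  then have "(\<lambda>n. proj_err (p n) (g n)) \<longlonglongrightarrow> 0" by (simp add: sqnorm_def F_def)
  then have "\<forall>\<^sub>F n in sequentially. proj_err (p n) (g n) < \<epsilon>" by (rule order_tendstoD) (rule \<epsilon>)
  then obtain n where "proj_err (p n) (g n) < \<epsilon>" by (auto simp: eventually_sequentially)
  then show ?thesis using o by blast
qed

lemma cov_eigenvalues_functions:
  assumes "cov_eigenvalues \<mu> evl D \<rho> lam"
  obtains E where "\<And>m. orthonormal P m E"
    and "\<And>g. sq_integrable P g \<Longrightarrow>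
      (\<lambda>k. lam k * (\<integral>x. g x * E k x \<partial>P)\<^sup>2) sums (\<integral>f. (\<integral>x. hf f x * g x \<partial>P)\<^sup>2 \<partial>\<mu>)"
proof -
  obtain e where em: "\<And>k. L2_member D \<rho> (e k)"
    and eo: "\<And>j k. L2_inner D \<rho> (e j) (e k) = (if j = k then 1 else 0)"
    and es: "\<And>g h. L2_member D \<rho> g \<Longrightarrow> L2_member D \<rho> h \<Longrightarrow>
           (\<lambda>k. lam k * L2_inner D \<rho> g (e k) * L2_inner D \<rho> h (e k)) sums
             (\<integral>f. L2_inner D \<rho> (evl f) g * L2_inner D \<rho> (evl f) h \<partial>\<mu>)"
    using assms unfolding cov_eigenvalues_def by blast
  define E where "E k x = indicator D x * e k x" for k x
  have ii: "indicator D x * a * (indicator D x * b) = a * (indicator D x * b)" for x and a b :: real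
    by (simp add: indicator_def)
  show ?thesis
  proof (rule that)
    show "orthonormal P m E" for m
      unfolding orthonormal_def
      using em eo L2_inner_eq[OF em em] by (auto simp: L2_member_iff E_def[abs_def])
    fix g assume g: "sq_integrable P g"
    then have gm: "L2_member D \<rho> g" unfolding L2_member_iff by (rule sq_integrable_indicator_D)
    have "L2_inner D \<rho> g (e k) = (\<integral>x. g x * E k x \<partial>P)" for k
      by (subst L2_inner_eq[OF gm em]) (simp add: E_def ii)
    moreover have "L2_inner D \<rho> (evl f) g = (\<integral>x. hf f x * g x \<partial>P)" for f
      by (subst L2_inner_eq[OF evl_member gm], intro Bochner_Integration.integral_cong refl)
        (simp add: hf_def indicator_def)
    ultimately show "(\<lambda>k. lam k * (\<integral>x. g x * E k x \<partial>P)\<^sup>2) sums (\<integral>f. (\<integral>x. hf f x * g x \<partial>P)\<^sup>2 \<partial>\<mu>)"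
      using es[OF gm gm] by (simp add: power2_eq_square mult.assoc)
  qed
qed

lemma Lambda_all_upper_bound:
  assumes o: "orthonormal P m E"
  shows "min_err2 Lambda_all m \<le> ennreal (proj_err m E)"
proof -
  let ?A = "\<lambda>f x. \<Sum>k<m. coef E k f * E k x"
  have "?A \<in> algorithms Lambda_all m D \<rho>"
  proof (cases "m = 0")
    case False
    have s: "(\<Sum>i<m. (if i = k then 1 else 0) * y i) = y k" if "k < m" for k and y :: "nat \<Rightarrow> real"
      using that by (subst sum.remove[of _ k]) (auto intro!: sum.neutral)
    define \<phi> where "\<phi> y x = (\<Sum>k<m. (\<Sum>i<m. (if i = k then 1 else 0) * y i) * E k x)" for y x
    have "?A = (\<lambda>f. \<phi> (\<lambda>i\<in>{..<m}. coef E i f))"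
      unfolding \<phi>_def by (intro ext sum.cong refl) (simp only: s restrict_apply lessThan_iff if_True)
    moreover have "admissible_phi m D \<rho> \<phi>"
      unfolding \<phi>_def[abs_def] by (rule linear_admissible[OF o])
    moreover have "\<forall>i<m. coef E i \<in> Lambda_all"
      using coef_bounded_linear[OF o] by (simp add: Lambda_all_def)
    ultimately show ?thesis
      unfolding algorithms_def if_not_P[OF False]
      by (intro CollectI exI[of _ "coef E"] exI[of _ \<phi>] conjI)
  qed (simp add: algorithms_def)
  then have "min_err2 Lambda_all m \<le> avg_err2 \<mu> evl D \<rho> ?A"
    unfolding min_err2_def by (rule INF_lower)
  also have "\<dots> = ennreal (proj_err m E)" by (rule avg_err2_comb[OF o coef_sq[OF o]]) auto
  finally show ?thesis .
qed

text \<open>Projecting onto the first \<open>m\<close> eigenfunctions leaves the trace of the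
  covariance minus the first \<open>m\<close> eigenvalues, so the trace has to be compared with the
  sum of the eigenvalues in one direction only.\<close>

lemma e_avg_all_le_eigenvalue_tail:
  assumes cov: "cov_eigenvalues \<mu> evl D \<rho> lam" and sm: "summable lam" and nn: "\<And>k. 0 \<le> lam k"
  shows "(e_avg \<mu> evl D \<rho> Lambda_all m)\<^sup>2 \<le> suminf lam - (\<Sum>k<m. lam k)"
proof -
  obtain E where o: "\<And>m. orthonormal P m E"
    and sums: "\<And>g. sq_integrable P g \<Longrightarrow>
      (\<lambda>k. lam k * (\<integral>x. g x * E k x \<partial>P)\<^sup>2) sums (\<integral>f. (\<integral>x. hf f x * g x \<partial>P)\<^sup>2 \<partial>\<mu>)"
    using cov_eigenvalues_functions[OF cov] by blast
  have Es: "sq_integrable P (E k)" for k using orthonormal_sq[OF o[of "Suc k"], of k] by simp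
  have EE: "(\<integral>x. E j x * E k x \<partial>P) = (if j = k then 1 else 0)" for j k
    using orthonormal_ip[OF o[of "Suc (max j k)"], of j k] by simp
  \<comment> \<open>For a finite orthonormal system \<open>g\<close> the coefficient variances add
    up to a series in which Bessel bounds the factor of each eigenvalue by 1; what \<open>g\<close>
    misses of the trace is below \<open>\<epsilon>\<close>.\<close>
  have trace: "sqnorm hf \<le> suminf lam"
  proof (rule field_le_epsilon)
    fix \<epsilon> :: real assume "0 < \<epsilon>"
    then obtain p g where g: "orthonormal P p g" and err: "proj_err p g < \<epsilon>"
      using finite_rank_approximation by blast
    have gs: "(\<lambda>k. lam k * (\<integral>x. g j x * E k x \<partial>P)\<^sup>2) sums (\<integral>f. (coef g j f)\<^sup>2 \<partial>\<mu>)" if "j < p" for j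
      by (rule sums[OF orthonormal_sq[OF g that]])
    have "(\<lambda>k. \<Sum>j<p. lam k * (\<integral>x. g j x * E k x \<partial>P)\<^sup>2) sums (\<Sum>j<p. \<integral>f. (coef g j f)\<^sup>2 \<partial>\<mu>)"
      using gs by (intro sums_sum) auto
    then have "(\<Sum>j<p. \<integral>f. (coef g j f)\<^sup>2 \<partial>\<mu>) \<le> suminf lam"
    proof (rule sums_le[rotated])
      show "lam sums suminf lam" by (rule summable_sums[OF sm])
      fix k
      have "(\<Sum>j<p. (\<integral>x. g j x * E k x \<partial>P)\<^sup>2) \<le> 1"
        using bessel[OF g Es[of k]] EE[of k k] by (simp add: mult.commute power2_eq_square[of "E k _"])
      then have "lam k * (\<Sum>j<p. (\<integral>x. g j x * E k x \<partial>P)\<^sup>2) \<le> lam k * 1"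
        using nn by (intro mult_left_mono) auto
      then show "(\<Sum>j<p. lam k * (\<integral>x. g j x * E k x \<partial>P)\<^sup>2) \<le> lam k"
        by (simp add: sum_distrib_left)
    qed
    then show "sqnorm hf \<le> suminf lam + \<epsilon>" using sqnorm_hf_eq[OF g] err by linarith
  qed
  have lam: "(\<integral>f. (coef E k f)\<^sup>2 \<partial>\<mu>) = lam k" for k
  proof -
    \<comment> \<open>Testing the covariance with an eigenfunction leaves a single term of the
      series.\<close>
    have "(\<lambda>j. if j = k then lam j else 0) sums (\<integral>f. (coef E k f)\<^sup>2 \<partial>\<mu>)"
      using sums[OF Es[of k]] by (simp add: EE if_distrib[of "\<lambda>x. x\<^sup>2"] if_distrib[of "(*) _"] eq_commute[of k] cong: if_cong)
    moreover have "(\<lambda>j. if j = k then lam j else 0) sums lam k" by (rule sums_single)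
    ultimately show ?thesis by (rule sums_unique2)
  qed
  have "enn2real (min_err2 Lambda_all m) \<le> enn2real (ennreal (proj_err m E))"
    by (intro enn2real_mono Lambda_all_upper_bound o) simp
  also have "\<dots> = proj_err m E" by (intro enn2real_ennreal sqnorm_nonneg)
  also have "\<dots> = sqnorm hf - (\<Sum>k<m. lam k)" using sqnorm_hf_eq[OF o[of m]] by (simp add: lam)
  also have "\<dots> \<le> suminf lam - (\<Sum>k<m. lam k)" using trace by simp
  finally show ?thesis by (simp add: e_avg_eq)
qed

text \<open>The hypothesis concerns square roots, so the eigenvalues decay like powers of
  \<open>q\<^sup>2\<close> and their tail has the denominator \<open>1 - q\<^sup>2\<close>. The
  exponent \<open>Suc k\<close> reflects that \<open>lam k\<close> is eigenvalue number
  \<open>k + 1\<close>.\<close>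

lemma std_geometric_decay:
  assumes cov: "cov_eigenvalues \<mu> evl D \<rho> lam" and A: "A \<ge> 1" and q: "0 < q" "q < 1"
    and le: "\<And>k. sqrt (lam k) \<le> A * q ^ Suc k * e_avg \<mu> evl D \<rho> Lambda_all 0"
  shows "e_avg \<mu> evl D \<rho> (Lambda_std evl D) n
    \<le> 4 * A / (1 - q) * (q powr (1 / (48 * sqrt 2))) powr (real n / ln (4 * real n)) * e_avg \<mu> evl D \<rho> Lambda_all 0"
proof -
  define e0 where "e0 = e_avg \<mu> evl D \<rho> Lambda_all 0"
  define m where "m = m_of n"
  have e0: "0 \<le> e0" by (simp add: e0_def e_avg_eq)
  have nn: "0 \<le> lam k" for k using cov by (simp add: cov_eigenvalues_def)
  have q2: "0 < q\<^sup>2" "q\<^sup>2 < 1" using q by (auto simp: power_less_one_iff)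
  have sqpow: "(q\<^sup>2) ^ k = (q ^ k)\<^sup>2" for k
    by (rule trans[OF power_mult[symmetric] power_even_eq])
  have lam: "lam k \<le> (A * e0)\<^sup>2 * (q\<^sup>2) ^ Suc k" for k
  proof -
    have "lam k = (sqrt (lam k))\<^sup>2" using nn by simp
    also have "\<dots> \<le> (A * q ^ Suc k * e0)\<^sup>2" using le[of k] nn by (intro power_mono) (auto simp: e0_def)
    also have "\<dots> = (A * e0)\<^sup>2 * (q\<^sup>2) ^ Suc k" unfolding power_mult_distrib sqpow by (simp only: mult_ac)
    finally show ?thesis .
  qed
  note tail = suminf_tail_le[of lam "(A * e0)\<^sup>2" "q\<^sup>2", OF nn lam q2]
  \<comment> \<open>This replaces the denominator by a perfect square, so that the root of the tail
    bound has the denominator \<open>1 - q\<close>.\<close>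
  have "(1 - q)\<^sup>2 \<le> 1 - q\<^sup>2"
  proof -
    have "0 \<le> 2 * q * (1 - q)" using q by simp
    then show ?thesis by (simp add: power2_eq_square algebra_simps)
  qed
  moreover have "0 < (1 - q)\<^sup>2" using q by simp
  ultimately have "(A * e0)\<^sup>2 * (q\<^sup>2) ^ Suc m / (1 - q\<^sup>2) \<le> (A * e0)\<^sup>2 * (q\<^sup>2) ^ Suc m / (1 - q)\<^sup>2"
    using q2 by (intro divide_left_mono mult_nonneg_nonneg mult_pos_pos) auto
  also have "\<dots> = (A * e0 * q ^ Suc m / (1 - q))\<^sup>2"
    unfolding power_divide power_mult_distrib sqpow ..
  finally have fin: "(A * e0)\<^sup>2 * (q\<^sup>2) ^ Suc m / (1 - q\<^sup>2) \<le> (A * e0 * q ^ Suc m / (1 - q))\<^sup>2" .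
  have head: "(e_avg \<mu> evl D \<rho> Lambda_all m)\<^sup>2 \<le> suminf lam - (\<Sum>k<m. lam k)"
    by (rule e_avg_all_le_eigenvalue_tail[OF cov tail(1) nn])
  have "(e_avg \<mu> evl D \<rho> Lambda_all m)\<^sup>2 \<le> (A * e0 * q ^ Suc m / (1 - q))\<^sup>2"
    by (rule order_trans[OF head order_trans[OF tail(2)[of m] fin]])
  then have all: "e_avg \<mu> evl D \<rho> Lambda_all m \<le> A * e0 * q ^ Suc m / (1 - q)"
  proof (rule power2_le_imp_le)
    show "0 \<le> A * e0 * q ^ Suc m / (1 - q)"
      using A e0 q by (intro divide_nonneg_nonneg mult_nonneg_nonneg zero_le_power; linarith)
  qed
  have "e_avg \<mu> evl D \<rho> (Lambda_std evl D) n \<le> 4 * e_avg \<mu> evl D \<rho> Lambda_all m"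
    unfolding m_def by (rule std_le_all)
  also have "\<dots> \<le> 4 * (A * e0 * q ^ Suc m / (1 - q))" by (intro mult_left_mono all) simp
  also have "\<dots> = 4 * A / (1 - q) * q ^ Suc m * e0" by simp
  also have "\<dots> \<le> 4 * A / (1 - q) * (q powr (1 / (48 * sqrt 2))) powr (real n / ln (4 * real n)) * e0"
    unfolding m_def using A q e0
    by (intro mult_right_mono mult_left_mono power_Suc_m_of_le divide_nonneg_nonneg; linarith)
  finally show ?thesis by (simp add: e0_def)
qed

end

theorem theorem5p1:
  fixes D :: "(real^'d) set" and \<rho> :: "real^'d \<Rightarrow> real"
    and evl :: "'f::{banach,second_countable_topology} \<Rightarrow> real^'d \<Rightarrow> real"
    and \<mu> :: "'f measure"
  assumes "avg_setting D \<rho> evl" and "centered_gaussian \<mu>"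
  shows "(\<forall>n::nat. e_avg \<mu> evl D \<rho> (Lambda_std evl D) n
                  \<le> 4 * e_avg \<mu> evl D \<rho> Lambda_all (m_of n))
       \<and> (\<forall>lam A q. cov_eigenvalues \<mu> evl D \<rho> lam \<and> A \<ge> 1 \<and> 0 < q \<and> q < 1 \<and>
            (\<forall>k. sqrt (lam k) \<le> A * q ^ Suc k * e_avg \<mu> evl D \<rho> Lambda_all 0) \<longrightarrow>
            (let q2 = q powr (1 / (48 * sqrt 2)) in
               q < q2 \<and> q2 < 1 \<and>
               (\<forall>n::nat. m_of n \<ge> 1 \<longrightarrow>
                  e_avg \<mu> evl D \<rho> (Lambda_std evl D) n
                  \<le> 4 * A / (1 - q) * q2 powr (real n / ln (4 * real n))
                    * e_avg \<mu> evl D \<rho> Lambda_all 0)))"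
proof -
  interpret avg_case D \<rho> evl \<mu> using assms by (rule avg_case.intro)
  have c: "1 / (48 * sqrt 2) < (1::real)"
  proof -
    have "1 < sqrt (2::real)" by simp
    then have "1 < 48 * sqrt (2::real)" by linarith
    then show ?thesis by (simp add: divide_less_eq)
  qed
  have q2: "q < q powr (1 / (48 * sqrt 2))" "q powr (1 / (48 * sqrt 2)) < 1" if "0 < q" "q < 1" for q :: real
    using powr_less_mono'[OF that c] powr_less_mono'[OF that, of 0 "1 / (48 * sqrt 2)"] that by simp_all
  show ?thesis
    using std_le_all q2 std_geometric_decay unfolding Let_def by blast
qed

end
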